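(* Let $\phi\colon\Gamma\to B$ be a strong formal subdivision of rank $0$, where $\Gamma$ is a lower Eulerian poset and $B$ is an Eulerian poset. The linear maps $L_\Omega\colon R_\Omega\to\mathbf K[t,u]$ and $H'_\Omega\colon R_\Omega\to\mathbf K[t,t',u,u']$ send the mixed $cd$-index $\Omega_\phi$ to the local $h$-polynomial and the mixed $h$-polynomial respectively, i.e. \[L_\Omega(\Omega_\phi)=\ell^h_B(\Gamma;t,u)\qquad\text{and}\qquad H'_\Omega(\Omega_\phi)=h_B(\Gamma;t',u',t,u).\]
   Context: Posets. All posets are finite and graded (all maximal chains have the same length, called the rank, $\mathrm{rank}$) with a unique minimal element $\hat 0$; $\hat 1$ is the unique maximal element if it exists; $\rho(x)=\mathrm{rank}([\hat 0,x])$. The boundary $\partial P$ of a poset of rank $n$ is the lower order ideal generated by the rank $n-1$ elements covered by exactly one element. $P$ is Eulerian if it has $\hat 0,\hat 1$ and every interval of positive rank has as many elements of even rank as of odd rank; lower Eulerian if it has $\hat 0$ and every interval is Eulerian; a rank $n$ poset $P$ is near-Eulerian if $P=Q\setminus\{q,\hat 1\}$ with $Q$ Eulerian of rank $n+1$ and $q\in Q$ of rank $n$. The semisuspension $\widetilde\Sigma P$ of a rank $n$ poset is $P\cup\{q\}$ with a new rank $n$ element $q$ lying above exactly the elements of $\partial P$. $P^*$ denotes the dual poset. $cd$-index. $\mathbf K$ is a field of characteristic $0$. For $P$ of rank $n$, $\Psi_P=\sum_{S\subseteq[n]}\beta_P(S)u_S\in\mathbf K\langle a,b\rangle$, where $\beta_P(S)=\sum_{T\subseteq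 S}(-1)^{\#(S\setminus T)}\alpha_P(T)$, $\alpha_P(T)$ is the number of chains $\hat 0<x_1<\dots<x_k$ with $\{\rho(x_i)\}=T$, and $u_S=u_1\cdots u_n$ with $u_i=b$ if $i\in S$, $u_i=a$ otherwise. If $Q$ is the boundary of an Eulerian poset of positive rank, $\Phi_Q(c,d)$ is the unique polynomial with $\Phi_Q(a+b,ab+ba)=\Psi_Q$ (so it is $1$ for $Q=\partial P$ with $P$ of rank $1$). For near-Eulerian $P$ the local $cd$-index is $\ell^\Phi_P=\Phi_{\widetilde\Sigma P}-\Phi_{\partial P}\cdot c$ (here $\widetilde\Sigma P$ and $\partial P$ are boundaries of Eulerian posets); for the singleton poset it is $1$. For an Eulerian poset $P$ of positive rank $\Phi_P:=\Phi_{\partial P}$; for an Eulerian poset of rank $0$ (singleton), $\Phi_P:=e$, where $e$ is a new symbol. Spaces. With $c=a+b$, $d=ab+ba$, $R_\Phi=\mathbf K\langle c,d\rangle\subset R_\Psi=\mathbf K\langle a,b\rangle$. $R^e_\Psi$ is the quotient of $\mathbf K\langle a,b,e\rangle$ by the two-sided ideal generated by $e^2,ea,eb,ae,be$ (underlying vector space $R_\Psi\oplus\mathbf Ke$), and $R^e_\Phi=R_\Phi\oplus\mathbf Ke\subset R^e_\Psi$. $R'_\Phi=\mathbf K\langle c',d'\rangle$ is a primed copy of $R_\Phi$, and $R_\Omega=R'_\Phi\otimes_{\mathbf K}R^e_\Phi$, writing $w'\cdot w$ for $w'\otimes w$. Degrees: $\deg c=\deg c'=1$, $\deg d=\deg d'=2$,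 $\deg e=-1$ ($\deg a=\deg b=1$). The coproduct $\Delta\colon R^e_\Psi\to R^e_\Psi\otimes R^e_\Psi$ is linear with $\Delta(e)=e\otimes e$ and, for a monomial $w=w_1\cdots w_n$ in $a,b$, $\Delta(w)=e\otimes w+\sum_{i=1}^n w_1\cdots w_{i-1}\otimes w_{i+1}\cdots w_n+w\otimes e$; it restricts to $R^e_\Phi\to R^e_\Phi\otimes R^e_\Phi$. The map $\varrho\colon R_\Omega\to R_\Omega\otimes R^e_\Phi$ is linear with $\varrho(w'\cdot w)=w'\cdot\Delta(w)$, where $w'\cdot(w_1\otimes w_2)=(w'\cdot w_1)\otimes w_2$. Strong formal subdivisions. A strong formal subdivision of rank $0$ is a surjective map $\phi\colon\Gamma\to B$ (with natural rank functions, $\rho(\hat 0)=0$) that is order-preserving, rank-increasing ($\rho(y)\le\rho(\phi(y))$), and such that for all $y\in\Gamma$, $x\in B$ with $\phi(y)\le x$: (1) there is $y'\ge y$ with $\phi(y')=x$, $\rho(y')=\rho(x)$; (2) $\sum_{y'\in\phi^{-1}(x),\,y\le y'}(-1)^{\rho(y')}=(-1)^{\rho(x)}$. Put $\Gamma_x=\{y\in\Gamma\mid\phi(y)\le x\}$; for $x\neq\hat 0$ it is near-Eulerian, and $\Gamma_{\hat 0}=\{\hat 0\}$. The mixed $cd$-index is $\Omega_\phi(c',d',c,d,e)=\sum_{x\in B}\ell^\Phi_{\Gamma_x}(c',d')\cdot\Phi_{[x,\hat 1]}(c,d,e)\in R_\Omega$. $h$-polynomials. For $f\in\mathbb Z[t,u]$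 put $\overline f(t,u)=f(u,t)$. For $B$ Eulerian of rank $n$, $g(B;t,u)$ is homogeneous of total degree $n$: $g=1$ if $n=0$, and for $n>0$ it is the unique such polynomial of $t$-degree $<n/2$ with $\overline g(B;t,u)=\sum_{x\in B}g([\hat 0,x];t,u)(t-u)^{n-\rho(x)}$. For $\Gamma$ lower Eulerian of rank $n$, $h$ is given by $\overline h(\Gamma;t,u)=\sum_{x\in\Gamma}g([\hat 0,x];t,u)(t-u)^{n-\rho(x)}$. The local $h$-polynomial is $\ell^h_B(\Gamma;t,u)=\sum_{x\in B}h(\Gamma_x;t,u)(-1)^{\mathrm{rank}([x,\hat 1])}g([x,\hat 1]^*;t,u)$. The mixed $h$-polynomial is $h_B(\Gamma;t',u',t,u)=\sum_{x\in B}(t'u')^{\mathrm{rank}(\Gamma_x)}\,\ell^h_{[\hat 0,x]}(\Gamma_x;t/t',u/u')\,g([x,\hat 1];tt',uu')$. Linear maps. $\nabla$ denotes multiplication $v\otimes w\mapsto vw$ of polynomials. $\kappa\colon R^e_\Psi\to\mathbf K[t,u]$ is linear with $\kappa(a^n)=(t-u)^n$ ($n\ge0$) and $\kappa(w)=0$ for all other monomials (including $e$). $F,G\colon R^e_\Psi\to\mathbf K[t,u]$ are linear, defined recursively: $F(e)=0$, $G(e)=1$; for a monomial $w\ne e$ in $a,b$, $\overline{F(w)}=(\nabla\circ(G\otimes\kappa)\circ\Delta)(w)$; and for such $w$ of degree $n$, $G(w)$ is the sum of the monomials of $(u-t)F(w)$ of $t$-degree strictly less than $(n+1)/2$. $G^*\colon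 R^e_\Psi\to\mathbf K[t,u]$ is linear with $G^*(e)=1$ and $G^*(w_1\cdots w_n)=(-1)^{n+1}G(w_n\cdots w_1)$ for letters $w_i\in\{a,b\}$. $H_\Omega\colon R_\Omega\to\mathbf K[t,u]$ is linear with, for a monomial $w'$ in $c',d'$ and a monomial $w$ of $R^e_\Phi$ ($w=e$ or a monomial in $c,d$): $H_\Omega(w'\cdot w)=F(w'|_{c'\mapsto c,d'\mapsto d})$ if $w=e$, and $H_\Omega(w'\cdot w)=G(w'|_{c'\mapsto c,d'\mapsto d}\cdot w)$ otherwise. Finally $L_\Omega:=\nabla\circ(H_\Omega\otimes G^* )\circ\varrho$; $L'_\Omega\colon R_\Omega\to\mathbf K[t,t',u,u']$ is linear with $L'_\Omega(w)=(t'u')^{\deg(w)+1}L_\Omega(w)(t/t',u/u')$ for monomials $w$; $G'\colon R^e_\Phi\to\mathbf K[t,t',u,u']$, $G'(w)=G(w)(tt',uu')$; and $H'_\Omega:=\nabla\circ(L'_\Omega\otimes G')\circ\varrho$. *)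

theory Defs
  imports Complex_Main "HOL-Library.Poly_Mapping" "HOL-Library.Product_Plus"
begin

section \<open>Posets\<close>

text \<open>
  A poset is given by its reflexive order relation \<open>r\<close>, with underlying set \<^term>\<open>Field r\<close>;
  a subposet is a restriction \<^term>\<open>Restr r A\<close>, and the dual poset is \<^term>\<open>r\<inverse>\<close>.
\<close>

definition is_minimal :: "'a rel \<Rightarrow> 'a \<Rightarrow> bool" where
  "is_minimal r x \<longleftrightarrow> x \<in> Field r \<and> (\<forall>y. (y, x) \<in> r \<longrightarrow> y = x)"

definition is_maximal :: "'a rel \<Rightarrow> 'a \<Rightarrow> bool" where
  "is_maximal r x \<longleftrightarrow> x \<in> Field r \<and> (\<forall>y. (x, y) \<in> r \<longrightarrow> y = x)"

definition zero_hat :: "'a rel \<Rightarrow> 'a" where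
  "zero_hat r = (THE x. is_minimal r x)"

definition one_hat :: "'a rel \<Rightarrow> 'a" where
  "one_hat r = (THE x. is_maximal r x)"

definition maximal_chain :: "'a rel \<Rightarrow> 'a set \<Rightarrow> bool" where
  "maximal_chain r C \<longleftrightarrow> C \<in> Chains r \<and> (\<forall>D \<in> Chains r. C \<subseteq> D \<longrightarrow> D = C)"

text \<open>The length of a chain is its number of elements minus one.\<close>

definition poset_rank :: "'a rel \<Rightarrow> nat" where
  "poset_rank r = Max (card ` Chains r) - 1"

definition graded_poset :: "'a rel \<Rightarrow> bool" where
  "graded_poset r \<longleftrightarrow> Partial_order r \<and> finite (Field r) \<and> (\<exists>!x. is_minimal r x) \<and>
     (\<forall>C D. maximal_chain r C \<longrightarrow> maximal_chain r D \<longrightarrow> card C = card D)"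

definition interval :: "'a rel \<Rightarrow> 'a \<Rightarrow> 'a \<Rightarrow> 'a rel" where
  "interval r x y = Restr r {z. (x, z) \<in> r \<and> (z, y) \<in> r}"

definition rho :: "'a rel \<Rightarrow> 'a \<Rightarrow> nat" where
  "rho r x = poset_rank (interval r (zero_hat r) x)"

definition covers :: "'a rel \<Rightarrow> 'a \<Rightarrow> 'a \<Rightarrow> bool" where
  "covers r z y \<longleftrightarrow> (y, z) \<in> r \<and> y \<noteq> z \<and> (\<forall>w. (y, w) \<in> r \<longrightarrow> (w, z) \<in> r \<longrightarrow> w = y \<or> w = z)"

definition boundary :: "'a rel \<Rightarrow> 'a rel" where
  "boundary r = Restr r {x. \<exists>y \<in> Field r. rho r y + 1 = poset_rank r \<and>
     (\<exists>!z. covers r z y) \<and> (x, y) \<in> r}"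

definition eulerian :: "'a rel \<Rightarrow> bool" where
  "eulerian r \<longleftrightarrow> graded_poset r \<and> (\<exists>!x. is_maximal r x) \<and>
     (\<forall>x y. (x, y) \<in> r \<longrightarrow> poset_rank (interval r x y) > 0 \<longrightarrow>
        card {z \<in> Field (interval r x y). even (rho r z)} =
        card {z \<in> Field (interval r x y). odd (rho r z)})"

definition lower_eulerian :: "'a rel \<Rightarrow> bool" where
  "lower_eulerian r \<longleftrightarrow> graded_poset r \<and> (\<forall>x y. (x, y) \<in> r \<longrightarrow> eulerian (interval r x y))"

text \<open>The new element \<open>q\<close> of the semisuspension is \<^const>\<open>None\<close>.\<close>

definition semisuspension :: "'a rel \<Rightarrow> 'a option rel" where
  "semisuspension r = {(Some x, Some y) | x y. (x, y) \<in> r} \<union>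
     {(Some x, None) | x. x \<in> Field (boundary r)} \<union> {(None, None)}"

text \<open>Strong formal subdivisions of rank 0, with respect to the natural rank functions.\<close>

definition strong_formal_subdivision :: "'a rel \<Rightarrow> 'b rel \<Rightarrow> ('a \<Rightarrow> 'b) \<Rightarrow> bool" where
  "strong_formal_subdivision \<Gamma> B \<phi> \<longleftrightarrow>
     \<phi> ` Field \<Gamma> = Field B \<and>
     (\<forall>y y'. (y, y') \<in> \<Gamma> \<longrightarrow> (\<phi> y, \<phi> y') \<in> B) \<and>
     (\<forall>y \<in> Field \<Gamma>. rho \<Gamma> y \<le> rho B (\<phi> y)) \<and>
     (\<forall>y \<in> Field \<Gamma>. \<forall>x \<in> Field B. (\<phi> y, x) \<in> B \<longrightarrow>
        (\<exists>y'. (y, y') \<in> \<Gamma> \<and> \<phi> y' = x \<and> rho \<Gamma> y' = rho B x) \<and>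
        (\<Sum>y' | (y, y') \<in> \<Gamma> \<and> \<phi> y' = x. (-1) ^ rho \<Gamma> y') = ((-1) ^ rho B x :: int))"

definition subdiv_below :: "'a rel \<Rightarrow> 'b rel \<Rightarrow> ('a \<Rightarrow> 'b) \<Rightarrow> 'b \<Rightarrow> 'a rel" where
  "subdiv_below \<Gamma> B \<phi> x = Restr \<Gamma> {y \<in> Field \<Gamma>. (\<phi> y, x) \<in> B}"


section \<open>Vector spaces with a monomial basis\<close>

text \<open>
  All vector spaces below are free on a type of monomials: \<open>'m \<Rightarrow>\<^sub>0 'k\<close> is the space
  with basis \<open>'m\<close>. The tensor product of two of them has basis the pairs of monomials.
\<close>

abbreviation mon :: "'m \<Rightarrow> 'm \<Rightarrow>\<^sub>0 'k::zero_neq_one" where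
  "mon m \<equiv> Poly_Mapping.single m 1"

definition lin :: "('m \<Rightarrow> 'n \<Rightarrow>\<^sub>0 'k) \<Rightarrow> ('m \<Rightarrow>\<^sub>0 'k) \<Rightarrow> 'n \<Rightarrow>\<^sub>0 'k::comm_ring_1" where
  "lin f p = (\<Sum>m \<in> Poly_Mapping.keys p.
     Poly_Mapping.map (\<lambda>k. Poly_Mapping.lookup p m * k) (f m))"

definition tensor :: "('m \<Rightarrow>\<^sub>0 'k) \<Rightarrow> ('n \<Rightarrow>\<^sub>0 'k) \<Rightarrow> 'm \<times> 'n \<Rightarrow>\<^sub>0 'k::comm_ring_1" where
  "tensor p q = lin (\<lambda>m. lin (\<lambda>n. mon (m, n)) q) p"

text \<open>The maps \<open>f \<otimes> g\<close> and \<open>\<nabla> \<circ> (f \<otimes> g)\<close> for linear \<open>f\<close> and \<open>g\<close>.\<close>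

definition tensor_map :: "(('m \<Rightarrow>\<^sub>0 'k) \<Rightarrow> 'p \<Rightarrow>\<^sub>0 'k) \<Rightarrow> (('n \<Rightarrow>\<^sub>0 'k) \<Rightarrow> 'q \<Rightarrow>\<^sub>0 'k) \<Rightarrow>
    ('m \<times> 'n \<Rightarrow>\<^sub>0 'k) \<Rightarrow> 'p \<times> 'q \<Rightarrow>\<^sub>0 'k::comm_ring_1" where
  "tensor_map f g = lin (\<lambda>(m, n). tensor (f (mon m)) (g (mon n)))"

definition nabla_tensor :: "(('m \<Rightarrow>\<^sub>0 'k) \<Rightarrow> 'p \<Rightarrow>\<^sub>0 'k) \<Rightarrow> (('n \<Rightarrow>\<^sub>0 'k) \<Rightarrow> 'p \<Rightarrow>\<^sub>0 'k) \<Rightarrow>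
    ('m \<times> 'n \<Rightarrow>\<^sub>0 'k) \<Rightarrow> 'p::comm_monoid_add \<Rightarrow>\<^sub>0 'k::comm_ring_1" where
  "nabla_tensor f g = lin (\<lambda>(m, n). f (mon m) * g (mon n))"

text \<open>With concatenation of words as monoid operation, \<open>'x list \<Rightarrow>\<^sub>0 'k\<close> is the free
  associative algebra on the letters \<open>'x\<close>.\<close>

instantiation list :: (type) monoid_add
begin

definition zero_list :: "'a list" where "zero_list = []"

definition plus_list :: "'a list \<Rightarrow> 'a list \<Rightarrow> 'a list" where "plus_list = (@)"

instance
  by standard (simp_all add: zero_list_def plus_list_def)

end

datatype ab = La | Lb
datatype cd = Lc | Ld

text \<open>Monomials of \<open>R\<^sup>e\<close>: the symbol \<open>e\<close>, or a word.\<close>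

datatype 'x emon = E | W "'x list"

type_synonym 'k R_Psi = "ab list \<Rightarrow>\<^sub>0 'k"
type_synonym 'k R_Phi = "cd list \<Rightarrow>\<^sub>0 'k"
type_synonym 'k Re_Psi = "ab emon \<Rightarrow>\<^sub>0 'k"
type_synonym 'k Re_Phi = "cd emon \<Rightarrow>\<^sub>0 'k"

text \<open>The first factor of \<open>R\<^sub>\<Omega>\<close> is the primed copy of \<open>R\<^sub>\<Phi>\<close>.\<close>

type_synonym 'k R_Omega = "cd list \<times> cd emon \<Rightarrow>\<^sub>0 'k"

text \<open>The inclusions \<open>R\<^sub>\<Phi> \<subseteq> R\<^sub>\<Psi>\<close> and \<open>R\<^sup>e\<^sub>\<Phi> \<subseteq> R\<^sup>e\<^sub>\<Psi>\<close>
  given by \<open>c = a + b\<close> and \<open>d = ab + ba\<close>.\<close>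

fun cd_letter :: "cd \<Rightarrow> 'k::comm_ring_1 R_Psi" where
  "cd_letter Lc = mon [La] + mon [Lb]"
| "cd_letter Ld = mon [La] * mon [Lb] + mon [Lb] * mon [La]"

definition cd_to_ab :: "'k::comm_ring_1 R_Phi \<Rightarrow> 'k R_Psi" where
  "cd_to_ab = lin (\<lambda>w. prod_list (map cd_letter w))"

definition words_to_e :: "('x list \<Rightarrow>\<^sub>0 'k) \<Rightarrow> 'x emon \<Rightarrow>\<^sub>0 'k::comm_ring_1" where
  "words_to_e = lin (\<lambda>w. mon (W w))"

definition cd_to_ab_e :: "'k::comm_ring_1 Re_Phi \<Rightarrow> 'k Re_Psi" where
  "cd_to_ab_e = lin (\<lambda>m. case m of E \<Rightarrow> mon E | W w \<Rightarrow> words_to_e (cd_to_ab (mon w)))"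


section \<open>The cd-index, the local cd-index and the mixed cd-index\<close>

definition flag_alpha :: "'a rel \<Rightarrow> nat set \<Rightarrow> nat" where
  "flag_alpha r T = card {C \<in> Chains r. zero_hat r \<notin> C \<and> rho r ` C = T}"

definition flag_beta :: "'a rel \<Rightarrow> nat set \<Rightarrow> int" where
  "flag_beta r S = (\<Sum>T \<in> Pow S. (-1) ^ card (S - T) * int (flag_alpha r T))"

definition ab_index :: "'a rel \<Rightarrow> 'k::comm_ring_1 R_Psi" where
  "ab_index r = (let n = poset_rank r in
     \<Sum>S \<in> Pow {1..n}. Poly_Mapping.single
       (map (\<lambda>i. if i \<in> S then Lb else La) [1..<Suc n]) (of_int (flag_beta r S)))"

text \<open>\<open>\<Phi>\<^sub>Q\<close> for \<open>Q\<close> the boundary of an Eulerian poset of positive rank;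
  \<open>\<Phi>\<^sub>Q(a + b, ab + ba)\<close> is the image of \<open>\<Phi>\<^sub>Q\<close> under \<^const>\<open>cd_to_ab\<close>.\<close>

definition cd_index_boundary :: "'a rel \<Rightarrow> 'k::comm_ring_1 R_Phi" where
  "cd_index_boundary r = (THE p. cd_to_ab p = ab_index r)"

text \<open>\<open>\<Phi>\<^sub>P\<close> for \<open>P\<close> an Eulerian poset.\<close>

definition cd_index :: "'a rel \<Rightarrow> 'k::comm_ring_1 Re_Phi" where
  "cd_index r = (if poset_rank r = 0 then mon E else words_to_e (cd_index_boundary (boundary r)))"

text \<open>The local cd-index of a near-Eulerian or singleton poset.\<close>

definition local_cd_index :: "'a rel \<Rightarrow> 'k::comm_ring_1 R_Phi" where
  "local_cd_index r = (if card (Field r) = 1 then 1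
     else cd_index_boundary (semisuspension r) - cd_index_boundary (boundary r) * mon [Lc])"

definition mixed_cd_index :: "'a rel \<Rightarrow> 'b rel \<Rightarrow> ('a \<Rightarrow> 'b) \<Rightarrow> 'k::comm_ring_1 R_Omega" where
  "mixed_cd_index \<Gamma> B \<phi> = (\<Sum>x \<in> Field B.
     tensor (local_cd_index (subdiv_below \<Gamma> B \<phi> x)) (cd_index (interval B x (one_hat B))))"


section \<open>Commutative polynomials\<close>

text \<open>The exponent pair \<open>(i, j)\<close> stands for \<open>t\<^sup>i u\<^sup>j\<close>.\<close>

type_synonym 'k poly_tu = "nat \<times> nat \<Rightarrow>\<^sub>0 'k"

definition var_t :: "'k::comm_ring_1 poly_tu" where "var_t = mon (1, 0)"
definition var_u :: "'k::comm_ring_1 poly_tu" where "var_u = mon (0, 1)"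

definition bar :: "'k::comm_ring_1 poly_tu \<Rightarrow> 'k poly_tu" where
  "bar = lin (\<lambda>(i, j). mon (j, i))"

definition homogeneous :: "nat \<Rightarrow> 'k::comm_ring_1 poly_tu \<Rightarrow> bool" where
  "homogeneous n p \<longleftrightarrow> (\<forall>(i, j) \<in> Poly_Mapping.keys p. i + j = n)"

definition t_degree_less_half :: "nat \<Rightarrow> 'k::comm_ring_1 poly_tu \<Rightarrow> bool" where
  "t_degree_less_half n p \<longleftrightarrow> (\<forall>(i, j) \<in> Poly_Mapping.keys p. 2 * i < n)"

definition t_lower_half :: "nat \<Rightarrow> 'k::comm_ring_1 poly_tu \<Rightarrow> 'k poly_tu" where
  "t_lower_half n = lin (\<lambda>(i, j). if 2 * i < n then mon (i, j) else 0)"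

text \<open>
  Since \<open>t / t'\<close> and \<open>u / u'\<close> occur, the polynomials in \<open>t, t', u, u'\<close> are viewed inside
  the ring of Laurent polynomials; the exponent \<open>((i, j), (k, l))\<close> stands for
  \<open>t\<^sup>i u\<^sup>j t'\<^sup>k u'\<^sup>l\<close>.
\<close>

type_synonym 'k laurent = "(int \<times> int) \<times> (int \<times> int) \<Rightarrow>\<^sub>0 'k"

definition subst_tu :: "'k laurent \<Rightarrow> 'k laurent \<Rightarrow> 'k::comm_ring_1 poly_tu \<Rightarrow> 'k laurent" where
  "subst_tu x y = lin (\<lambda>(i, j). x ^ i * y ^ j)"

text \<open>\<open>f(t/t', u/u')\<close>, \<open>f(tt', uu')\<close> and the element \<open>t'u'\<close>.\<close>

definition subst_quot :: "'k::comm_ring_1 poly_tu \<Rightarrow> 'k laurent" where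
  "subst_quot = subst_tu (mon ((1, 0), (-1, 0))) (mon ((0, 1), (0, -1)))"

definition subst_prod :: "'k::comm_ring_1 poly_tu \<Rightarrow> 'k laurent" where
  "subst_prod = subst_tu (mon ((1, 0), (1, 0))) (mon ((0, 1), (0, 1)))"

definition t'u' :: "'k::comm_ring_1 laurent" where
  "t'u' = mon ((0, 0), (1, 1))"

definition of_int_coeffs :: "('m \<Rightarrow>\<^sub>0 int) \<Rightarrow> 'm \<Rightarrow>\<^sub>0 'k::ring_1" where
  "of_int_coeffs = Poly_Mapping.map of_int"


section \<open>The g-, h-, local h- and mixed h-polynomials\<close>

lemma card_interval_less:
  assumes "eulerian r" "x \<in> Field r" "x \<noteq> one_hat r"
  shows "card (Field (interval r (zero_hat r) x)) < card (Field r)"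
proof -
  have ex: "\<exists>!x. is_maximal r x" and fin: "finite (Field r)"
    using assms(1) by (auto simp: eulerian_def graded_poset_def)
  have mx: "is_maximal r (one_hat r)"
    unfolding one_hat_def using ex by (rule theI')
  have "one_hat r \<notin> Field (interval r (zero_hat r) x)"
    using mx assms(3) by (auto simp: is_maximal_def interval_def Field_def)
  moreover have "Field (interval r (zero_hat r) x) \<subseteq> Field r"
    by (auto simp: interval_def Field_def)
  moreover have "one_hat r \<in> Field r"
    using mx by (simp add: is_maximal_def)
  ultimately have "Field (interval r (zero_hat r) x) \<subset> Field r"
    by blast
  then show ?thesis
    using fin by (simp add: psubset_card_mono)
qed

text \<open>
  The summand of the defining identity at the maximal element is \<open>g(B)\<close> itself,
  which is the unknown \<open>p\<close>. Posets that are not Eulerian are irrelevant and sent to 0.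
\<close>

function g_poly :: "'a rel \<Rightarrow> int poly_tu" where
  "g_poly r = (
     if \<not> eulerian r then 0
     else if poset_rank r = 0 then 1
     else THE p. homogeneous (poset_rank r) p \<and> t_degree_less_half (poset_rank r) p \<and>
       bar p = (\<Sum>x \<in> Field r.
         (if x = one_hat r then p else g_poly (interval r (zero_hat r) x)) *
         (var_t - var_u) ^ (poset_rank r - rho r x)))"
  by auto
termination
  by (relation "measure (\<lambda>r. card (Field r))") (auto intro: card_interval_less)

declare g_poly.simps [simp del]

definition h_poly :: "'a rel \<Rightarrow> int poly_tu" where
  "h_poly r = bar (\<Sum>x \<in> Field r.
     g_poly (interval r (zero_hat r) x) * (var_t - var_u) ^ (poset_rank r - rho r x))"

definition local_h_poly :: "'a rel \<Rightarrow> 'b rel \<Rightarrow> ('a \<Rightarrow> 'b) \<Rightarrow> int poly_tu" where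
  "local_h_poly \<Gamma> B \<phi> = (\<Sum>x \<in> Field B. h_poly (subdiv_below \<Gamma> B \<phi> x) *
     (-1) ^ poset_rank (interval B x (one_hat B)) * g_poly ((interval B x (one_hat B))\<inverse>))"

definition mixed_h_poly :: "'a rel \<Rightarrow> 'b rel \<Rightarrow> ('a \<Rightarrow> 'b) \<Rightarrow> int laurent" where
  "mixed_h_poly \<Gamma> B \<phi> = (\<Sum>x \<in> Field B. t'u' ^ poset_rank (subdiv_below \<Gamma> B \<phi> x) *
     subst_quot (local_h_poly (subdiv_below \<Gamma> B \<phi> x) (interval B (zero_hat B) x) \<phi>) *
     subst_prod (g_poly (interval B x (one_hat B))))"


section \<open>The linear maps\<close>

fun Delta_mon :: "'x emon \<Rightarrow> 'x emon \<times> 'x emon \<Rightarrow>\<^sub>0 'k::comm_ring_1" where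
  "Delta_mon E = mon (E, E)"
| "Delta_mon (W w) = mon (E, W w) +
     (\<Sum>i<length w. mon (W (take i w), W (drop (Suc i) w))) + mon (W w, E)"

definition Delta :: "'k::comm_ring_1 Re_Psi \<Rightarrow> ab emon \<times> ab emon \<Rightarrow>\<^sub>0 'k" where
  "Delta = lin Delta_mon"

text \<open>The restriction \<open>R\<^sup>e\<^sub>\<Phi> \<rightarrow> R\<^sup>e\<^sub>\<Phi> \<otimes> R\<^sup>e\<^sub>\<Phi>\<close> of \<^const>\<open>Delta\<close>.\<close>

definition Delta_Phi :: "'k::comm_ring_1 Re_Phi \<Rightarrow> cd emon \<times> cd emon \<Rightarrow>\<^sub>0 'k" where
  "Delta_Phi p = (THE q. tensor_map cd_to_ab_e cd_to_ab_e q = Delta (cd_to_ab_e p))"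

definition varrho :: "'k::comm_ring_1 R_Omega \<Rightarrow> (cd list \<times> cd emon) \<times> cd emon \<Rightarrow>\<^sub>0 'k" where
  "varrho = lin (\<lambda>(w', w). lin (\<lambda>(w1, w2). mon ((w', w1), w2)) (Delta_Phi (mon w)))"

fun kappa_mon :: "ab emon \<Rightarrow> 'k::comm_ring_1 poly_tu" where
  "kappa_mon E = 0"
| "kappa_mon (W w) = (if set w \<subseteq> {La} then (var_t - var_u) ^ length w else 0)"

definition kappa :: "'k::comm_ring_1 Re_Psi \<Rightarrow> 'k poly_tu" where
  "kappa = lin kappa_mon"

text \<open>
  \<open>F\<close> and \<open>G\<close> on words. The summand of \<open>(\<nabla> \<circ> (G \<otimes> \<kappa>) \<circ> \<Delta>)(w)\<close> from \<open>e \<otimes> w\<close> is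
  \<open>G(e) \<kappa>(w) = \<kappa>(w)\<close>, and the one from \<open>w \<otimes> e\<close> vanishes because of \<open>\<kappa>(e) = 0\<close>; the
  recursion in its original form is the lemma \<open>bar_F_mon\<close> below.
\<close>

function F_word :: "ab list \<Rightarrow> 'k::comm_ring_1 poly_tu"
  and G_word :: "ab list \<Rightarrow> 'k::comm_ring_1 poly_tu" where
  "F_word w = bar (kappa_mon (W w) +
     (\<Sum>i<length w. G_word (take i w) * kappa_mon (W (drop (Suc i) w))))"
| "G_word w = t_lower_half (length w + 1) ((var_u - var_t) * F_word w)"
  by pat_completeness auto
termination
  by (relation "measure (\<lambda>x. case x of Inl w \<Rightarrow> 2 * length w | Inr w \<Rightarrow> 2 * length w + 1)") auto

declare F_word.simps [simp del] G_word.simps [simp del]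

fun F_mon :: "ab emon \<Rightarrow> 'k::comm_ring_1 poly_tu" where
  "F_mon E = 0"
| "F_mon (W w) = F_word w"

fun G_mon :: "ab emon \<Rightarrow> 'k::comm_ring_1 poly_tu" where
  "G_mon E = 1"
| "G_mon (W w) = G_word w"

fun Gstar_mon :: "ab emon \<Rightarrow> 'k::comm_ring_1 poly_tu" where
  "Gstar_mon E = 1"
| "Gstar_mon (W w) = (-1) ^ (length w + 1) * G_word (rev w)"

definition map_F :: "'k::comm_ring_1 Re_Psi \<Rightarrow> 'k poly_tu" where "map_F = lin F_mon"
definition map_G :: "'k::comm_ring_1 Re_Psi \<Rightarrow> 'k poly_tu" where "map_G = lin G_mon"
definition map_Gstar :: "'k::comm_ring_1 Re_Psi \<Rightarrow> 'k poly_tu" where "map_Gstar = lin Gstar_mon"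

fun H_Omega_mon :: "cd list \<times> cd emon \<Rightarrow> 'k::comm_ring_1 poly_tu" where
  "H_Omega_mon (w', E) = map_F (cd_to_ab_e (mon (W w')))"
| "H_Omega_mon (w', W w) = map_G (cd_to_ab_e (mon (W (w' @ w))))"

definition H_Omega :: "'k::comm_ring_1 R_Omega \<Rightarrow> 'k poly_tu" where
  "H_Omega = lin H_Omega_mon"

definition L_Omega :: "'k::comm_ring_1 R_Omega \<Rightarrow> 'k poly_tu" where
  "L_Omega p = nabla_tensor H_Omega (\<lambda>q. map_Gstar (cd_to_ab_e q)) (varrho p)"

fun deg_cd :: "cd \<Rightarrow> int" where
  "deg_cd Lc = 1"
| "deg_cd Ld = 2"

fun deg_emon :: "cd emon \<Rightarrow> int" where
  "deg_emon E = -1"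
| "deg_emon (W w) = sum_list (map deg_cd w)"

fun deg_Omega :: "cd list \<times> cd emon \<Rightarrow> int" where
  "deg_Omega (w', w) = sum_list (map deg_cd w') + deg_emon w"

text \<open>Degrees are at least \<open>-1\<close>, so \<^const>\<open>nat\<close> does not truncate.\<close>

definition L'_Omega :: "'k::comm_ring_1 R_Omega \<Rightarrow> 'k laurent" where
  "L'_Omega = lin (\<lambda>m. t'u' ^ nat (deg_Omega m + 1) * subst_quot (L_Omega (mon m)))"

definition map_G' :: "'k::comm_ring_1 Re_Phi \<Rightarrow> 'k laurent" where
  "map_G' p = subst_prod (map_G (cd_to_ab_e p))"

definition H'_Omega :: "'k::comm_ring_1 R_Omega \<Rightarrow> 'k laurent" where
  "H'_Omega p = nabla_tensor L'_Omega map_G' (varrho p)"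


section \<open>The recursion for F in its original form\<close>

lemma lookup_lin:
  "Poly_Mapping.lookup (lin f p) n =
     (\<Sum>m \<in> Poly_Mapping.keys p. Poly_Mapping.lookup p m * Poly_Mapping.lookup (f m) n)"
  by (auto simp: lin_def lookup_sum Poly_Mapping.map.rep_eq when_def intro!: sum.cong)

lemma lookup_lin_superset:
  assumes "finite A" "Poly_Mapping.keys p \<subseteq> A"
  shows "Poly_Mapping.lookup (lin f p) n =
     (\<Sum>m \<in> A. Poly_Mapping.lookup p m * Poly_Mapping.lookup (f m) n)"
  unfolding lookup_lin
  by (rule sum.mono_neutral_left) (use assms in \<open>auto simp: in_keys_iff\<close>)

lemma lin_zero [simp]: "lin f 0 = 0"
  by (simp add: lin_def)

lemma lin_add: "lin f (p + q) = lin f p + lin f q"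
proof (rule poly_mapping_eqI)
  fix n
  let ?A = "Poly_Mapping.keys p \<union> Poly_Mapping.keys q"
  have "Poly_Mapping.keys (p + q) \<subseteq> ?A"
    by (rule keys_add)
  then show "Poly_Mapping.lookup (lin f (p + q)) n = Poly_Mapping.lookup (lin f p + lin f q) n"
    by (simp add: lookup_lin_superset [where A = ?A] lookup_add distrib_right sum.distrib)
qed

lemma lin_sum: "lin f (\<Sum>i \<in> I. p i) = (\<Sum>i \<in> I. lin f (p i))"
  by (induction I rule: infinite_finite_induct) (simp_all add: lin_add)

lemma lin_mon [simp]: "lin f (mon m) = f m"
  by (rule poly_mapping_eqI) (simp add: lookup_lin)

lemma lookup_scale:
  "Poly_Mapping.lookup (Poly_Mapping.map (\<lambda>k. c * k) p) n =
     (c :: 'k::comm_ring_1) * Poly_Mapping.lookup p n"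
  by (simp add: Poly_Mapping.map.rep_eq when_def)

lemma lin_scale:
  "lin f (Poly_Mapping.map (\<lambda>k. c * k) p) = Poly_Mapping.map (\<lambda>k. c * k) (lin f p)"
proof (rule poly_mapping_eqI)
  fix n
  have "Poly_Mapping.keys (Poly_Mapping.map (\<lambda>k. c * k) p) \<subseteq> Poly_Mapping.keys p"
    by (auto simp: in_keys_iff lookup_scale)
  then show "Poly_Mapping.lookup (lin f (Poly_Mapping.map (\<lambda>k. c * k) p)) n =
      Poly_Mapping.lookup (Poly_Mapping.map (\<lambda>k. c * k) (lin f p)) n"
    by (simp add: lookup_lin_superset [where A = "Poly_Mapping.keys p"]
        lookup_scale sum_distrib_left mult.assoc)
qed

lemma lin_lin: "lin g (lin f p) = lin (\<lambda>m. lin g (f m)) p"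
  by (simp add: lin_def [of _ p] lin_sum lin_scale)

lemma lin_id: "lin mon p = p"
proof (rule poly_mapping_eqI)
  fix n
  show "Poly_Mapping.lookup (lin mon p) n = Poly_Mapping.lookup p n"
    by (cases "n \<in> Poly_Mapping.keys p")
       (auto simp: lookup_lin lookup_single when_def in_keys_iff if_distrib [of "(*) _"]
         cong: if_cong intro!: sum.neutral)
qed

lemma bar_bar [simp]: "bar (bar p) = p"
proof -
  have "(\<lambda>m. lin (\<lambda>(i, j). mon (j, i)) (case m of (i, j) \<Rightarrow> mon (j, i))) = (mon :: _ \<Rightarrow> 'a poly_tu)"
    by (auto simp: fun_eq_iff)
  then show ?thesis
    by (simp add: bar_def lin_lin lin_id)
qed

lemma bar_F_mon:
  fixes w :: "ab list"
  shows "bar (map_F (mon (W w)) :: 'k::comm_ring_1 poly_tu) =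
     nabla_tensor map_G kappa (Delta (mon (W w)))"
  by (simp add: map_F_def map_G_def kappa_def Delta_def nabla_tensor_def lin_add lin_sum
      F_word.simps del: kappa_mon.simps(2))

lemma G_mon_W:
  "map_G (mon (W w)) = t_lower_half (length w + 1) ((var_u - var_t) * map_F (mon (W w)))"
  by (simp add: map_F_def map_G_def G_word.simps)

end

(*
  All indices are written as sums over chains. With X = a - b, the ab-index of a poset of rank n is
  the sum over its chains C of the word with letter b at the ranks of C and X elsewhere, so
  Psi_Q = X^n + (sum over x of Psi_[0,x] b X^(n - rho(x))). Since the coproduct acts as a
  derivation that kills X, this recursion yields
    Delta(Psi_[x,y]) = (sum over z in [x,y] of Psi_[x,z] (x) Psi_[z,y]),
  and since kappa is multiplicative and kills b it yields F(Psi_Q) = h(Q). In the Eulerian case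
  the defining identity of g becomes bar(G(Psi)) = G(Psi) + (t - u) bar(F(Psi)), hence G(Psi) = g;
  moreover F(Psi a) = G(Psi).

  The semisuspension of Gamma_x has ab-index Psi(Gamma_x) + Psi(bd Gamma_x) b, so the local
  cd-index of Gamma_x is Psi(Gamma_x) - Psi(bd Gamma_x) a. The recursion then gives, by induction,
  the decomposition
    Psi(bd Gamma_y) = (sum over x < y of local(Gamma_x) Psi_[x,y]).
  Hence H_Omega sends the mixed cd-index over [0,y] to
    F(Psi(Gamma_y)) - F(Psi(bd Gamma_y) a) + G(Psi(bd Gamma_y)) = h(Gamma_y).
  By the coproduct formula, varrho splits the mixed cd-index into the mixed cd-indices over [0,y]
  tensored with the cd-indices of the upper intervals [y,1], which gives both claims.
*)
theory Submission
  imports Defs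
begin

section \<open>Graded posets and their rank functions\<close>

text \<open>\<open>cd_index_boundary\<close> and \<open>Delta_Phi\<close> are definite descriptions,
  so existence and uniqueness must be settled before anything can be computed. Uniqueness comes from
  an explicit left inverse of the substitution c = a + b, d = ab + ba, which also transfers degrees.
  Existence comes from a second recursion for the ab-index, with a and b exchanged; averaging it
  with the first one needs 1/2 and hence a condition on the characteristic. Boundaries and
  semisuspensions are never completed to Eulerian posets. What is used of them is
  \<open>sphere\<close>: a set of elements of an ambient relation with strictly increasing ranks and
  the right alternating sums, relative to an imagined bottom and top. Passing to an ideal then only
  replaces one set by another. The g- and h-polynomials have integer coefficients, while F and G act
  over the field. The symmetry of F and G is therefore proved over all integral domains of
  characteristic 0: over the integers it identifies g, over the field it gives F(Psi a) = G(Psi),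
  and a change of coefficients joins the two.\<close>

lemma Field_Restr: "Refl r \<Longrightarrow> Field (Restr r A) = Field r \<inter> A"
  by (auto simp: Field_def refl_on_def)

lemma ex_max_on:
  fixes f :: "'a \<Rightarrow> nat"
  assumes "finite S" "S \<noteq> {}"
  shows "\<exists>x \<in> S. \<forall>y \<in> S. f y \<le> f x"
  using assms Max_in[of "f ` S"] Max_ge[of "f ` S"] by fastforce

lemma ex_min_on:
  fixes f :: "'a \<Rightarrow> nat"
  assumes "finite S" "S \<noteq> {}"
  shows "\<exists>x \<in> S. \<forall>y \<in> S. f x \<le> f y"
  using assms Min_in[of "f ` S"] Min_le[of "f ` S"] by fastforce

lemma Chains_subset_Field: "C \<in> Chains r \<Longrightarrow> C \<subseteq> Field r"
  by (auto simp: Chains_def Field_def)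

lemma finite_Chains:
  assumes "finite (Field r)"
  shows "finite (Chains r)"
  by (rule finite_subset[of _ "Pow (Field r)"]) (use assms in \<open>auto dest: Chains_subset_Field\<close>)

lemma chain_extends_to_maximal:
  assumes "finite (Field r)" "C \<in> Chains r"
  obtains D where "maximal_chain r D" "C \<subseteq> D"
proof -
  have "finite {D \<in> Chains r. C \<subseteq> D}" "{D \<in> Chains r. C \<subseteq> D} \<noteq> {}"
    using finite_Chains[OF assms(1)] assms(2) by auto
  then obtain D where D: "D \<in> Chains r" "C \<subseteq> D"
      and mx: "\<And>D'. D' \<in> Chains r \<Longrightarrow> C \<subseteq> D' \<Longrightarrow> D \<subseteq> D' \<Longrightarrow> D = D'"
    using finite_has_maximal[of "{D \<in> Chains r. C \<subseteq> D}"] by auto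
  have "maximal_chain r D"
    unfolding maximal_chain_def using D mx by blast
  with D that show thesis by blast
qed

lemma poset_rank_eqI:
  assumes "finite (Field r)" "C \<in> Chains r" "card C = Suc n"
    and "\<And>D. D \<in> Chains r \<Longrightarrow> card D \<le> Suc n"
  shows "poset_rank r = n"
proof -
  have "Max (card ` Chains r) = Suc n"
    using assms finite_Chains by (intro Max_eqI) force+
  then show ?thesis by (simp add: poset_rank_def)
qed

text \<open>Bottom, rank function and total rank are given as data. Intervals, duals, lower ideals
  and semisuspensions each come with an evident candidate for these data, so checking the axioms is
  easier than comparing maximal chains; \<open>zero_hat_eq\<close>, \<open>rho_eq\<close> and
  \<open>poset_rank_eq\<close> then identify the defined notions.\<close>

locale ranked_poset =
  fixes r :: "'a rel" and z :: 'a and \<rho> :: "'a \<Rightarrow> nat" and N :: nat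
  assumes partial_order: "Partial_order r" and finite_carrier: "finite (Field r)"
    and bot_in: "z \<in> Field r"
    and bot_least: "\<And>x. x \<in> Field r \<Longrightarrow> (z, x) \<in> r"
    and rank_bot: "\<rho> z = 0"
    and rank_less: "\<And>x y. (x, y) \<in> r \<Longrightarrow> x \<noteq> y \<Longrightarrow> \<rho> x < \<rho> y"
    and rank_between: "\<And>x y k. (x, y) \<in> r \<Longrightarrow> \<rho> x \<le> k \<Longrightarrow> k \<le> \<rho> y \<Longrightarrow>
          \<exists>w. (x, w) \<in> r \<and> (w, y) \<in> r \<and> \<rho> w = k"
    and rank_top: "\<And>x. x \<in> Field r \<Longrightarrow> \<exists>y. (x, y) \<in> r \<and> \<rho> y = N"
    and rank_le: "\<And>x. x \<in> Field r \<Longrightarrow> \<rho> x \<le> N"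
begin

lemma rel_Refl: "Refl r" and rel_refl: "x \<in> Field r \<Longrightarrow> (x, x) \<in> r"
  and rel_trans: "(x, y) \<in> r \<Longrightarrow> (y, w) \<in> r \<Longrightarrow> (x, w) \<in> r"
  and rel_antisym: "(x, y) \<in> r \<Longrightarrow> (y, x) \<in> r \<Longrightarrow> x = y"
  using partial_order by (auto simp: partial_order_on_def preorder_on_def refl_on_def
      dest: transD antisymD)

lemma in_Field: "(x, y) \<in> r \<Longrightarrow> x \<in> Field r" "(x, y) \<in> r \<Longrightarrow> y \<in> Field r"
  by (auto simp: Field_def)

lemma rank_mono: "(x, y) \<in> r \<Longrightarrow> \<rho> x \<le> \<rho> y"
  using rank_less by (cases "x = y") (auto simp: less_imp_le)

lemma rank_eq_bot: "x \<in> Field r \<Longrightarrow> \<rho> x = 0 \<longleftrightarrow> x = z"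
  using rank_less[of z x] bot_least[of x] rank_bot by (metis less_numeral_extra(3))

lemma rank_eqD: "(x, y) \<in> r \<Longrightarrow> \<rho> y \<le> \<rho> x \<Longrightarrow> x = y"
  using rank_less leD by blast

lemma is_minimal_iff: "is_minimal r x \<longleftrightarrow> x = z"
  using bot_least bot_in rel_antisym by (auto simp: is_minimal_def intro: FieldI1)

lemma zero_hat_eq: "zero_hat r = z"
  by (simp add: zero_hat_def is_minimal_iff)

lemma Field_interval: "Field (interval r x y) = {w. (x, w) \<in> r \<and> (w, y) \<in> r}"
  unfolding interval_def Field_Restr[OF rel_Refl] by (auto simp: Field_def)

lemma fin_le: "finite {w. (x, w) \<in> r \<and> P w}" "finite {w. (w, x) \<in> r \<and> P w}"
  by (rule finite_subset[OF _ finite_carrier]; auto simp: Field_def)+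

lemma inj_rank_chain: "C \<in> Chains r \<Longrightarrow> inj_on \<rho> C"
  unfolding inj_on_def Chains_def using rank_less by force

lemma ex_chain:
  "(x, y) \<in> r \<Longrightarrow> \<exists>C \<in> Chains (interval r x y). card C = Suc (\<rho> y - \<rho> x)"
proof (induction "\<rho> y - \<rho> x" arbitrary: y)
  case 0
  then have "y = x" using rank_eqD by auto
  then show ?case using 0 rel_refl in_Field
    by (intro bexI[of _ "{x}"]) (auto simp: Chains_def interval_def)
next
  case (Suc k)
  have "\<rho> x \<le> \<rho> y - 1" using Suc.hyps(2) by simp
  then obtain w where w: "(x, w) \<in> r" "(w, y) \<in> r" "\<rho> w = \<rho> y - 1"
    using rank_between[OF Suc.prems, of "\<rho> y - 1"] by auto
  then obtain C where C: "C \<in> Chains (interval r x w)" "card C = Suc (\<rho> w - \<rho> x)"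
    using Suc.hyps(1)[of w] Suc.hyps(2) by (metis diff_Suc_1 diff_commute)
  have Cw: "\<And>c. c \<in> C \<Longrightarrow> (x, c) \<in> r \<and> (c, w) \<in> r"
    using C(1) by (auto simp: Chains_def interval_def)
  have "y \<notin> C"
    using Cw w rank_mono Suc.hyps(2) by fastforce
  moreover have "finite C" using C(2) by (intro card_ge_0_finite) simp
  ultimately have "card (insert y C) = Suc (\<rho> y - \<rho> x)"
    using C(2) w(3) Suc.hyps(2) by simp
  moreover have "insert y C \<in> Chains (interval r x y)"
  proof -
    have y: "(x, y) \<in> r" "(y, y) \<in> r" "(x, x) \<in> r"
      using Suc.prems rel_refl in_Field by blast+
    have cy: "(c, y) \<in> r" if "c \<in> C" for c using Cw[OF that] w(2) rel_trans by blast
    have cc: "(c, d) \<in> r \<or> (d, c) \<in> r" if "c \<in> C" "d \<in> C" for c d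
      using C(1) that unfolding Chains_def interval_def by blast
    show ?thesis
      using y cy cc Cw unfolding Chains_def interval_def by blast
  qed
  ultimately show ?case by blast
qed

lemma card_chain_le:
  assumes "C \<in> Chains r" "\<And>c. c \<in> C \<Longrightarrow> m \<le> \<rho> c \<and> \<rho> c \<le> n"
  shows "card C \<le> Suc n - m"
proof -
  have "card C = card (\<rho> ` C)" using inj_rank_chain[OF assms(1)] by (simp add: card_image)
  also have "\<dots> \<le> card {m..n}" using assms(2) by (intro card_mono) auto
  finally show ?thesis by simp
qed

lemma poset_rank_interval:
  assumes "(x, y) \<in> r"
  shows "poset_rank (interval r x y) = \<rho> y - \<rho> x"
proof -
  obtain C where C: "C \<in> Chains (interval r x y)" "card C = Suc (\<rho> y - \<rho> x)"
    using ex_chain[OF assms] by blast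
  show ?thesis
  proof (rule poset_rank_eqI[OF _ C])
    show "finite (Field (interval r x y))"
      by (simp add: Field_interval fin_le)
    fix D assume D: "D \<in> Chains (interval r x y)"
    have "card D \<le> Suc (\<rho> y) - \<rho> x"
      by (rule card_chain_le)
        (use D in \<open>auto simp: interval_def Chains_def dest: rank_mono\<close>)
    then show "card D \<le> Suc (\<rho> y - \<rho> x)"
      using rank_mono[OF assms] by simp
  qed
qed

lemma rho_eq: "x \<in> Field r \<Longrightarrow> rho r x = \<rho> x"
  by (simp add: rho_def zero_hat_eq poset_rank_interval bot_least rank_bot)

lemma poset_rank_eq: "poset_rank r = N"
proof -
  obtain t where t: "(z, t) \<in> r" "\<rho> t = N" using rank_top[OF bot_in] by blast
  obtain C where C: "C \<in> Chains (interval r z t)" "card C = Suc (\<rho> t - \<rho> z)"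
    using ex_chain[OF t(1)] by blast
  show ?thesis
  proof (rule poset_rank_eqI[OF finite_carrier])
    show "C \<in> Chains r" using C(1) by (auto simp: Chains_def interval_def)
    show "card C = Suc N" using C(2) t rank_bot by simp
    fix D assume D: "D \<in> Chains r"
    have "card D \<le> Suc N - 0"
      using D Chains_subset_Field rank_le by (intro card_chain_le) auto
    then show "card D \<le> Suc N" by simp
  qed
qed

text \<open>If the chain skipped the rank \<open>k\<close>, an element of rank \<open>k\<close>
  could be inserted between its last element below \<open>k\<close> and its first element above
  \<open>k\<close> (or, if there is none above, on the way to an element of rank \<open>N\<close>),
  against maximality.\<close>

lemma rank_maximal_chain:
  assumes "maximal_chain r C"
  shows "\<rho> ` C = {..N}"
proof (rule ccontr)
  have C: "C \<in> Chains r" and mx: "\<And>D. D \<in> Chains r \<Longrightarrow> C \<subseteq> D \<Longrightarrow> D = C"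
    using assms by (auto simp: maximal_chain_def)
  have CF: "C \<subseteq> Field r" by (rule Chains_subset_Field[OF C])
  have insC: "w \<in> C" if "w \<in> Field r" "\<And>c. c \<in> C \<Longrightarrow> (c, w) \<in> r \<or> (w, c) \<in> r" for w
    using mx[of "insert w C"] C that rel_refl by (auto simp: Chains_def)
  assume "\<rho> ` C \<noteq> {..N}"
  moreover have "\<rho> ` C \<subseteq> {..N}" using CF rank_le by auto
  ultimately obtain k where k: "k \<le> N" "k \<notin> \<rho> ` C" by auto
  have fC: "finite C" using CF finite_carrier finite_subset by blast
  have zC: "z \<in> C" using insC[OF bot_in] bot_least CF by blast
  let ?L = "{c \<in> C. \<rho> c < k}" and ?U = "{c \<in> C. k < \<rho> c}"
  have lu: "c \<in> ?L \<or> c \<in> ?U" if "c \<in> C" for c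
    using that k by (metis (mono_tags, lifting) image_eqI linorder_neqE_nat mem_Collect_eq)
  have "z \<in> ?L" using zC lu rank_bot by fastforce
  then obtain x where x: "x \<in> ?L" "\<And>c. c \<in> ?L \<Longrightarrow> \<rho> c \<le> \<rho> x"
    using ex_max_on[of ?L \<rho>] fC by auto
  have cmp: "(c, d) \<in> r" if "c \<in> C" "d \<in> C" "\<rho> c \<le> \<rho> d" for c d
    using that C rank_eqD[of d c] rel_refl CF unfolding Chains_def by blast
  have xL: "(c, x) \<in> r" if "c \<in> ?L" for c using cmp that x by blast
  show False
  proof (cases "?U = {}")
    case True
    obtain y where "(x, y) \<in> r" "\<rho> y = N" using rank_top x(1) CF by blast
    then obtain w where w: "(x, w) \<in> r" "\<rho> w = k"
      using rank_between[of x y k] x(1) k(1) by auto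
    have "w \<in> C"
      by (rule insC) (use w in_Field lu True xL rel_trans in blast)+
    then show False using w k by auto
  next
    case False
    then obtain y where y: "y \<in> ?U" "\<And>c. c \<in> ?U \<Longrightarrow> \<rho> y \<le> \<rho> c"
      using ex_min_on[of ?U \<rho>] fC by auto
    have yU: "(y, c) \<in> r" if "c \<in> ?U" for c using cmp that y by blast
    have "(x, y) \<in> r" using cmp[of x y] x(1) y(1) by auto
    then obtain w where w: "(x, w) \<in> r" "(w, y) \<in> r" "\<rho> w = k"
      using rank_between[of x y k] x(1) y(1) by auto
    have "w \<in> C"
      by (rule insC) (use w in_Field lu xL yU rel_trans in blast)+
    then show False using w k by auto
  qed
qed

lemma graded: "graded_poset r"
  unfolding graded_poset_def
proof (intro conjI allI impI partial_order finite_carrier)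
  show "\<exists>!x. is_minimal r x" by (simp add: is_minimal_iff)
  have *: "card C = Suc N" if "maximal_chain r C" for C
    using rank_maximal_chain[OF that] inj_rank_chain[of C] that card_image[of \<rho> C]
    by (simp add: maximal_chain_def)
  fix C D assume "maximal_chain r C" "maximal_chain r D"
  then show "card C = card D" using * by simp
qed

lemma interval_ranked:
  assumes "(x, y) \<in> r"
  shows "ranked_poset (interval r x y) x (\<lambda>w. \<rho> w - \<rho> x) (\<rho> y - \<rho> x)"
proof
  show "Partial_order (interval r x y)"
    unfolding interval_def using partial_order by (rule Partial_order_Restr)
  show "finite (Field (interval r x y))"
    by (simp add: Field_interval fin_le)
  show "x \<in> Field (interval r x y)"
    using assms rel_refl in_Field by (auto simp: Field_interval)
  fix w assume "w \<in> Field (interval r x y)"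
  then have w: "(x, w) \<in> r" "(w, y) \<in> r" by (auto simp: Field_interval)
  show "(x, w) \<in> interval r x y"
    using w assms rel_refl in_Field by (auto simp: interval_def)
  show "\<exists>v. (w, v) \<in> interval r x y \<and> \<rho> v - \<rho> x = \<rho> y - \<rho> x"
    using w assms rel_refl in_Field by (auto simp: interval_def)
  show "\<rho> w - \<rho> x \<le> \<rho> y - \<rho> x"
    using w rank_mono diff_le_mono by blast
next
  fix v w assume "(v, w) \<in> interval r x y"
  then have vw: "(v, w) \<in> r" "(x, v) \<in> r" "(w, y) \<in> r" by (auto simp: interval_def)
  show "\<rho> v - \<rho> x < \<rho> w - \<rho> x" if "v \<noteq> w"
    using rank_less[OF vw(1) that] rank_mono[OF vw(2)] by simp
  fix k assume k: "\<rho> v - \<rho> x \<le> k" "k \<le> \<rho> w - \<rho> x"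
  have xw: "\<rho> x \<le> \<rho> v" "\<rho> x \<le> \<rho> w" using vw rank_mono rel_trans by blast+
  then have "\<rho> v \<le> k + \<rho> x" "k + \<rho> x \<le> \<rho> w" using k by arith+
  then obtain u where u: "(v, u) \<in> r" "(u, w) \<in> r" "\<rho> u = k + \<rho> x"
    using rank_between[OF vw(1)] by blast
  have "(x, u) \<in> r" "(u, y) \<in> r" "(x, w) \<in> r" "(v, y) \<in> r"
    using u vw rel_trans[of x v u] rel_trans[of u w y] rel_trans[of x v w] rel_trans[of v w y] by auto
  then show "\<exists>u. (v, u) \<in> interval r x y \<and> (u, w) \<in> interval r x y \<and> \<rho> u - \<rho> x = k"
    using u vw unfolding interval_def by (intro exI[of _ u]) auto
qed simp

lemma dual_ranked:
  assumes t: "t \<in> Field r" "\<And>x. x \<in> Field r \<Longrightarrow> (x, t) \<in> r"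
  shows "ranked_poset (r\<inverse>) t (\<lambda>w. N - \<rho> w) N"
proof -
  have rt: "\<rho> t = N"
    using rank_top[OF t(1)] t rel_antisym in_Field by metis
  show ?thesis
  proof
    show "Partial_order (r\<inverse>)" using partial_order by simp
    show "finite (Field (r\<inverse>))" using finite_carrier by simp
    show "t \<in> Field (r\<inverse>)" using t by simp
    show "N - \<rho> t = 0" using rt by simp
    fix x assume "x \<in> Field (r\<inverse>)"
    then have x: "x \<in> Field r" by simp
    show "(t, x) \<in> r\<inverse>" using t x by simp
    show "\<exists>y. (x, y) \<in> r\<inverse> \<and> N - \<rho> y = N" using bot_least[OF x] rank_bot by auto
  next
    fix x y assume "(x, y) \<in> r\<inverse>"
    then have xy: "(y, x) \<in> r" by simp
    have le: "\<rho> x \<le> N" "\<rho> y \<le> N" using rank_le in_Field xy by blast+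
    show "N - \<rho> x < N - \<rho> y" if "x \<noteq> y"
      using rank_less[OF xy] that le by auto
    fix k assume "N - \<rho> x \<le> k" "k \<le> N - \<rho> y"
    then obtain w where "(y, w) \<in> r" "(w, x) \<in> r" "\<rho> w = N - k"
      using rank_between[OF xy, of "N - k"] le by fastforce
    then show "\<exists>w. (x, w) \<in> r\<inverse> \<and> (w, y) \<in> r\<inverse> \<and> N - \<rho> w = k"
      using le \<open>k \<le> N - \<rho> y\<close> by (intro exI[of _ w]) auto
  qed simp
qed

end

text \<open>For a maximal chain \<open>C\<close> through \<open>x\<close>, the elements of \<open>C\<close> below \<open>x\<close> can be exchanged for a longest
  chain below \<open>x\<close>; as all maximal chains have the same length, \<open>C\<close> already contains one.\<close>

theorem graded_poset_ranked:
  assumes "graded_poset r"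
  shows "ranked_poset r (zero_hat r) (rho r) (poset_rank r)"
proof -
  have partial_order: "Partial_order r" and finite_carrier: "finite (Field r)"
    and exm: "\<exists>!x. is_minimal r x"
    and mc: "\<And>C D. maximal_chain r C \<Longrightarrow> maximal_chain r D \<Longrightarrow> card C = card D"
    using assms unfolding graded_poset_def by blast+
  have rel_Refl: "Refl r" and "trans r" "antisym r"
    using partial_order by (auto simp: partial_order_on_def preorder_on_def)
  have rel_trans: "(x, w) \<in> r" if "(x, y) \<in> r" "(y, w) \<in> r" for x y w
    using \<open>trans r\<close> that by (rule transD)
  have rel_antisym: "x = y" if "(x, y) \<in> r" "(y, x) \<in> r" for x y
    using \<open>antisym r\<close> that by (rule antisymD)
  have rel_refl: "(x, x) \<in> r" if "x \<in> Field r" for x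
    using rel_Refl that by (rule refl_onD)
  define z where "z = zero_hat r"
  have zmin: "is_minimal r z"
    unfolding z_def zero_hat_def using exm by (rule theI')
  have zF: "z \<in> Field r" using zmin by (simp add: is_minimal_def)
  have least: "(z, x) \<in> r" if x: "x \<in> Field r" for x
  proof -
    let ?S = "{w. (w, x) \<in> r}"
    have fS: "finite ?S" by (rule finite_subset[OF _ finite_carrier]) (auto simp: Field_def)
    \<comment> \<open>Among the elements below \<open>x\<close>, one with the fewest elements
      beneath it is minimal; as the minimal element is unique, it is \<open>z\<close>.\<close>
    define w where "w = (ARG_MIN (\<lambda>w. card {v. (v, w) \<in> r}) w. w \<in> ?S)"
    have w: "w \<in> ?S" "\<And>v. v \<in> ?S \<Longrightarrow> card {u. (u, w) \<in> r} \<le> card {u. (u, v) \<in> r}"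
      unfolding w_def using arg_min_nat_lemma[of "\<lambda>w. w \<in> ?S" x "\<lambda>w. card {v. (v, w) \<in> r}"]
        rel_refl[OF x] by auto
    have "is_minimal r w"
      unfolding is_minimal_def
    proof (intro conjI allI impI)
      show "w \<in> Field r" using w(1) by (auto simp: Field_def)
      fix v assume v: "(v, w) \<in> r"
      show "v = w"
      proof (rule ccontr)
        assume "v \<noteq> w"
        then have "w \<notin> {u. (u, v) \<in> r}" using v rel_antisym by blast
        moreover have "w \<in> {u. (u, w) \<in> r}" using v rel_refl by (auto simp: Field_def)
        ultimately have "{u. (u, v) \<in> r} \<subset> {u. (u, w) \<in> r}" using v rel_trans by blast
        moreover have "finite {u. (u, w) \<in> r}"
          by (rule finite_subset[OF _ finite_carrier]) (auto simp: Field_def)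
        ultimately have "card {u. (u, v) \<in> r} < card {u. (u, w) \<in> r}"
          by (rule psubset_card_mono[rotated])
        moreover have "v \<in> ?S" using v w(1) rel_trans by blast
        ultimately show False using w(2) by fastforce
      qed
    qed
    then have "w = z" using zmin exm by blast
    then show ?thesis using w(1) by simp
  qed
  have FI: "Field (interval r x y) = {w. (x, w) \<in> r \<and> (w, y) \<in> r}" for x y
    unfolding interval_def Field_Restr[OF rel_Refl] by (auto simp: Field_def)
  have finC: "finite C" if "C \<in> Chains r" for C
    using Chains_subset_Field[OF that] finite_carrier finite_subset by blast
  have rho_card: "card {c \<in> C. (c, x) \<in> r} = Suc (rho r x)"
    if C: "maximal_chain r C" and x: "x \<in> C" for C x
  proof -
    have Cc: "C \<in> Chains r" using C by (simp add: maximal_chain_def)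
    have CF: "C \<subseteq> Field r" by (rule Chains_subset_Field[OF Cc])
    have fI: "finite (Field (interval r z x))"
      unfolding FI by (rule finite_subset[OF _ finite_carrier]) (auto simp: Field_def)
    let ?L = "{c \<in> C. (c, x) \<in> r}" and ?U = "{c \<in> C. (x, c) \<in> r \<and> c \<noteq> x}"
    have LU: "card C = card ?L + card ?U"
    proof -
      have "C = ?L \<union> ?U" "?L \<inter> ?U = {}"
        using Cc x rel_antisym unfolding Chains_def by blast+
      then show ?thesis using finC[OF Cc] by (metis (no_types, lifting) card_Un_disjoint finite_Un)
    qed
    have "rho r x = card ?L - 1"
      unfolding rho_def z_def[symmetric]
    proof (rule poset_rank_eqI[OF fI])
      show "?L \<in> Chains (interval r z x)"
        using Cc CF least by (auto simp: Chains_def interval_def)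
      have "x \<in> ?L" using x CF rel_refl by auto
      then have pos: "card ?L > 0" using finC[OF Cc] by (auto simp: card_gt_0_iff)
      then show "card ?L = Suc (card ?L - 1)" by simp
      fix D assume D: "D \<in> Chains (interval r z x)"
      have Dx: "\<And>d. d \<in> D \<Longrightarrow> (d, x) \<in> r" and Dr: "D \<in> Chains r"
        using D by (auto simp: Chains_def interval_def)
      have "D \<union> ?U \<in> Chains r"
        using Dr Cc Dx rel_trans unfolding Chains_def by blast
      then obtain M where M: "maximal_chain r M" "D \<union> ?U \<subseteq> M"
        using chain_extends_to_maximal[OF finite_carrier] by blast
      have "card (D \<union> ?U) \<le> card M"
        using M finC by (intro card_mono) (auto simp: maximal_chain_def)
      also have "\<dots> = card C" using mc M C by blast
      finally have "card (D \<union> ?U) \<le> card ?L + card ?U" using LU by simp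
      moreover have "card (D \<union> ?U) = card D + card ?U"
        using finC[OF Dr] finC[OF Cc] Dx rel_antisym by (intro card_Un_disjoint) auto
      ultimately show "card D \<le> Suc (card ?L - 1)" using pos by simp
    qed
    moreover have "card ?L > 0" using x CF rel_refl finC[OF Cc] by (auto simp: card_gt_0_iff)
    ultimately show ?thesis by simp
  qed
  have rank_C: "Suc (poset_rank r) = card C" if C: "maximal_chain r C" for C
  proof -
    have Cc: "C \<in> Chains r" using C by (simp add: maximal_chain_def)
    have "z \<in> C"
    proof -
      have "insert z C \<in> Chains r"
        using Cc least zF Chains_subset_Field[OF Cc] unfolding Chains_def by blast
      then show ?thesis using C unfolding maximal_chain_def by blast
    qed
    then have pos: "card C > 0" using finC[OF Cc] by (auto simp: card_gt_0_iff)
    have "poset_rank r = card C - 1"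
    proof (rule poset_rank_eqI[OF finite_carrier Cc])
      show "card C = Suc (card C - 1)" using pos by simp
      fix D assume "D \<in> Chains r"
      then obtain M where M: "maximal_chain r M" "D \<subseteq> M"
        using chain_extends_to_maximal[OF finite_carrier] by blast
      then have "card D \<le> card M"
        using finC by (intro card_mono) (auto simp: maximal_chain_def)
      then show "card D \<le> Suc (card C - 1)" using mc[OF M(1) C] pos by simp
    qed
    then show ?thesis using pos by simp
  qed
  have less: "rho r x < rho r y" if xy: "(x, y) \<in> r" "x \<noteq> y" for x y
  proof -
    have "{x, y} \<in> Chains r" using xy rel_refl by (auto simp: Chains_def Field_def)
    then obtain C where C: "maximal_chain r C" "{x, y} \<subseteq> C"
      using chain_extends_to_maximal[OF finite_carrier] by blast
    have "{c \<in> C. (c, x) \<in> r} \<subset> {c \<in> C. (c, y) \<in> r}"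
    proof -
      have "y \<in> {c \<in> C. (c, y) \<in> r}" using C(2) xy rel_refl by (auto simp: Field_def)
      moreover have "y \<notin> {c \<in> C. (c, x) \<in> r}" using xy rel_antisym by blast
      ultimately show ?thesis using rel_trans xy by blast
    qed
    then have "card {c \<in> C. (c, x) \<in> r} < card {c \<in> C. (c, y) \<in> r}"
      using C finC by (intro psubset_card_mono) (auto simp: maximal_chain_def)
    then show ?thesis using rho_card[OF C(1)] C(2) by simp
  qed
  \<comment> \<open>\<open>rho r\<close> is injective on \<open>C\<close> and bounded by the rank,
    and \<open>C\<close> has one element more than the rank, so every rank occurs.\<close>
  have rho_C: "rho r ` C = {..poset_rank r}" if C: "maximal_chain r C" for C
  proof -
    have Cc: "C \<in> Chains r" using C by (simp add: maximal_chain_def)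
    have "inj_on (rho r) C"
      unfolding inj_on_def using Cc less unfolding Chains_def
      by (metis (mono_tags, lifting) mem_Collect_eq nat_neq_iff)
    then have "card (rho r ` C) = Suc (poset_rank r)"
      using rank_C[OF C] by (simp add: card_image)
    moreover have "rho r ` C \<subseteq> {..poset_rank r}"
    proof
      fix k assume "k \<in> rho r ` C"
      then obtain c where c: "c \<in> C" "k = rho r c" by blast
      have "card {d \<in> C. (d, c) \<in> r} \<le> card C"
        using finC[OF Cc] by (intro card_mono) auto
      then show "k \<in> {..poset_rank r}"
        using rho_card[OF C c(1)] rank_C[OF C] c(2) by simp
    qed
    ultimately show ?thesis
      by (intro card_subset_eq) auto
  qed
  have cmp: "(c, d) \<in> r" if "maximal_chain r C" "c \<in> C" "d \<in> C" "rho r c \<le> rho r d" for C c d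
  proof -
    have Cc: "C \<in> Chains r" using that by (simp add: maximal_chain_def)
    have "(c, d) \<in> r \<or> (d, c) \<in> r" using Cc that by (auto simp: Chains_def)
    then show ?thesis
      using less[of d c] that(4) rel_refl[of c] Chains_subset_Field[OF Cc] that(2) by fastforce
  qed
  show ?thesis
    unfolding z_def[symmetric]
  proof (unfold_locales)
    show "rho r z = 0"
    proof -
      have "{z} \<in> Chains r" using zF rel_refl by (auto simp: Chains_def)
      then obtain C where C: "maximal_chain r C" "{z} \<subseteq> C"
        using chain_extends_to_maximal[OF finite_carrier] by blast
      have "{c \<in> C. (c, z) \<in> r} = {z}"
        using zmin C rel_refl zF by (auto simp: is_minimal_def)
      then show ?thesis using rho_card[OF C(1), of z] C(2) by simp
    qed
  next
    fix x y k assume xy: "(x, y) \<in> r" "rho r x \<le> k" "k \<le> rho r y"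
    have "{x, y} \<in> Chains r" using xy rel_refl by (auto simp: Chains_def Field_def)
    then obtain C where C: "maximal_chain r C" "{x, y} \<subseteq> C"
      using chain_extends_to_maximal[OF finite_carrier] by blast
    have "rho r y \<le> poset_rank r" using rho_C[OF C(1)] C(2) by blast
    then obtain w where w: "w \<in> C" "rho r w = k" using rho_C[OF C(1)] xy
      by (metis (mono_tags, lifting) atMost_iff imageE le_trans)
    then show "\<exists>w. (x, w) \<in> r \<and> (w, y) \<in> r \<and> rho r w = k"
      using cmp[OF C(1)] C(2) xy by auto
  next
    fix x assume x: "x \<in> Field r"
    have "{x} \<in> Chains r" using x rel_refl by (auto simp: Chains_def)
    then obtain C where C: "maximal_chain r C" "{x} \<subseteq> C"
      using chain_extends_to_maximal[OF finite_carrier] by blast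
    show le: "rho r x \<le> poset_rank r" using rho_C[OF C(1)] C(2) by blast
    obtain w where w: "w \<in> C" "rho r w = poset_rank r"
      using rho_C[OF C(1)] by (metis (mono_tags, lifting) atMost_iff imageE order_refl)
    then show "\<exists>y. (x, y) \<in> r \<and> rho r y = poset_rank r"
      using cmp[OF C(1), of x w] C(2) le by auto
  qed (use partial_order finite_carrier zF least less in auto)
qed

section \<open>Linear maps\<close>

definition scale :: "'k \<Rightarrow> ('m \<Rightarrow>\<^sub>0 'k) \<Rightarrow> 'm \<Rightarrow>\<^sub>0 'k::comm_ring_1" where
  "scale c p = Poly_Mapping.map (\<lambda>k. c * k) p"

lemma lookup_scale' [simp]:
  "Poly_Mapping.lookup (scale c p) n = c * Poly_Mapping.lookup p n"
  by (simp add: scale_def lookup_scale)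

lemma lin_eq_sum_scale:
  "lin f p = (\<Sum>m \<in> Poly_Mapping.keys p. scale (Poly_Mapping.lookup p m) (f m))"
  by (simp add: lin_def scale_def)

lemma lin_scale': "lin f (scale c p) = scale c (lin f p)"
  by (simp add: scale_def lin_scale)

lemma scale_add: "scale c (p + q) = scale c p + scale c q"
  by (rule poly_mapping_eqI) (simp add: lookup_add distrib_left)

lemma scale_minus: "scale c (p - q) = scale c p - scale c q"
  by (rule poly_mapping_eqI) (simp add: lookup_minus right_diff_distrib)

lemma scale_scale: "scale c (scale d p) = scale (c * d) p"
  by (rule poly_mapping_eqI) (simp add: mult.assoc)

lemma scale_one [simp]: "scale 1 p = p"
  by (rule poly_mapping_eqI) simp

lemma scale_zero_right [simp]: "scale c 0 = 0"
  by (rule poly_mapping_eqI) simp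

lemma scale_sum: "scale c (\<Sum>i \<in> I. f i) = (\<Sum>i \<in> I. scale c (f i))"
  by (induction I rule: infinite_finite_induct) (simp_all add: scale_add)

lemma sum_scale_mon: "(\<Sum>m \<in> Poly_Mapping.keys p. scale (Poly_Mapping.lookup p m) (mon m)) = p"
  using lin_id[of p] by (simp add: lin_eq_sum_scale)

lemma scale_eq_mult: "scale c p = Poly_Mapping.single (0 :: 'm::monoid_add) c * p"
  using mult_map_scale_conv_mult[of c p] by (simp add: scale_def)

lemma mult_scale_left:
  fixes p q :: "'m::monoid_add \<Rightarrow>\<^sub>0 'k::comm_ring_1"
  shows "scale c p * q = scale c (p * q)"
  by (simp add: scale_eq_mult mult.assoc)

text \<open>Scalars are central although the word algebra is not commutative: they sit at the
  neutral monomial, which commutes with every monomial.\<close>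

lemma mult_scale_right:
  fixes p q :: "'m::monoid_add \<Rightarrow>\<^sub>0 'k::comm_ring_1"
  shows "p * scale c q = scale c (p * q)"
proof -
  have *: "mon m * scale c q = scale c (mon m * q)" for m :: 'm
    unfolding scale_eq_mult by (simp flip: mult.assoc add: mult_single)
  have "p * scale c q = (\<Sum>m \<in> Poly_Mapping.keys p. scale (Poly_Mapping.lookup p m) (mon m)) * scale c q"
    by (simp only: sum_scale_mon)
  also have "\<dots> = scale c ((\<Sum>m \<in> Poly_Mapping.keys p. scale (Poly_Mapping.lookup p m) (mon m)) * q)"
    unfolding sum_distrib_right scale_sum mult_scale_left * scale_scale
    by (simp add: mult.commute)
  finally show ?thesis by (simp only: sum_scale_mon)
qed

definition linear_map :: "(('m \<Rightarrow>\<^sub>0 'k) \<Rightarrow> 'n \<Rightarrow>\<^sub>0 'k::comm_ring_1) \<Rightarrow> bool" where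
  "linear_map F \<longleftrightarrow> (\<forall>p q. F (p + q) = F p + F q) \<and> (\<forall>c p. F (scale c p) = scale c (F p))"

named_theorems linear_intros

lemma linear_map_add: "linear_map F \<Longrightarrow> F (p + q) = F p + F q"
  and linear_map_scale: "linear_map F \<Longrightarrow> F (scale c p) = scale c (F p)"
  by (auto simp: linear_map_def)

lemma linear_map_zero: "linear_map F \<Longrightarrow> F 0 = 0"
  using linear_map_add[of F 0 0] by simp

lemma linear_map_minus: "linear_map F \<Longrightarrow> F (p - q) = F p - F q"
  using linear_map_add[of F "p - q" q] by (simp add: algebra_simps)

lemma linear_map_sum: "linear_map F \<Longrightarrow> F (\<Sum>i \<in> I. p i) = (\<Sum>i \<in> I. F (p i))"
  by (induction I rule: infinite_finite_induct) (simp_all add: linear_map_add linear_map_zero)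

lemma linear_map_eq_lin: "linear_map F \<Longrightarrow> F p = lin (\<lambda>m. F (mon m)) p"
  using arg_cong[OF sum_scale_mon[of p], of F, symmetric]
  by (simp add: linear_map_sum linear_map_scale lin_eq_sum_scale)

text \<open>The usual way to prove identities below: both sides are shown to be linear by
  \<open>linear_intros\<close>, and only basis monomials remain to be compared.\<close>

lemma linear_map_ext:
  assumes "linear_map F" "linear_map G" "\<And>m. F (mon m) = G (mon m)"
  shows "F p = G p"
  using linear_map_eq_lin[OF assms(1), of p] linear_map_eq_lin[OF assms(2), of p] assms(3) by simp

lemma linear_lin [linear_intros]: "linear_map F \<Longrightarrow> linear_map (\<lambda>p. lin f (F p))"
  by (simp add: linear_map_def lin_add lin_scale')

lemma linear_ident [linear_intros]: "linear_map (\<lambda>p. p)"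
  by (simp add: linear_map_def)

lemma linear_zero [linear_intros]: "linear_map (\<lambda>p. 0)"
  by (simp add: linear_map_def)

lemma linear_add [linear_intros]:
  "linear_map F \<Longrightarrow> linear_map G \<Longrightarrow> linear_map (\<lambda>p. F p + G p)"
  by (simp add: linear_map_def scale_add)

lemma linear_minus [linear_intros]:
  "linear_map F \<Longrightarrow> linear_map G \<Longrightarrow> linear_map (\<lambda>p. F p - G p)"
  by (simp add: linear_map_def scale_minus)

lemma linear_scale [linear_intros]: "linear_map F \<Longrightarrow> linear_map (\<lambda>p. scale c (F p))"
  by (simp add: linear_map_def scale_scale scale_add mult.commute)

lemma linear_sum [linear_intros]:
  "(\<And>i. i \<in> I \<Longrightarrow> linear_map (F i)) \<Longrightarrow> linear_map (\<lambda>p. \<Sum>i \<in> I. F i p)"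
  by (induction I rule: infinite_finite_induct) (intro linear_intros | simp)+

lemma linear_mult_left [linear_intros]:
  fixes q :: "'m::monoid_add \<Rightarrow>\<^sub>0 'k::comm_ring_1"
  shows "linear_map F \<Longrightarrow> linear_map (\<lambda>p. q * F p)"
  by (simp add: linear_map_def distrib_left mult_scale_right)

lemma linear_mult_right [linear_intros]:
  fixes q :: "'m::monoid_add \<Rightarrow>\<^sub>0 'k::comm_ring_1"
  shows "linear_map F \<Longrightarrow> linear_map (\<lambda>p. F p * q)"
  by (simp add: linear_map_def distrib_right mult_scale_left)

lemma linear_lin_param [linear_intros]:
  "(\<And>m. linear_map (F m)) \<Longrightarrow> linear_map (\<lambda>q. lin (\<lambda>m. F m q) p)"
  unfolding lin_eq_sum_scale by (intro linear_intros) auto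

lemma lin_mult:
  fixes f :: "'m::monoid_add \<Rightarrow> 'n::monoid_add \<Rightarrow>\<^sub>0 'k::comm_ring_1"
  assumes "\<And>m n. f (m + n) = f m * f n"
  shows "lin f (p * q) = lin f p * lin f q"
proof -
  have *: "lin f (mon m * q) = f m * lin f q" for m
    by (rule linear_map_ext[where F = "\<lambda>q. lin f (mon m * q)" and G = "\<lambda>q. f m * lin f q"])
      (intro linear_intros | simp add: mult_single assms)+
  show ?thesis
    by (rule linear_map_ext[where F = "\<lambda>p. lin f (p * q)" and G = "\<lambda>p. lin f p * lin f q"])
      (intro linear_intros | simp add: *)+
qed

lemma linear_tensor_left [linear_intros]: "linear_map F \<Longrightarrow> linear_map (\<lambda>p. tensor (F p) q)"
  unfolding tensor_def by (intro linear_intros)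

lemma linear_tensor_right [linear_intros]: "linear_map F \<Longrightarrow> linear_map (\<lambda>q. tensor p (F q))"
  unfolding tensor_def by (intro linear_intros)

lemma linear_nabla_tensor [linear_intros]:
  "linear_map F \<Longrightarrow> linear_map (\<lambda>p. nabla_tensor f g (F p))"
  unfolding nabla_tensor_def by (intro linear_intros)

lemma linear_tensor_map [linear_intros]:
  "linear_map F \<Longrightarrow> linear_map (\<lambda>p. tensor_map f g (F p))"
  unfolding tensor_map_def by (intro linear_intros)

lemma tensor_mon [simp]: "tensor (mon m) (mon n) = mon (m, n)"
  by (simp add: tensor_def)

lemma linear_map_ext2:
  assumes "\<And>q. linear_map (\<lambda>p. F p q)" "\<And>q. linear_map (\<lambda>p. G p q)"
    and "\<And>p. linear_map (\<lambda>q. F p q)" "\<And>p. linear_map (\<lambda>q. G p q)"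
    and "\<And>m n. F (mon m) (mon n) = G (mon m) (mon n)"
  shows "F p q = G p q"
proof -
  have "F (mon m) q = G (mon m) q" for m
    by (rule linear_map_ext[OF assms(3,4,5)])
  then show ?thesis
    by (rule linear_map_ext[OF assms(1,2)])
qed

lemma nabla_tensor_tensor:
  fixes f :: "('m \<Rightarrow>\<^sub>0 'k) \<Rightarrow> 'p::comm_monoid_add \<Rightarrow>\<^sub>0 'k::comm_ring_1"
  assumes f: "linear_map f" and g: "linear_map g"
  shows "nabla_tensor f g (tensor p q) = f p * g q"
  by (rule linear_map_ext2[where F = "\<lambda>p q. nabla_tensor f g (tensor p q)" and G = "\<lambda>p q. f p * g q"])
    (intro linear_intros f g | simp add: nabla_tensor_def)+

lemma tensor_map_tensor:
  assumes f: "linear_map f" and g: "linear_map g"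
  shows "tensor_map f g (tensor p q) = tensor (f p) (g q)"
  by (rule linear_map_ext2[where F = "\<lambda>p q. tensor_map f g (tensor p q)" and G = "\<lambda>p q. tensor (f p)
      (g q)"])
    (intro linear_intros f g | simp add: tensor_map_def)+

text \<open>Pairs of monomials are added componentwise, so the product on pairs is the
  multiplication of the tensor product of two algebras.\<close>

lemma tensor_mult:
  fixes p p' :: "'m::monoid_add \<Rightarrow>\<^sub>0 'k::comm_ring_1" and q q' :: "'n::monoid_add \<Rightarrow>\<^sub>0 'k"
  shows "tensor p q * tensor p' q' = tensor (p * p') (q * q')"
proof -
  have *: "mon (m, n) * tensor p' q' = tensor (mon m * p') (mon n * q')" for m :: 'm and n :: 'n
    by (rule linear_map_ext2[where F = "\<lambda>p' q'. mon (m, n) * tensor p' q'" and G = "\<lambda>p' q'. tensor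
        (mon m * p') (mon n * q')"])
      (intro linear_intros | simp add: mult_single)+
  show ?thesis
    by (rule linear_map_ext2[where F = "\<lambda>p q. tensor p q * tensor p' q'" and G = "\<lambda>p q. tensor (p *
        p') (q * q')"])
      (intro linear_intros | simp add: *)+
qed

lemma tensor_sum_left: "tensor (\<Sum>i \<in> I. f i) q = (\<Sum>i \<in> I. tensor (f i) q)"
  by (rule linear_map_sum[where F = "\<lambda>p. tensor p q"]) (intro linear_intros)

lemma tensor_sum_right: "tensor p (\<Sum>i \<in> I. f i) = (\<Sum>i \<in> I. tensor p (f i))"
  by (rule linear_map_sum[where F = "\<lambda>q. tensor p q"]) (intro linear_intros)

lemma one_word: "(1 :: 'x list \<Rightarrow>\<^sub>0 'k::comm_ring_1) = mon []"
  by (simp flip: single_one add: zero_list_def)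

lemma mon_append: "mon (v @ w) = (mon v * mon w :: 'x list \<Rightarrow>\<^sub>0 'k::comm_ring_1)"
  by (simp add: mult_single plus_list_def)

section \<open>The coproduct as a derivation\<close>

text \<open>The summands of \<open>Delta_mon\<close> that do not involve \<open>E\<close>. Splitting
  them off gives a derivation on the plain word algebra, so no product with \<open>E\<close> is ever
  needed.\<close>

definition deriv_word :: "'x list \<Rightarrow> 'x list \<times> 'x list \<Rightarrow>\<^sub>0 'k::comm_ring_1" where
  "deriv_word w = (\<Sum>i<length w. mon (take i w, drop (Suc i) w))"

definition deriv :: "('x list \<Rightarrow>\<^sub>0 'k::comm_ring_1) \<Rightarrow> 'x list \<times> 'x list \<Rightarrow>\<^sub>0 'k" where
  "deriv = lin deriv_word"

lemma linear_deriv [linear_intros]: "linear_map F \<Longrightarrow> linear_map (\<lambda>p. deriv (F p))"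
  unfolding deriv_def by (intro linear_intros)

lemma mon_Nil_Nil: "mon ([], []) = (1 :: 'x list \<times> 'y list \<Rightarrow>\<^sub>0 'k::comm_ring_1)"
  by (simp flip: single_one add: zero_prod_def zero_list_def)

lemma deriv_word_Cons:
  "deriv_word (x # w) = (mon ([], w) + mon ([x], []) * deriv_word w
     :: 'x list \<times> 'x list \<Rightarrow>\<^sub>0 'k::comm_ring_1)"
  by (simp add: deriv_word_def sum.lessThan_Suc_shift sum_distrib_left mult_single plus_list_def
      del: sum.lessThan_Suc)

lemma deriv_word_append:
  "deriv_word (v @ w) = (deriv_word v * mon ([], w) + mon (v, []) * deriv_word w
     :: 'x list \<times> 'x list \<Rightarrow>\<^sub>0 'k::comm_ring_1)"
proof (induction v)
  case Nil
  show ?case by (simp add: deriv_word_def mon_Nil_Nil)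
next
  case (Cons x v)
  then show ?case
    by (simp add: deriv_word_Cons algebra_simps mult_single plus_list_def)
      (simp add: mult_single plus_list_def flip: mult.assoc)
qed

text \<open>The deleted letter lies either in the left or in the right factor of a product of
  words.\<close>

lemma deriv_mult: "deriv (p * q) = deriv p * tensor 1 q + tensor p 1 * deriv q"
  by (rule linear_map_ext2[where F = "\<lambda>p q. deriv (p * q)" and G = "\<lambda>p q. deriv p * tensor 1 q +
      tensor p 1 * deriv q"])
    (intro linear_intros | simp add: deriv_def mult_single plus_list_def deriv_word_append one_word)+

lemma deriv_one [simp]: "deriv 1 = 0"
  by (simp add: deriv_def one_word deriv_word_def)

lemma deriv_letter: "deriv (mon [x]) = 1"
  by (simp add: deriv_def deriv_word_def mon_Nil_Nil)

lemma deriv_power_0: "deriv p = 0 \<Longrightarrow> deriv (p ^ n) = 0"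
  by (induction n) (simp_all add: deriv_mult)

lemma linear_words_to_e [linear_intros]: "linear_map F \<Longrightarrow> linear_map (\<lambda>p. words_to_e (F p))"
  unfolding words_to_e_def by (intro linear_intros)

lemma linear_Delta [linear_intros]: "linear_map F \<Longrightarrow> linear_map (\<lambda>p. Delta (F p))"
  unfolding Delta_def by (intro linear_intros)

lemma words_to_e_mon [simp]: "words_to_e (mon w) = mon (W w)"
  by (simp add: words_to_e_def)

lemma Delta_words_to_e:
  "Delta (words_to_e p) = tensor (mon E) (words_to_e p)
     + tensor_map words_to_e words_to_e (deriv p) + tensor (words_to_e p) (mon E)"
  by (rule linear_map_ext[where F = "\<lambda>p. Delta (words_to_e p)" and G = "\<lambda>p. tensor (mon E)
      (words_to_e p) + tensor_map words_to_e words_to_e (deriv p) + tensor (words_to_e p) (mon E)"])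
    (intro linear_intros | simp add: Delta_def deriv_def deriv_word_def lin_sum tensor_map_def)+

section \<open>Injectivity of the inclusion of the cd-words\<close>

lemma linear_cd_to_ab [linear_intros]: "linear_map F \<Longrightarrow> linear_map (\<lambda>p. cd_to_ab (F p))"
  unfolding cd_to_ab_def by (intro linear_intros)

lemma linear_cd_to_ab_e [linear_intros]: "linear_map F \<Longrightarrow> linear_map (\<lambda>p. cd_to_ab_e (F p))"
  unfolding cd_to_ab_e_def by (intro linear_intros)

lemma cd_to_ab_mult: "cd_to_ab (p * q) = cd_to_ab p * cd_to_ab q"
  unfolding cd_to_ab_def by (rule lin_mult) (simp add: plus_list_def)

lemma cd_to_ab_one [simp]: "cd_to_ab 1 = 1"
  by (simp add: cd_to_ab_def one_word)

lemma cd_to_ab_letter [simp]: "cd_to_ab (mon [x]) = cd_letter x"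
  by (simp add: cd_to_ab_def)

lemma cd_to_ab_e_words: "cd_to_ab_e (words_to_e p) = words_to_e (cd_to_ab p)"
  by (rule linear_map_ext[where F = "\<lambda>p. cd_to_ab_e (words_to_e p)" and G = "\<lambda>p. words_to_e
      (cd_to_ab p)"])
    (intro linear_intros | simp add: cd_to_ab_e_def)+

lemma cd_to_ab_e_E [simp]: "cd_to_ab_e (mon E) = mon E"
  by (simp add: cd_to_ab_e_def)

text \<open>A left inverse of \<^const>\<open>cd_to_ab\<close>: if \<open>q = c p + d p'\<close>, then \<open>p'\<close> and \<open>p\<close> can be
  read off the words of \<open>q\<close> that start with \<open>ab\<close>, \<open>bb\<close> and \<open>ba\<close>.\<close>

fun ab_to_cd_word :: "ab list \<Rightarrow> 'k::comm_ring_1 R_Phi" where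
  "ab_to_cd_word [] = 1"
| "ab_to_cd_word [La] = 0"
| "ab_to_cd_word [Lb] = mon [Lc]"
| "ab_to_cd_word (La # La # w) = 0"
| "ab_to_cd_word (Lb # La # w) = mon [Lc] * ab_to_cd_word (La # w)"
| "ab_to_cd_word (La # Lb # w) = mon [Ld] * ab_to_cd_word w - mon [Lc] * ab_to_cd_word (La # w)"
| "ab_to_cd_word (Lb # Lb # w) = mon [Lc] * ab_to_cd_word (Lb # w)
     + mon [Lc] * ab_to_cd_word (La # w) - mon [Ld] * ab_to_cd_word w"

definition ab_to_cd :: "'k::comm_ring_1 R_Psi \<Rightarrow> 'k R_Phi" where
  "ab_to_cd = lin ab_to_cd_word"

lemma linear_ab_to_cd [linear_intros]: "linear_map F \<Longrightarrow> linear_map (\<lambda>p. ab_to_cd (F p))"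
  unfolding ab_to_cd_def by (intro linear_intros)

text \<open>The clauses of \<open>ab_to_cd_word\<close> are made for this. For \<open>d\<close>, the
  terms with \<open>La # w\<close> of the words starting with ab and ba cancel; for
  \<open>c\<close>, the values at \<open>La # v\<close> and \<open>Lb # v\<close> always add up to
  \<open>c\<close> times the value at \<open>v\<close>.\<close>

lemma ab_to_cd_letter: "ab_to_cd (cd_letter x * p) = mon [x] * ab_to_cd p"
proof (rule linear_map_ext[where F = "\<lambda>p. ab_to_cd (cd_letter x * p)" and G = "\<lambda>p. mon [x] *
    ab_to_cd p"])
  fix w :: "ab list"
  have c: "ab_to_cd_word (La # v) + ab_to_cd_word (Lb # v)
      = (mon [Lc] * ab_to_cd_word v :: 'a R_Phi)" for v
    by (cases v rule: ab_to_cd_word.cases) (auto simp: algebra_simps)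
  show "ab_to_cd (cd_letter x * mon w) = mon [x] * (ab_to_cd (mon w) :: 'a R_Phi)"
  proof (cases x)
    case Lc
    then show ?thesis
      using c[of w] by (simp add: ab_to_cd_def distrib_right lin_add mult_single plus_list_def)
  next
    case Ld
    then show ?thesis
      by (simp add: ab_to_cd_def distrib_right lin_add mult_single plus_list_def)
  qed
qed (intro linear_intros)+

text \<open>This is the injectivity of \<open>cd_to_ab\<close>, and hence the uniqueness behind the
  descriptions in \<open>cd_index_boundary\<close> and \<open>Delta_Phi\<close>.\<close>

lemma ab_to_cd_cd_to_ab [simp]: "ab_to_cd (cd_to_ab p) = p"
proof (rule linear_map_ext[where F = "\<lambda>p. ab_to_cd (cd_to_ab p)" and G = "\<lambda>p. p"])
  fix w :: "cd list"
  show "ab_to_cd (cd_to_ab (mon w)) = (mon w :: 'a R_Phi)"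
  proof (induction w)
    case Nil
    then show ?case by (simp add: ab_to_cd_def flip: one_word) (simp add: one_word)
  next
    case (Cons x w)
    have "mon (x # w) = (mon [x] * mon w :: 'a R_Phi)"
      by (simp flip: mon_append)
    then show ?case
      using Cons by (simp add: cd_to_ab_mult ab_to_cd_letter)
  qed
qed (intro linear_intros)+

definition ab_to_cd_e :: "'k::comm_ring_1 Re_Psi \<Rightarrow> 'k Re_Phi" where
  "ab_to_cd_e = lin (\<lambda>m. case m of E \<Rightarrow> mon E | W w \<Rightarrow> words_to_e (ab_to_cd (mon w)))"

lemma linear_ab_to_cd_e [linear_intros]: "linear_map F \<Longrightarrow> linear_map (\<lambda>p. ab_to_cd_e (F p))"
  unfolding ab_to_cd_e_def by (intro linear_intros)

lemma ab_to_cd_e_words: "ab_to_cd_e (words_to_e p) = words_to_e (ab_to_cd p)"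
  by (rule linear_map_ext[where F = "\<lambda>p. ab_to_cd_e (words_to_e p)" and G = "\<lambda>p. words_to_e
      (ab_to_cd p)"])
    (intro linear_intros | simp add: ab_to_cd_e_def)+

lemma ab_to_cd_e_cd_to_ab_e: "ab_to_cd_e (cd_to_ab_e p) = p"
proof (rule linear_map_ext[where F = "\<lambda>p. ab_to_cd_e (cd_to_ab_e p)" and G = "\<lambda>p. p"])
  fix m :: "cd emon"
  show "ab_to_cd_e (cd_to_ab_e (mon m)) = (mon m :: 'a Re_Phi)"
    by (cases m) (simp_all add: cd_to_ab_e_words ab_to_cd_e_words flip: words_to_e_mon,
      simp add: ab_to_cd_e_def)
qed (intro linear_intros)+

lemma tensor_map_comp:
  assumes f: "linear_map f" and g: "linear_map g" and f': "linear_map f'" and g': "linear_map g'"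
  shows "tensor_map f g (tensor_map f' g' p) = tensor_map (\<lambda>p. f (f' p)) (\<lambda>q. g (g' q)) p"
proof (rule linear_map_ext[where F = "\<lambda>p. tensor_map f g (tensor_map f' g' p)"
      and G = "\<lambda>p. tensor_map (\<lambda>p. f (f' p)) (\<lambda>q. g (g' q)) p"])
  fix m
  show "tensor_map f g (tensor_map f' g' (mon m)) =
      tensor_map (\<lambda>p. f (f' p)) (\<lambda>q. g (g' q)) (mon m)"
    by (cases m) (simp add: tensor_map_def[of f'] tensor_map_def[of "\<lambda>p. f (f' p)"]
      tensor_map_tensor f g)
qed (intro linear_intros)+

lemma tensor_map_id: "tensor_map (\<lambda>p. p) (\<lambda>p. p) p = p"
proof (rule linear_map_ext[where F = "tensor_map (\<lambda>p. p) (\<lambda>p. p)" and G = "\<lambda>p. p"])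
  show "tensor_map (\<lambda>p. p) (\<lambda>p. p) (mon m) = mon m" for m :: "'a \<times> 'b"
    by (cases m) (simp add: tensor_map_def)
qed (intro linear_intros linear_tensor_map[OF linear_ident])+

lemma Delta_Phi_eqI:
  assumes "tensor_map cd_to_ab_e cd_to_ab_e q = Delta (cd_to_ab_e p)"
  shows "Delta_Phi p = q"
  unfolding Delta_Phi_def
proof (rule the_equality)
  fix q' :: "cd emon \<times> cd emon \<Rightarrow>\<^sub>0 'a"
  assume "tensor_map cd_to_ab_e cd_to_ab_e q' = Delta (cd_to_ab_e p)"
  then have "tensor_map ab_to_cd_e ab_to_cd_e (tensor_map cd_to_ab_e cd_to_ab_e q')
      = tensor_map ab_to_cd_e ab_to_cd_e (tensor_map cd_to_ab_e cd_to_ab_e q)"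
    using assms by simp
  then show "q' = q"
    by (simp add: tensor_map_comp linear_intros ab_to_cd_e_cd_to_ab_e tensor_map_id)
qed (fact assms)

text \<open>The reason why the coproduct preserves cd-polynomials: the derivation sends c to twice
  the unit and d to 1 (x) c + c (x) 1, and the Leibniz rule extends this to all words.\<close>

lemma ex_deriv_cd:
  "\<exists>q. tensor_map cd_to_ab cd_to_ab q = deriv (cd_to_ab (mon w) :: 'k::comm_ring_1 R_Psi)"
proof (induction w)
  case Nil
  show ?case
    by (intro exI[of _ 0]) (simp add: tensor_map_def flip: one_word)
next
  case (Cons x w)
  let ?T = "tensor_map cd_to_ab cd_to_ab :: _ \<Rightarrow> _ \<Rightarrow>\<^sub>0 'k"
  have T: "?T (tensor p q) = tensor (cd_to_ab p) (cd_to_ab q)" for p q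
    by (intro tensor_map_tensor linear_intros)
  have X: "?T (tensor p 1 * mon m) = tensor (cd_to_ab p) 1 * ?T (mon m)" for p m
  proof (cases m)
    case (Pair v w)
    have "mon m = tensor (mon v) (mon w :: 'k R_Phi)" using Pair by simp
    then show ?thesis by (simp only: tensor_mult T cd_to_ab_mult mult_1_left)
  qed
  have Tm: "?T (tensor p 1 * q) = tensor (cd_to_ab p) 1 * ?T q" for p q
    by (rule linear_map_ext[where F = "\<lambda>q. ?T (tensor p 1 * q)" and G = "\<lambda>q. tensor (cd_to_ab p) 1 *
        ?T q"])
      (intro linear_intros | rule X)+
  have "\<exists>q. ?T q = deriv (cd_letter x * p)" if ex: "\<exists>q. ?T q = deriv p" "\<exists>q. p = cd_to_ab q" for p
  proof -
    obtain q p' where q: "?T q = deriv p" "p = cd_to_ab p'" using ex by blast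
    \<comment> \<open>The Leibniz rule in terms of preimages: the case distinction is the preimage
      of the part where a letter of \<open>cd_letter x\<close> is deleted, the last summand that of
      the part where \<open>p\<close> is differentiated.\<close>
    let ?q = "(case x of Lc \<Rightarrow> tensor 1 p' + tensor 1 p' | Ld \<Rightarrow>
        tensor 1 (mon [Lc] * p') + tensor (mon [Lc]) p')
      + tensor (mon [x]) 1 * q"
    have d1: "deriv (cd_letter Lc * p) = tensor 1 p + tensor 1 p + tensor (cd_letter Lc) 1 * deriv p"
      by (simp add: deriv_mult distrib_right linear_map_add[OF linear_deriv[OF linear_ident]]
          linear_map_add[OF linear_tensor_left[OF linear_ident]] deriv_letter)
    have "deriv (cd_letter Ld) = tensor 1 (cd_letter Lc) + tensor (cd_letter Lc) (1 :: 'k R_Psi)"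
      by (simp add: linear_map_add[OF linear_deriv[OF linear_ident]] deriv_mult deriv_letter
          linear_map_add[OF linear_tensor_left[OF linear_ident]]
          linear_map_add[OF linear_tensor_right[OF linear_ident]])
    then have d2: "deriv (cd_letter Ld * p) = tensor 1 (cd_letter Lc * p) + tensor (cd_letter Lc) p
        + tensor (cd_letter Ld) 1 * deriv p"
      by (simp add: deriv_mult distrib_right tensor_mult del: cd_letter.simps)
    have "?T ?q = deriv (cd_letter x * p)"
      using d1 d2 by (cases x) (simp_all add: linear_map_add[OF linear_tensor_map[OF linear_ident]]
          T Tm cd_to_ab_mult q del: cd_letter.simps)
    then show ?thesis by blast
  qed
  from this[OF Cons, OF exI, OF refl] show ?case
    using cd_to_ab_mult[of "mon [x]" "mon w :: 'k R_Phi"] mon_append[of "[x]" w, where ?'k = 'k]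
    by (simp del: cd_letter.simps)
qed

lemma tensor_map_Delta_Phi_mon:
  "tensor_map cd_to_ab_e cd_to_ab_e (Delta_Phi (mon m)) =
     Delta (cd_to_ab_e (mon m) :: 'k::comm_ring_1 Re_Psi)"
proof -
  let ?T = "tensor_map cd_to_ab_e cd_to_ab_e :: _ \<Rightarrow> _ \<Rightarrow>\<^sub>0 'k"
  have T: "?T (tensor p q) = tensor (cd_to_ab_e p) (cd_to_ab_e q)" for p q
    by (intro tensor_map_tensor linear_intros)
  have "\<exists>q. ?T q = Delta (cd_to_ab_e (mon m))"
  proof (cases m)
    case E
    then show ?thesis using T[of "mon E" "mon E"]
      by (intro exI[of _ "mon (E, E)"]) (simp add: Delta_def)
  next
    case (W w)
    obtain q where q: "tensor_map cd_to_ab cd_to_ab q = deriv (cd_to_ab (mon w) :: 'k R_Psi)"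
      using ex_deriv_cd by blast
    let ?q = "tensor (mon E) (mon (W w)) + tensor_map words_to_e words_to_e q
      + tensor (mon (W w)) (mon E)"
    have "?T ?q = Delta (words_to_e (cd_to_ab (mon w)))"
      unfolding Delta_words_to_e q[symmetric]
      using cd_to_ab_e_words[of "mon w :: 'k R_Phi"]
      by (simp add: linear_map_add[OF linear_tensor_map[OF linear_ident]] T tensor_map_comp
          linear_intros cd_to_ab_e_words del: tensor_mon)
    then show ?thesis
      using W cd_to_ab_e_words[of "mon w :: 'k R_Phi"] by auto
  qed
  then show ?thesis using Delta_Phi_eqI by blast
qed

text \<open>As \<open>Delta_Phi\<close> is a description, its linearity is not evident. By
  uniqueness it agrees with the linear extension of its values on monomials, which is the form that
  occurs in \<open>varrho\<close>.\<close>

lemma lin_Delta_Phi: "lin (\<lambda>m. Delta_Phi (mon m)) p = Delta_Phi p"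
proof (rule Delta_Phi_eqI[symmetric])
  show "tensor_map cd_to_ab_e cd_to_ab_e (lin (\<lambda>m. Delta_Phi (mon m)) p) = Delta (cd_to_ab_e p)"
    by (rule linear_map_ext[where
          F = "\<lambda>p. tensor_map cd_to_ab_e cd_to_ab_e (lin (\<lambda>m. Delta_Phi (mon m)) p)"
          and G = "\<lambda>p. Delta (cd_to_ab_e p)"])
      (intro linear_intros | simp add: tensor_map_Delta_Phi_mon)+
qed

lemma linear_varrho [linear_intros]: "linear_map F \<Longrightarrow> linear_map (\<lambda>p. varrho (F p))"
  unfolding varrho_def by (intro linear_intros)

lemma varrho_tensor:
  assumes "Delta_Phi p = (\<Sum>i \<in> I. tensor (f i) (g i))"
  shows "varrho (tensor l p) = (\<Sum>i \<in> I. tensor (tensor l (f i)) (g i))"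
proof (rule linear_map_ext[where F = "\<lambda>l. varrho (tensor l p)" and G = "\<lambda>l. \<Sum>i \<in> I. tensor (tensor l
    (f i)) (g i)"])
  fix w' :: "cd list"
  let ?S = "lin (\<lambda>(w1, w2). mon ((w', w1), w2)) :: _ \<Rightarrow> _ \<Rightarrow>\<^sub>0 'a"
  have S: "?S (tensor p q) = tensor (tensor (mon w') p) q" for p q
    by (rule linear_map_ext2[where F = "\<lambda>p q. ?S (tensor p q)" and G = "\<lambda>p q. tensor (tensor (mon
        w') p) q"])
      (intro linear_intros | simp)+
  have "varrho (tensor (mon w') p) = ?S (lin (\<lambda>m. Delta_Phi (mon m)) p)"
    by (rule linear_map_ext[where F = "\<lambda>p. varrho (tensor (mon w') p)" and G = "\<lambda>p. ?S (lin (\<lambda>m.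
        Delta_Phi (mon m)) p)"])
      (intro linear_intros | simp add: varrho_def)+
  then show "varrho (tensor (mon w') p) = (\<Sum>i \<in> I. tensor (tensor (mon w') (f i)) (g i))"
    by (simp add: lin_Delta_Phi assms lin_sum S)
qed (intro linear_intros)+

section \<open>Homogeneous elements\<close>

text \<open>The degree function is a parameter because words, cd-words, \<open>emon\<close> and
  exponent pairs are all graded; its values are integers because \<open>E\<close> has degree
  -1.\<close>

definition homog :: "('m \<Rightarrow> int) \<Rightarrow> int \<Rightarrow> ('m \<Rightarrow>\<^sub>0 'k::comm_ring_1) \<Rightarrow> bool" where
  "homog \<delta> n p \<longleftrightarrow> (\<forall>m \<in> Poly_Mapping.keys p. \<delta> m = n)"

abbreviation len :: "'x list \<Rightarrow> int" where "len w \<equiv> int (length w)"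

lemma homog_zero [simp]: "homog \<delta> n 0"
  by (simp add: homog_def)

lemma homog_add: "homog \<delta> n p \<Longrightarrow> homog \<delta> n q \<Longrightarrow> homog \<delta> n (p + q)"
  using keys_add[of p q] by (auto simp: homog_def)

lemma homog_minus: "homog \<delta> n p \<Longrightarrow> homog \<delta> n q \<Longrightarrow> homog \<delta> n (p - q)"
  using keys_diff[of p q] by (auto simp: homog_def)

lemma homog_sum: "(\<And>i. i \<in> I \<Longrightarrow> homog \<delta> n (f i)) \<Longrightarrow> homog \<delta> n (sum f I)"
  by (induction I rule: infinite_finite_induct) (auto intro: homog_add)

lemma homog_scale: "homog \<delta> n p \<Longrightarrow> homog \<delta> n (scale c p)"
  by (auto simp: homog_def in_keys_iff)

lemma homog_mon: "\<delta> m = n \<Longrightarrow> homog \<delta> n (mon m)"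
  by (auto simp: homog_def split: if_splits)

lemma homog_mult:
  fixes p q :: "'m::monoid_add \<Rightarrow>\<^sub>0 'k::comm_ring_1"
  assumes "\<And>m m'. \<delta> (m + m') = \<delta> m + \<delta> m'" "homog \<delta> i p" "homog \<delta> j q" "n = i + j"
  shows "homog \<delta> n (p * q)"
  using keys_mult[of p q] assms by (fastforce simp: homog_def)

lemma len_add: "len (v + w) = len v + len w"
  by (simp add: plus_list_def)

lemma homog_lin:
  assumes "homog \<delta> n p" "\<And>m. \<delta> m = n \<Longrightarrow> homog \<delta>' k (f m)"
  shows "homog \<delta>' k (lin f p)"
  unfolding lin_eq_sum_scale
  by (intro homog_sum homog_scale assms(2)) (use assms(1) in \<open>auto simp: homog_def\<close>)

abbreviation cd_deg :: "cd list \<Rightarrow> int" where "cd_deg w \<equiv> sum_list (map deg_cd w)"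

lemma homog_ab_to_cd_word: "homog cd_deg (len w) (ab_to_cd_word w :: 'k::comm_ring_1 R_Phi)"
proof -
  have add: "cd_deg (v + w) = cd_deg v + cd_deg w" for v w
    by (simp add: plus_list_def)
  have m: "homog cd_deg (n + deg_cd x) (mon [x] * p)" if "homog cd_deg n p"
    for n x and p :: "'k R_Phi"
    using that by (intro homog_mult[OF add homog_mon[OF refl]]) auto
  show ?thesis
  proof (induction w rule: ab_to_cd_word.induct)
    case 1
    show ?case by (simp add: one_word homog_mon)
  next
    case (5 w)
    then show ?case using m[OF 5, of Lc] by (simp add: add.commute)
  next
    case (6 w)
    then show ?case using m[OF 6(1), of Ld] m[OF 6(2), of Lc]
      by (simp add: add.commute homog_minus)
  next
    case (7 w)
    then show ?case using m[OF 7(1), of Lc] m[OF 7(2), of Lc] m[OF 7(3), of Ld]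
      by (simp add: add.commute homog_minus homog_add)
  qed (simp_all add: homog_mon)
qed

text \<open>The cd-polynomials of posets are given by descriptions, so their degree is recovered
  from the ab-index through the left inverse.\<close>

lemma homog_ab_to_cd: "homog len n p \<Longrightarrow> homog cd_deg n (ab_to_cd p)"
  unfolding ab_to_cd_def using homog_ab_to_cd_word by (intro homog_lin) auto

section \<open>The maps F and G\<close>

lemma linear_bar [linear_intros]: "linear_map F \<Longrightarrow> linear_map (\<lambda>p. bar (F p))"
  unfolding bar_def by (intro linear_intros)

lemma linear_t_lower_half [linear_intros]:
  "linear_map F \<Longrightarrow> linear_map (\<lambda>p. t_lower_half n (F p))"
  unfolding t_lower_half_def by (intro linear_intros)

lemma bar_mult: "bar (p * q) = bar p * bar q"
  unfolding bar_def by (rule lin_mult) (auto simp: mult_single)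

lemma bar_one [simp]: "bar 1 = 1"
proof -
  have "bar (mon (0, 0)) = mon (0, 0)" by (simp add: bar_def)
  then show ?thesis unfolding zero_prod_def[symmetric] single_one .
qed

lemma bar_add: "bar (p + q) = bar p + bar q"
  by (simp add: bar_def lin_add)

lemma bar_minus: "bar (p - q) = bar p - bar q"
  by (rule linear_map_minus) (intro linear_intros)

lemma bar_sum: "bar (sum f I) = (\<Sum>i \<in> I. bar (f i))"
  by (simp add: bar_def lin_sum)

lemma bar_power: "bar (p ^ n) = bar p ^ n"
  by (induction n) (simp_all add: bar_mult)

lemma bar_var [simp]: "bar var_t = var_u" "bar var_u = var_t"
  by (simp_all add: bar_def var_t_def var_u_def)

abbreviation tmu :: "'k::comm_ring_1 poly_tu" where "tmu \<equiv> var_t - var_u"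

lemma bar_tmu: "bar tmu = - tmu"
  by (simp add: bar_minus)

section \<open>F, G and kappa on plain words\<close>

definition ab_F :: "'k::comm_ring_1 R_Psi \<Rightarrow> 'k poly_tu" where "ab_F = lin F_word"
definition ab_G :: "'k::comm_ring_1 R_Psi \<Rightarrow> 'k poly_tu" where "ab_G = lin G_word"
definition ab_kappa :: "'k::comm_ring_1 R_Psi \<Rightarrow> 'k poly_tu" where
  "ab_kappa = lin (\<lambda>w. kappa_mon (W w))"

lemma linear_ab_F [linear_intros]: "linear_map F \<Longrightarrow> linear_map (\<lambda>p. ab_F (F p))"
  unfolding ab_F_def by (intro linear_intros)

lemma linear_ab_G [linear_intros]: "linear_map F \<Longrightarrow> linear_map (\<lambda>p. ab_G (F p))"
  unfolding ab_G_def by (intro linear_intros)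

lemma linear_ab_kappa [linear_intros]: "linear_map F \<Longrightarrow> linear_map (\<lambda>p. ab_kappa (F p))"
  unfolding ab_kappa_def by (intro linear_intros)

lemmas ab_F_sum = linear_map_sum[OF linear_ab_F[OF linear_ident]]
  and ab_F_add = linear_map_add[OF linear_ab_F[OF linear_ident]]
  and ab_F_minus = linear_map_minus[OF linear_ab_F[OF linear_ident]]
  and ab_G_sum = linear_map_sum[OF linear_ab_G[OF linear_ident]]

lemma map_F_words: "map_F (words_to_e p) = ab_F p"
  and map_G_words: "map_G (words_to_e p) = ab_G p"
  by (simp_all add: map_F_def map_G_def ab_F_def ab_G_def words_to_e_def lin_lin)

lemma ab_kappa_mult: "ab_kappa (p * q) = ab_kappa p * ab_kappa q"
  unfolding ab_kappa_def by (rule lin_mult) (auto simp: plus_list_def power_add)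

abbreviation (input) la :: "'k::comm_ring_1 R_Psi" where "la \<equiv> mon [La]"
abbreviation (input) lb :: "'k::comm_ring_1 R_Psi" where "lb \<equiv> mon [Lb]"
definition lx :: "'k::comm_ring_1 R_Psi" where "lx = mon [La] - mon [Lb]"

lemma ab_kappa_simps [simp]: "ab_kappa la = tmu" "ab_kappa lb = 0" "ab_kappa 1 = 1"
  by (simp_all add: ab_kappa_def one_word)

lemma ab_kappa_lx: "ab_kappa (lx ^ n) = tmu ^ n"
  by (induction n)
    (simp_all add: ab_kappa_mult lx_def linear_map_minus[OF linear_ab_kappa[OF linear_ident]])

lemma deriv_lx: "deriv (lx ^ n) = 0"
  by (rule deriv_power_0)
    (simp add: lx_def linear_map_minus[OF linear_deriv[OF linear_ident]] deriv_letter)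

lemma bar_ab_F: "bar (ab_F p) = ab_kappa p + nabla_tensor ab_G ab_kappa (deriv p)"
proof (rule linear_map_ext[where F = "\<lambda>p. bar (ab_F p)" and
      G = "\<lambda>p. ab_kappa p + nabla_tensor ab_G ab_kappa (deriv p)"])
  fix w :: "ab list"
  show "bar (ab_F (mon w)) = ab_kappa (mon w) + nabla_tensor ab_G ab_kappa (deriv (mon w) :: _ \<Rightarrow>\<^sub>0 'a)"
    by (simp add: ab_F_def F_word.simps ab_kappa_def ab_G_def deriv_def deriv_word_def
        nabla_tensor_def lin_sum del: kappa_mon.simps)
qed (intro linear_intros)+

lemma nabla_mult_right:
  "nabla_tensor ab_G ab_kappa (q * tensor 1 r) =
     nabla_tensor ab_G ab_kappa q * ab_kappa r"
proof (rule linear_map_ext2[where F = "\<lambda>q r. nabla_tensor ab_G ab_kappa (q * tensor 1 r)" and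
      G = "\<lambda>q r. nabla_tensor ab_G ab_kappa q * ab_kappa r"])
  fix m :: "ab list \<times> ab list" and w :: "ab list"
  obtain u v where m: "m = (u, v)" by (cases m)
  have "mon m * tensor 1 (mon w) = tensor (mon u) (mon v * mon w :: 'a R_Psi)"
    by (simp add: m tensor_mult flip: tensor_mon)
  then show "nabla_tensor ab_G ab_kappa (mon m * tensor 1 (mon w)) =
      nabla_tensor ab_G ab_kappa (mon m) * (ab_kappa (mon w) :: 'a poly_tu)"
    by (simp add: nabla_tensor_tensor linear_intros ab_kappa_mult m mult.assoc flip: tensor_mon)
qed (intro linear_intros)+

lemma nabla_tensor_ab: "nabla_tensor ab_G ab_kappa (tensor p q) = ab_G p * ab_kappa q"
  by (intro nabla_tensor_tensor linear_intros)

lemma bar_F_lx: "bar (ab_F (lx ^ n)) = tmu ^ n"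
  by (simp add: bar_ab_F ab_kappa_lx deriv_lx linear_map_zero[OF linear_nabla_tensor[OF linear_ident]])

text \<open>The Leibniz rule leaves two parts. One keeps \<open>lb\<close> in the right tensor
  factor, where \<open>ab_kappa\<close> kills it, as it kills the whole word; the other deletes this
  \<open>lb\<close> and survives.\<close>

lemma bar_F_b_lx: "bar (ab_F (p * lb * lx ^ m)) = ab_G p * tmu ^ m"
proof -
  have "deriv (p * lb * lx ^ m) = deriv p * tensor 1 (lb * lx ^ m) + tensor p (lx ^ m)"
    by (simp add: deriv_mult deriv_lx deriv_letter distrib_right mult.assoc tensor_mult)
  then show ?thesis
    by (simp add: bar_ab_F ab_kappa_mult ab_kappa_lx nabla_mult_right nabla_tensor_ab
        linear_map_add[OF linear_nabla_tensor[OF linear_ident]])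
qed

lemma bar_F_a: "bar (ab_F (p * la)) = tmu * bar (ab_F p) + ab_G p"
proof -
  have "deriv (p * la) = deriv p * tensor 1 la + tensor p 1"
    by (simp add: deriv_mult deriv_letter)
  then show ?thesis
    by (simp add: bar_ab_F ab_kappa_mult nabla_mult_right nabla_tensor_ab algebra_simps
        linear_map_add[OF linear_nabla_tensor[OF linear_ident]])
qed

text \<open>\<open>G_word\<close> truncates at a bound that depends on the length of the word; on a
  homogeneous element the bound is constant, so the whole sum can be truncated at once.\<close>

lemma ab_G_homog:
  assumes "homog len (int n) p"
  shows "ab_G p = t_lower_half (n + 1) ((var_u - var_t) * ab_F p)"
proof -
  let ?T = "\<lambda>p. t_lower_half (n + 1) ((var_u - var_t) * p) :: 'a poly_tu"
  have T: "linear_map ?T" by (intro linear_intros)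
  have "?T (ab_F p) = (\<Sum>w \<in> Poly_Mapping.keys p. scale (Poly_Mapping.lookup p w) (?T (F_word w)))"
    by (simp only: ab_F_def lin_eq_sum_scale linear_map_sum[OF T] linear_map_scale[OF T])
  also have "\<dots> = ab_G p"
    unfolding ab_G_def lin_eq_sum_scale
    by (intro sum.cong refl arg_cong[of _ _ "scale _"])
      (use assms in \<open>auto simp: homog_def G_word.simps\<close>)
  finally show ?thesis by simp
qed

section \<open>The ab-index as a sum over chains\<close>

definition chain_word :: "nat \<Rightarrow> nat set \<Rightarrow> 'k::comm_ring_1 R_Psi" where
  "chain_word n T = prod_list (map (\<lambda>i. if i \<in> T then lb else lx) [1..<Suc n])"

text \<open>Set and rank function are free parameters, so ideals, open intervals and upper sets of
  one relation are covered without restricting it; for upper sets only the ranks are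
  shifted.\<close>

definition Psi :: "'a rel \<Rightarrow> ('a \<Rightarrow> nat) \<Rightarrow> 'a set \<Rightarrow> nat \<Rightarrow> 'k::comm_ring_1 R_Psi" where
  "Psi r \<rho> A n = (\<Sum>C | C \<in> Chains r \<and> C \<subseteq> A. chain_word n (\<rho> ` C))"

text \<open>Only what sums over chains need. No saturation and no elements of rank \<open>n\<close>
  are demanded, so the notion passes to all subsets, and after a shift of ranks to upper
  sets.\<close>

definition graded_set :: "'a rel \<Rightarrow> ('a \<Rightarrow> nat) \<Rightarrow> 'a set \<Rightarrow> nat \<Rightarrow> bool" where
  "graded_set r \<rho> A n \<longleftrightarrow> Partial_order r \<and> finite A \<and> A \<subseteq> Field r \<and>
     (\<forall>x \<in> A. 1 \<le> \<rho> x \<and> \<rho> x \<le> n) \<and>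
     (\<forall>x \<in> A. \<forall>y \<in> A. (x, y) \<in> r \<longrightarrow> x \<noteq> y \<longrightarrow> \<rho> x < \<rho> y)"

definition below :: "'a rel \<Rightarrow> 'a set \<Rightarrow> 'a \<Rightarrow> 'a set" where
  "below r A x = {y \<in> A. (y, x) \<in> r \<and> y \<noteq> x}"

definition above :: "'a rel \<Rightarrow> 'a set \<Rightarrow> 'a \<Rightarrow> 'a set" where
  "above r A x = {y \<in> A. (x, y) \<in> r \<and> y \<noteq> x}"

abbreviation Psi_below where
  "Psi_below r \<rho> A x \<equiv> Psi r \<rho> (below r A x) (\<rho> x - 1)"

lemma Psi_cong:
  assumes "\<And>x y. x \<in> A \<Longrightarrow> y \<in> A \<Longrightarrow> (x, y) \<in> r \<longleftrightarrow> (x, y) \<in> r'"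
    and "\<And>x. x \<in> A \<Longrightarrow> \<rho> x = \<rho>' x"
  shows "Psi r \<rho> A n = Psi r' \<rho>' A n"
proof -
  have "{C. C \<in> Chains r \<and> C \<subseteq> A} = {C. C \<in> Chains r' \<and> C \<subseteq> A}"
    using assms(1) unfolding Chains_def by blast
  moreover have "\<rho> ` C = \<rho>' ` C" if "C \<subseteq> A" for C
    using assms(2) that by (auto simp: image_def subset_iff)
  ultimately show ?thesis
    unfolding Psi_def by (intro sum.cong) auto
qed

lemma homog_lx: "homog len 1 lx"
  unfolding lx_def by (intro homog_minus homog_mon) auto

lemma homog_chain_word: "homog len (int n) (chain_word n T)"
proof (induction n)
  case 0
  show ?case by (simp add: chain_word_def one_word homog_mon)
next
  case (Suc n)
  have eq: "chain_word (Suc n) T = chain_word n T * (if Suc n \<in> T then lb else lx)"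
    by (simp add: chain_word_def)
  have "homog len 1 (if Suc n \<in> T then lb else lx)"
    using homog_lx by (auto intro: homog_mon)
  then show ?case
    unfolding eq by (rule homog_mult[OF len_add Suc]) simp
qed

lemma homog_Psi: "homog len (int n) (Psi r \<rho> A n)"
  unfolding Psi_def by (intro homog_sum homog_chain_word)

lemma chain_word_split:
  assumes "T \<subseteq> {1..<k}" "1 \<le> k" "k \<le> n"
  shows "chain_word n (insert k T) = chain_word (k - 1) T * lb * lx ^ (n - k)"
  using assms(3)
proof (induction n rule: dec_induct)
  case base
  have 1: "[1..<Suc k] = [1..<k] @ [k]" using assms(2) by simp
  have 2: "map (\<lambda>i. if i \<in> insert k T then lb else lx) [1..<k] =
      (map (\<lambda>i. if i \<in> T then lb else lx) [1..<k] :: 'a R_Psi list)"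
    by (intro map_cong) auto
  have "chain_word k (insert k T) = chain_word (k - 1) T * (lb :: 'a R_Psi)"
    using assms(2) unfolding chain_word_def 1 map_append 2 by (simp del: upt_Suc)
  then show ?case by simp
next
  case (step n)
  have "Suc n \<notin> insert k T" using assms(1) step by auto
  then have eq: "chain_word (Suc n) (insert k T) = chain_word n (insert k T) * lx"
    using assms(2) by (simp add: chain_word_def)
  show ?case
    unfolding eq step.IH using step.hyps by (simp add: Suc_diff_le mult.assoc power_commutes)
qed

lemma graded_set_below:
  assumes "graded_set r \<rho> A n" "x \<in> A"
  shows "graded_set r \<rho> (below r A x) (\<rho> x - 1)"
  using assms unfolding graded_set_def below_def by (auto simp: less_imp_le_nat Suc_leI le_diff_conv2)

lemma below_below:
  assumes "graded_set r \<rho> A n" "x \<in> A" "y \<in> below r A x"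
  shows "below r (below r A x) y = below r A y"
proof -
  have t: "trans r" "antisym r"
    using assms(1) by (auto simp: graded_set_def partial_order_on_def preorder_on_def)
  show ?thesis
    using assms t unfolding below_def by (auto dest: transD antisymD)
qed

lemma chain_word_empty: "chain_word n {} = lx ^ n"
  by (induction n) (simp_all add: chain_word_def power_commutes)

text \<open>Nonempty chains are sorted by their largest element \<open>x\<close>: the rest of the
  chain lies strictly below \<open>x\<close>, rank \<open>\<rho> x\<close> carries
  \<open>lb\<close>, and all higher ranks carry X. The empty chain gives the pure power of
  X.\<close>

lemma Psi_rec:
  assumes "graded_set r \<rho> A n"
  shows "(Psi r \<rho> A n :: 'k::comm_ring_1 R_Psi) = lx ^ n + (\<Sum>x \<in> A. Psi_below r \<rho> A x * lb * lx ^ (n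
      - \<rho> x))"
proof -
  have partial_order: "Partial_order r" and fA: "finite A" and AF: "A \<subseteq> Field r"
    and rk: "\<And>x. x \<in> A \<Longrightarrow> 1 \<le> \<rho> x \<and> \<rho> x \<le> n"
    and less: "\<And>x y. x \<in> A \<Longrightarrow> y \<in> A \<Longrightarrow> (x, y) \<in> r \<Longrightarrow> x \<noteq> y \<Longrightarrow> \<rho> x < \<rho> y"
    using assms unfolding graded_set_def by blast+
  have rel_refl: "(x, x) \<in> r" if "x \<in> A" for x
    using partial_order AF that by (auto simp: partial_order_on_def preorder_on_def refl_on_def)
  let ?B = "\<lambda>x. {C. C \<in> Chains r \<and> C \<subseteq> below r A x}"
  have fB: "finite (?B x)" for x
    by (rule finite_subset[of _ "Pow A"]) (use fA in \<open>auto simp: below_def\<close>)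
  have eq: "{C. C \<in> Chains r \<and> C \<subseteq> A} = insert {} (\<Union>x \<in> A. insert x ` ?B x)"
  proof (intro equalityI subsetI)
    fix C assume C: "C \<in> {C. C \<in> Chains r \<and> C \<subseteq> A}"
    show "C \<in> insert {} (\<Union>x \<in> A. insert x ` ?B x)"
    proof (cases "C = {}")
      case False
      have "finite C" using C fA finite_subset by blast
      then obtain x where x: "x \<in> C" "\<And>y. y \<in> C \<Longrightarrow> \<rho> y \<le> \<rho> x"
        using False ex_max_on[of C \<rho>] by blast
      have "(y, x) \<in> r" if "y \<in> C" for y
      proof -
        have "(x, y) \<in> r \<or> (y, x) \<in> r" using C x(1) that by (auto simp: Chains_def)
        moreover have "\<not> \<rho> x < \<rho> y" using x(2)[OF that] by simp
        ultimately show ?thesis using less[of x y] rel_refl[of x] C x(1) that by blast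
      qed
      then have "C - {x} \<in> ?B x"
        using C by (auto simp: Chains_def below_def)
      moreover have "C = insert x (C - {x})" using x by auto
      ultimately show ?thesis using x(1) C by blast
    qed simp
  next
    fix C assume "C \<in> insert {} (\<Union>x \<in> A. insert x ` ?B x)"
    then show "C \<in> {C. C \<in> Chains r \<and> C \<subseteq> A}"
      using rel_refl unfolding Chains_def below_def by auto
  qed
  \<comment> \<open>Two different maxima of the same chain would lie strictly below each other, so
    the families for different \<open>x\<close> are disjoint.\<close>
  have mx: "x = y" if "insert x C = insert y D" "C \<subseteq> below r A x" "D \<subseteq> below r A y" "x \<in> A" "y \<in> A"
      for x y C D
  proof (rule ccontr)
    assume "x \<noteq> y"
    then have "x \<in> D" "y \<in> C" using that by auto
    then show False using that less[of x y] less[of y x] unfolding below_def by force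
  qed
  have "(Psi r \<rho> A n :: 'k R_Psi) = chain_word n {} + (\<Sum>C \<in> (\<Union>x \<in> A. insert x ` ?B x). chain_word n
      (\<rho> ` C))"
    unfolding Psi_def eq using fA fB by (subst sum.insert) auto
  also have "(\<Sum>C \<in> (\<Union>x \<in> A. insert x ` ?B x). chain_word n (\<rho> ` C) :: 'k R_Psi) =
      (\<Sum>x \<in> A. \<Sum>C \<in> insert x ` ?B x. chain_word n (\<rho> ` C))"
  proof (rule sum.UNION_disjoint)
    show "\<forall>x \<in> A. \<forall>y \<in> A. x \<noteq> y \<longrightarrow> insert x ` ?B x \<inter> insert y ` ?B y = {}"
      using mx by blast
  qed (use fA fB in auto)
  also have "\<dots> = (\<Sum>x \<in> A. Psi_below r \<rho> A x * lb * lx ^ (n - \<rho> x))"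
  proof (rule sum.cong[OF refl])
    fix x assume x: "x \<in> A"
    have inj: "inj_on (insert x) (?B x)"
      unfolding inj_on_def below_def by (auto simp: insert_ident)
    have "(\<Sum>C \<in> insert x ` ?B x. chain_word n (\<rho> ` C) :: 'k R_Psi) = (\<Sum>C \<in> ?B x. chain_word n
        (insert (\<rho> x) (\<rho> ` C)))"
      by (simp add: sum.reindex[OF inj])
    also have "\<dots> = (\<Sum>C \<in> ?B x. chain_word (\<rho> x - 1) (\<rho> ` C) * lb * lx ^ (n - \<rho> x))"
    proof (rule sum.cong[OF refl])
      fix C assume C: "C \<in> ?B x"
      have "\<rho> ` C \<subseteq> {1..<\<rho> x}"
        using C rk less x unfolding below_def by fastforce
      then show "chain_word n (insert (\<rho> x) (\<rho> ` C)) =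
          (chain_word (\<rho> x - 1) (\<rho> ` C) * lb * lx ^ (n - \<rho> x) :: 'k R_Psi)"
        using rk[OF x] by (intro chain_word_split) auto
    qed
    finally show "(\<Sum>C \<in> insert x ` ?B x. chain_word n (\<rho> ` C) :: 'k R_Psi) =
        Psi_below r \<rho> A x * lb * lx ^ (n - \<rho> x)"
      by (simp add: Psi_def sum_distrib_right)
  qed
  finally show ?thesis by (simp add: chain_word_empty)
qed

lemma bar_F_Psi:
  assumes "graded_set r \<rho> A n"
  shows "bar (ab_F (Psi r \<rho> A n)) =
     tmu ^ n + (\<Sum>x \<in> A. ab_G (Psi_below r \<rho> A x) * tmu ^ (n - \<rho> x))"
  by (simp add: Psi_rec[OF assms] ab_F_add ab_F_sum bar_add bar_sum bar_F_lx bar_F_b_lx)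

text \<open>The Leibniz rule is applied to the recursion. Deleting the \<open>lb\<close> of
  \<open>x\<close> gives \<open>Psi_below\<close> tensor a power of X; an earlier deletion splits
  \<open>Psi_below\<close> at some \<open>y\<close> by induction. For fixed \<open>y\<close> the
  terms reassemble to the recursion for the set above \<open>y\<close>.\<close>

lemma Psi_deriv:
  assumes "graded_set r \<rho> A n"
  shows "deriv (Psi r \<rho> A n :: 'k::comm_ring_1 R_Psi) =
     (\<Sum>x \<in> A. tensor (Psi_below r \<rho> A x) (Psi r (\<lambda>y. \<rho> y - \<rho> x) (above r A x) (n - \<rho> x)))"
  using assms
proof (induction n arbitrary: A rule: less_induct)
  case (less n)
  note g = less.prems
  have fA: "finite A" and AF: "A \<subseteq> Field r"
    and rk: "\<And>x. x \<in> A \<Longrightarrow> 1 \<le> \<rho> x \<and> \<rho> x \<le> n"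
    and lt: "\<And>x y. x \<in> A \<Longrightarrow> y \<in> A \<Longrightarrow> (x, y) \<in> r \<Longrightarrow> x \<noteq> y \<Longrightarrow> \<rho> x < \<rho> y"
    and partial_order: "Partial_order r"
    using g unfolding graded_set_def by blast+
  have t: "trans r" "antisym r"
    using partial_order by (auto simp: partial_order_on_def preorder_on_def)
  let ?U = "\<lambda>A n x. Psi r (\<lambda>y. \<rho> y - \<rho> x) (above r A x) (n - \<rho> x) :: 'k R_Psi"
  let ?L = "\<lambda>x. Psi_below r \<rho> A x :: 'k R_Psi"
  have IH: "deriv (?L x) = (\<Sum>y \<in> below r A x. tensor (?L y) (?U (below r A x) (\<rho> x - 1) y))"
    if x: "x \<in> A" for x
  proof -
    have "deriv (?L x) = (\<Sum>y \<in> below r A x. tensor (Psi_below r \<rho> (below r A x) y) (?U (below r A x)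
        (\<rho> x - 1) y))"
      using rk[OF x] graded_set_below[OF g x] by (intro less.IH) auto
    then show ?thesis using below_below[OF g x] by simp
  qed
  have ab: "above r (below r A x) y = below r (above r A y) x" for x y
    by (auto simp: above_def below_def)
  \<comment> \<open>The recursion for the set above \<open>y\<close>, with ranks renormalised so
    that its summands are those produced by the induction hypothesis.\<close>
  have U: "?U A n y = lx ^ (n - \<rho> y) + (\<Sum>x \<in> above r A y. ?U (below r A x) (\<rho> x - 1) y * lb * lx ^
      (n - \<rho> x))"
    if y: "y \<in> A" for y
  proof -
    have "graded_set r (\<lambda>z. \<rho> z - \<rho> y) (above r A y) (n - \<rho> y)"
      using g y unfolding graded_set_def above_def by (auto simp: Suc_leI diff_le_mono
          less_imp_le_nat intro!: diff_less_mono)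
    from Psi_rec[OF this] have "?U A n y = lx ^ (n - \<rho> y) +
        (\<Sum>x \<in> above r A y. Psi r (\<lambda>z. \<rho> z - \<rho> y) (below r (above r A y) x) (\<rho> x - \<rho> y - 1)
          * lb * lx ^ (n - \<rho> y - (\<rho> x - \<rho> y)))" .
    also have "\<dots> = lx ^ (n - \<rho> y) + (\<Sum>x \<in> above r A y. ?U (below r A x) (\<rho> x - 1) y * lb * lx ^ (n -
        \<rho> x))"
    proof (intro arg_cong2[of _ _ _ _ "(+)"] sum.cong refl)
      fix x assume "x \<in> above r A y"
      then have "\<rho> y < \<rho> x" using lt y by (auto simp: above_def)
      then have 1: "\<rho> x - \<rho> y - 1 = \<rho> x - 1 - \<rho> y" "n - \<rho> y - (\<rho> x - \<rho> y) = n - \<rho> x" by auto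
      show "Psi r (\<lambda>z. \<rho> z - \<rho> y) (below r (above r A y) x) (\<rho> x - \<rho> y - 1)
          * lb * lx ^ (n - \<rho> y - (\<rho> x - \<rho> y)) = ?U (below r A x) (\<rho> x - 1) y * lb * lx ^ (n - \<rho> x)"
        unfolding 1 ab ..
    qed
    finally show ?thesis .
  qed
  have "deriv (Psi r \<rho> A n) = (\<Sum>x \<in> A. deriv (?L x) * tensor 1 (lb * lx ^ (n - \<rho> x)) + tensor (?L x)
      (lx ^ (n - \<rho> x)))"
    unfolding Psi_rec[OF g]
    by (simp add: linear_map_add[OF linear_deriv[OF linear_ident]]
        linear_map_sum[OF linear_deriv[OF linear_ident]] deriv_mult deriv_lx deriv_letter
        distrib_right mult.assoc tensor_mult)
  also have "\<dots> = (\<Sum>x \<in> A. \<Sum>y \<in> below r A x. tensor (?L y) (?U (below r A x) (\<rho> x - 1) y * lb * lx ^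
      (n - \<rho> x)))
      + (\<Sum>x \<in> A. tensor (?L x) (lx ^ (n - \<rho> x)))"
    unfolding sum.distrib
    by (intro arg_cong2[of _ _ _ _ "(+)"] sum.cong refl)
      (simp only: IH sum_distrib_right tensor_mult mult_1_right mult.assoc)
  also have "(\<Sum>x \<in> A. \<Sum>y \<in> below r A x. tensor (?L y) (?U (below r A x) (\<rho> x - 1) y * lb * lx ^ (n -
      \<rho> x)))
      = (\<Sum>y \<in> A. \<Sum>x \<in> above r A y. tensor (?L y) (?U (below r A x) (\<rho> x - 1) y * lb * lx ^ (n - \<rho> x)))"
    unfolding below_def[of r A] above_def[of r A] using fA
    by (subst sum.swap_restrict) (auto simp: eq_commute)
  also have "\<dots> + (\<Sum>x \<in> A. tensor (?L x) (lx ^ (n - \<rho> x))) = (\<Sum>x \<in> A. tensor (?L x) (?U A n x))"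
    by (simp add: U tensor_sum_right linear_map_add[OF linear_tensor_right[OF linear_ident]]
        sum.distrib add.commute)
  finally show ?case .
qed

section \<open>Existence of the cd-index\<close>

text \<open>The condition that \<open>A\<close>, with a minimum of rank \<open>0\<close> and a maximum of rank \<open>n + 1\<close> added,
  has vanishing alternating sums on all intervals that end at the maximum.\<close>

definition eulerian_set :: "'a rel \<Rightarrow> ('a \<Rightarrow> nat) \<Rightarrow> 'a set \<Rightarrow> nat \<Rightarrow> bool" where
  "eulerian_set r \<rho> A n \<longleftrightarrow> 1 + (\<Sum>x \<in> A. (- 1) ^ \<rho> x) = ((- 1) ^ n :: int) \<and>
     (\<forall>y \<in> A. (\<Sum>x | x \<in> A \<and> (y, x) \<in> r. (- 1) ^ \<rho> x) = ((- 1) ^ n :: int))"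

text \<open>The recursion for the ab-index stays valid for Eulerian posets when \<open>a\<close> and \<open>b\<close> are
  exchanged. Twice the ab-index is the sum of both recursions, and
  \<open>b X\<^sup>m + a (-X)\<^sup>m\<close> is \<open>c X\<^sup>m\<close> for even \<open>m\<close> and \<open>-X\<^sup>m\<^sup>+\<^sup>1\<close> for odd \<open>m\<close>, where
  \<open>X\<^sup>2 = c\<^sup>2 - 2 d\<close>.\<close>

lemma Psi_alt:
  assumes g: "graded_set r \<rho> A n" and e: "eulerian_set r \<rho> A n"
  shows "(Psi r \<rho> A n :: 'k::comm_ring_1 R_Psi) = (- lx) ^ n + (\<Sum>x \<in> A. Psi_below r \<rho> A x * la * (-
      lx) ^ (n - \<rho> x))"
proof -
  have fA: "finite A" and AF: "A \<subseteq> Field r"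
    and rk: "\<And>x. x \<in> A \<Longrightarrow> 1 \<le> \<rho> x \<and> \<rho> x \<le> n"
    and lt: "\<And>x y. x \<in> A \<Longrightarrow> y \<in> A \<Longrightarrow> (x, y) \<in> r \<Longrightarrow> x \<noteq> y \<Longrightarrow> \<rho> x < \<rho> y"
    and partial_order: "Partial_order r"
    using g unfolding graded_set_def by blast+
  have rel_refl: "(x, x) \<in> r" if "x \<in> A" for x
    using partial_order AF that by (auto simp: partial_order_on_def preorder_on_def refl_on_def)
  let ?L = "\<lambda>x. Psi_below r \<rho> A x :: 'k R_Psi"
  let ?s = "\<lambda>k. of_int ((- 1) ^ k) :: 'k R_Psi"
  have pw: "(- lx) ^ k = ?s k * lx ^ k" for k
    by (simp add: power_minus[of lx])
  have sgn: "(- 1 :: int) ^ (n - \<rho> x) = (- 1) ^ n * (- 1) ^ \<rho> x" if "x \<in> A" for x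
    using rk[OF that] by (simp add: power_diff_conv_inverse minus_one_power_iff)
  \<comment> \<open>Inserting the recursion for the set below \<open>x\<close> makes all powers of X
    run up to rank \<open>n\<close>. Then \<open>x\<close> enters only through a sign and the
    condition \<open>y\<close> below \<open>x\<close>, so that sums over \<open>x\<close> can be
    evaluated by the Eulerian condition.\<close>
  have P: "?L x * (- lx) ^ Suc (n - \<rho> x) = - (?s (n - \<rho> x) * lx ^ n)
      - (\<Sum>y \<in> below r A x. ?s (n - \<rho> x) * (?L y * lb * lx ^ (n - \<rho> y)))" if x: "x \<in> A" for x
  proof -
    have Lx: "?L x = lx ^ (\<rho> x - 1) + (\<Sum>y \<in> below r A x. ?L y * lb * lx ^ (\<rho> x - 1 - \<rho> y))"
      unfolding Psi_rec[OF graded_set_below[OF g x]]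
      by (intro arg_cong2[of _ _ _ _ "(+)"] sum.cong refl) (simp add: below_below[OF g x])
    have "?L x * (- lx) ^ Suc (n - \<rho> x) = - (?s (n - \<rho> x) * (?L x * lx ^ Suc (n - \<rho> x)))"
    proof -
      have "?s (Suc (n - \<rho> x)) = - ?s (n - \<rho> x)" by simp
      then have "?L x * (- lx) ^ Suc (n - \<rho> x) = - (?L x * ?s (n - \<rho> x) * lx ^ Suc (n - \<rho> x))"
        unfolding pw by (simp only: mult_minus_left mult_minus_right mult.assoc)
      then show ?thesis
        unfolding mult_of_int_commute[symmetric] by (simp only: mult.assoc)
    qed
    also have "?L x * lx ^ Suc (n - \<rho> x) = lx ^ n + (\<Sum>y \<in> below r A x. ?L y * lb * lx ^ (n - \<rho> y))"
    proof -
      have 1: "\<rho> x - 1 + Suc (n - \<rho> x) = n" using rk[OF x] by simp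
      have 2: "\<rho> x - 1 - \<rho> y + Suc (n - \<rho> x) = n - \<rho> y" if "y \<in> below r A x" for y
        using rk[OF x] that x lt[of y x] by (auto simp: below_def)
      show ?thesis
        unfolding Lx distrib_right sum_distrib_right mult.assoc power_add[symmetric] 1
        by (intro arg_cong2[of _ _ _ _ "(+)"] sum.cong refl) (simp only: 2)
    qed
    finally show ?thesis by (simp add: distrib_left sum_distrib_left)
  qed
  have la: "la = lx + lb" by (simp add: lx_def)
  have comm: "?s k * (y * w) = y * (?s k * w)" for k y w
    by (simp only: mult.assoc[symmetric] mult_of_int_commute[of _ y])
  have summand: "?L x * la * (- lx) ^ (n - \<rho> x) =
      ?s (n - \<rho> x) * (?L x * lb * lx ^ (n - \<rho> x)) - ?L x * (- lx) ^ Suc (n - \<rho> x)" for x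
  proof -
    have "?L x * la * (- lx) ^ (n - \<rho> x) = ?L x * lb * (- lx) ^ (n - \<rho> x) - ?L x * (- lx) ^ Suc (n -
        \<rho> x)"
      unfolding la by (simp add: algebra_simps)
    also have "?L x * lb * (- lx) ^ (n - \<rho> x) = ?s (n - \<rho> x) * (?L x * lb * lx ^ (n - \<rho> x))"
      unfolding pw comm ..
    finally show ?thesis .
  qed
  have sq: "(- 1 :: int) ^ n * (- 1) ^ n = 1"
    by (simp flip: power_mult_distrib)
  \<comment> \<open>\<open>s1\<close> and \<open>s2\<close> are the two parts of
    \<open>eulerian_set\<close>, rewritten for the exponents \<open>n - \<rho> x\<close>; in
    \<open>s2\<close> the element \<open>y\<close> itself is taken out of the sum.\<close>
  have s1: "(\<Sum>x \<in> A. (- 1) ^ (n - \<rho> x)) = (1 - (- 1) ^ n :: int)"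
  proof -
    have "(\<Sum>x \<in> A. (- 1) ^ (n - \<rho> x)) = (- 1) ^ n * (\<Sum>x \<in> A. (- 1 :: int) ^ \<rho> x)"
      unfolding sum_distrib_left by (intro sum.cong refl) (simp only: sgn)
    also have "(\<Sum>x \<in> A. (- 1 :: int) ^ \<rho> x) = (- 1) ^ n - 1"
      using e unfolding eulerian_set_def by linarith
    finally show ?thesis by (simp add: right_diff_distrib sq)
  qed
  have s2: "(\<Sum>x \<in> above r A y. (- 1) ^ (n - \<rho> x)) = (1 - (- 1) ^ (n - \<rho> y) :: int)" if y: "y \<in> A" for y
  proof -
    have "{x. x \<in> A \<and> (y, x) \<in> r} = insert y (above r A y)"
      using rel_refl[OF y] y by (auto simp: above_def)
    moreover have "y \<notin> above r A y" "finite (above r A y)" using fA by (auto simp: above_def)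
    ultimately have s: "(\<Sum>x \<in> above r A y. (- 1 :: int) ^ \<rho> x) = (- 1) ^ n - (- 1) ^ \<rho> y"
      using e y unfolding eulerian_set_def by (metis add_diff_cancel_left' sum.insert)
    have "(\<Sum>x \<in> above r A y. (- 1) ^ (n - \<rho> x)) = (- 1) ^ n * (\<Sum>x \<in> above r A y. (- 1 :: int) ^ \<rho> x)"
      unfolding sum_distrib_left by (intro sum.cong refl sgn) (auto simp: above_def)
    then show ?thesis
      unfolding s sgn[OF y] by (simp add: right_diff_distrib sq)
  qed
  have "(\<Sum>x \<in> A. ?L x * (- lx) ^ Suc (n - \<rho> x)) =
      - ((\<Sum>x \<in> A. ?s (n - \<rho> x)) * lx ^ n)
      - (\<Sum>x \<in> A. \<Sum>y \<in> below r A x. ?s (n - \<rho> x) * (?L y * lb * lx ^ (n - \<rho> y)))"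
    by (simp only: sum.cong[OF refl P] sum_subtractf sum_negf sum_distrib_right)
  also have "(\<Sum>x \<in> A. \<Sum>y \<in> below r A x. ?s (n - \<rho> x) * (?L y * lb * lx ^ (n - \<rho> y))) =
      (\<Sum>y \<in> A. \<Sum>x \<in> above r A y. ?s (n - \<rho> x) * (?L y * lb * lx ^ (n - \<rho> y)))"
    unfolding below_def[of r A] above_def[of r A] using fA
    by (subst sum.swap_restrict) (auto simp: eq_commute)
  also have "\<dots> = (\<Sum>y \<in> A. of_int (\<Sum>x \<in> above r A y. (- 1) ^ (n - \<rho> x)) * (?L y * lb * lx ^ (n - \<rho> y)))"
    by (simp add: sum_distrib_right)
  also have "\<dots> = (\<Sum>y \<in> A. ?L y * lb * lx ^ (n - \<rho> y)) - (\<Sum>y \<in> A. ?s (n - \<rho> y) * (?L y * lb * lx ^ (n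
      - \<rho> y)))"
    by (simp add: s2 left_diff_distrib sum_subtractf)
  also have "(\<Sum>x \<in> A. ?s (n - \<rho> x)) = 1 - ?s n"
    unfolding of_int_sum[symmetric] s1 by simp
  finally have "(\<Sum>x \<in> A. ?L x * la * (- lx) ^ (n - \<rho> x)) =
      (1 - ?s n) * lx ^ n + (\<Sum>y \<in> A. ?L y * lb * lx ^ (n - \<rho> y))"
    unfolding summand sum_subtractf by (simp add: algebra_simps)
  then show ?thesis
    unfolding Psi_rec[OF g] pw[of n] by (simp add: algebra_simps)
qed

section \<open>The image of the cd-polynomials as a subalgebra\<close>

lemma range_cd_one: "1 \<in> range cd_to_ab"
  using cd_to_ab_one by (metis rangeI)

lemma range_cd_mult: "p \<in> range cd_to_ab \<Longrightarrow> q \<in> range cd_to_ab \<Longrightarrow> p * q \<in> range cd_to_ab"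
  using cd_to_ab_mult by (metis (no_types, lifting) imageE rangeI)

lemma range_cd_add: "p \<in> range cd_to_ab \<Longrightarrow> q \<in> range cd_to_ab \<Longrightarrow> p + q \<in> range cd_to_ab"
  using linear_map_add[OF linear_cd_to_ab[OF linear_ident]] by (metis (no_types, lifting) imageE rangeI)

lemma range_cd_minus: "p \<in> range cd_to_ab \<Longrightarrow> q \<in> range cd_to_ab \<Longrightarrow> p - q \<in> range cd_to_ab"
  using linear_map_minus[OF linear_cd_to_ab[OF linear_ident]] by (metis (no_types, lifting) imageE
      rangeI)

lemma range_cd_scale: "p \<in> range cd_to_ab \<Longrightarrow> scale k p \<in> range cd_to_ab"
  using linear_map_scale[OF linear_cd_to_ab[OF linear_ident]] by (metis (no_types, lifting) imageE
      rangeI)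

lemma range_cd_sum: "(\<And>i. i \<in> I \<Longrightarrow> f i \<in> range cd_to_ab) \<Longrightarrow> sum f I \<in> range cd_to_ab"
  by (induction I rule: infinite_finite_induct)
    (auto intro: range_cd_add simp: linear_map_zero[OF linear_cd_to_ab[OF linear_ident], symmetric])

lemma range_cd_power: "p \<in> range cd_to_ab \<Longrightarrow> p ^ n \<in> range cd_to_ab"
  by (induction n) (auto intro: range_cd_mult range_cd_one)

lemma range_cd_letter: "cd_letter x \<in> range cd_to_ab"
  by (metis cd_to_ab_letter rangeI)

lemma range_cd_lx_even: "even n \<Longrightarrow> lx ^ n \<in> range cd_to_ab"
proof -
  assume "even n"
  then obtain k where k: "n = 2 * k" by blast
  have "lx ^ 2 = cd_letter Lc * cd_letter Lc - (cd_letter Ld + cd_letter Ld :: 'a R_Psi)"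
    by (simp add: lx_def power2_eq_square algebra_simps)
  then have "lx ^ 2 \<in> range (cd_to_ab :: 'a R_Phi \<Rightarrow> _)"
    using range_cd_minus[OF range_cd_mult range_cd_add] range_cd_letter by metis
  then show ?thesis unfolding k power_mult by (rule range_cd_power)
qed

text \<open>By induction the indices \<open>Psi_below\<close> are cd-polynomials, and in the sum of
  the two recursions their right factors combine to \<open>lb * lx ^ m + la * (- lx) ^ m\<close>,
  which is one as well.\<close>

lemma Psi_in_range_cd:
  assumes "graded_set r \<rho> A n" "eulerian_set r \<rho> A n"
    and "\<And>x. x \<in> A \<Longrightarrow> eulerian_set r \<rho> (below r A x) (\<rho> x - 1)"
  shows "(Psi r \<rho> A n :: 'k::field_char_0 R_Psi) \<in> range cd_to_ab"
  using assms
proof (induction n arbitrary: A rule: less_induct)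
  case (less n)
  note g = less.prems(1) and e = less.prems(2,3)
  have L: "(Psi_below r \<rho> A x :: 'k R_Psi) \<in> range cd_to_ab" if x: "x \<in> A" for x
  proof (rule less.IH)
    show "\<rho> x - 1 < n" using g x by (auto simp: graded_set_def)
    show "eulerian_set r \<rho> (below r (below r A x) y) (\<rho> y - 1)" if "y \<in> below r A x" for y
      using e(2) that below_below[OF g x that] by (simp add: below_def)
  qed (use graded_set_below[OF g x] e x in auto)
  have 1: "lx ^ m + (- lx) ^ m \<in> range (cd_to_ab :: 'k R_Phi \<Rightarrow> _)" for m
  proof (cases "even m")
    case True
    then show ?thesis
      using range_cd_add[OF range_cd_lx_even[OF True] range_cd_lx_even[OF True]] by simp
  next
    case False
    then have "lx ^ m + (- lx) ^ m = (0 :: 'k R_Psi)" by simp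
    then show ?thesis using linear_map_zero[OF linear_cd_to_ab[OF linear_ident]] by (metis rangeI)
  qed
  have 2: "lb * lx ^ m + la * (- lx) ^ m \<in> range (cd_to_ab :: 'k R_Phi \<Rightarrow> _)" for m
  proof (cases "even m")
    case True
    then have "lb * lx ^ m + la * (- lx) ^ m = cd_letter Lc * (lx ^ m :: 'k R_Psi)"
      by (simp add: algebra_simps)
    then show ?thesis using range_cd_mult[OF range_cd_letter range_cd_lx_even[OF True]] by metis
  next
    case False
    have lb: "lb = (la - lx :: 'k R_Psi)" by (simp add: lx_def)
    \<comment> \<open>Zero is written as \<open>1 - 1\<close> so that closure under differences
      applies.\<close>
    have "lb * lx ^ m + la * (- lx) ^ m = 1 - 1 - (lx ^ Suc m :: 'k R_Psi)"
      unfolding lb using False by (simp add: left_diff_distrib)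
    moreover have "lx ^ Suc m \<in> range (cd_to_ab :: 'k R_Phi \<Rightarrow> _)"
      using False by (intro range_cd_lx_even) simp
    ultimately show ?thesis using range_cd_minus[OF range_cd_minus[OF range_cd_one range_cd_one]] by
        metis
  qed
  have "Psi r \<rho> A n + Psi r \<rho> A n = (lx ^ n + (- lx) ^ n) +
      (\<Sum>x \<in> A. Psi_below r \<rho> A x * (lb * lx ^ (n - \<rho> x) + la * (- lx) ^ (n - \<rho> x)) :: 'k R_Psi)"
    (is "?P + ?P = ?Q")
    using Psi_rec[OF g, where ?'k = 'k] Psi_alt[OF g e(1), where ?'k = 'k]
    by (simp add: distrib_left sum.distrib mult.assoc)
  moreover have "?Q \<in> range cd_to_ab"
    by (intro range_cd_add range_cd_sum range_cd_mult 1 2 L)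
  \<comment> \<open>The recursions give twice the index; 2 is invertible in characteristic
    0.\<close>
  moreover have "?P = scale (1/2) (?P + ?P)"
    by (rule poly_mapping_eqI) (simp add: lookup_add)
  ultimately show ?case using range_cd_scale by metis
qed

section \<open>The ab-index\<close>

definition ab_word :: "nat \<Rightarrow> nat set \<Rightarrow> ab list" where
  "ab_word n S = map (\<lambda>i. if i \<in> S then Lb else La) [1..<Suc n]"

text \<open>The coefficient of \<open>ab_word n S\<close> when X = a - b is expanded in
  \<open>chain_word n T\<close>: a position in \<open>T\<close> must carry b, and a b at any other
  position costs a sign.\<close>

definition flag_sign :: "nat \<Rightarrow> nat set \<Rightarrow> nat set \<Rightarrow> 'k::comm_ring_1" where
  "flag_sign n T S = (\<Prod>i = 1..n. if i \<in> S then (if i \<in> T then 1 else - 1) else (if i \<in> T then 0 else 1))"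

lemma scale_zero_left [simp]: "scale 0 p = 0"
  by (rule poly_mapping_eqI) simp

lemma chain_word_expand:
  "chain_word n T = (\<Sum>S \<in> Pow {1..n}. scale (flag_sign n T S) (mon (ab_word n S)) :: 'k::comm_ring_1
      R_Psi)"
proof (induction n)
  case 0
  show ?case by (simp add: chain_word_def flag_sign_def ab_word_def) (rule one_word[symmetric])
next
  case (Suc n)
  let ?t = "\<lambda>n S. scale (flag_sign n T S) (mon (ab_word n S)) :: 'k R_Psi"
  have a: "?t (Suc n) S = ?t n S * (if Suc n \<in> T then 0 else la)" if "S \<in> Pow {1..n}" for S
  proof -
    have "Suc n \<notin> S" using that by auto
    then have "flag_sign (Suc n) T S = flag_sign n T S * (if Suc n \<in> T then 0 else 1 :: 'k)"
      and "ab_word (Suc n) S = ab_word n S @ [La]"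
      by (auto simp: flag_sign_def ab_word_def)
    then show ?thesis
      by (simp add: mon_append mult_scale_left)
  qed
  have b: "?t (Suc n) (insert (Suc n) S) = ?t n S * (if Suc n \<in> T then lb else - lb)" for S
  proof -
    have "flag_sign (Suc n) T (insert (Suc n) S) = flag_sign n T S * (if Suc n \<in> T then 1 else - 1
        :: 'k)"
      unfolding flag_sign_def by (simp cong: if_cong)
    moreover have "ab_word (Suc n) (insert (Suc n) S) = ab_word n S @ [Lb]"
      by (auto simp: ab_word_def)
    moreover have "scale (- c) p = - scale c p" "scale c (- p) = - scale c p"
      for c :: 'k and p :: "'k R_Psi"
      by (rule poly_mapping_eqI, simp)+
    ultimately show ?thesis
      by (simp add: mon_append mult_scale_left)
  qed
  have P: "Pow {1..Suc n} = Pow {1..n} \<union> insert (Suc n) ` Pow {1..n}"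
    by (simp add: atLeastAtMostSuc_conv Pow_insert)
  have inj: "inj_on (insert (Suc n)) (Pow {1..n})"
    by (intro inj_onI, subst (asm) insert_ident) auto
  have "(\<Sum>S \<in> Pow {1..Suc n}. ?t (Suc n) S) =
      (\<Sum>S \<in> Pow {1..n}. ?t (Suc n) S) + (\<Sum>S \<in> insert (Suc n) ` Pow {1..n}. ?t (Suc n) S)"
    unfolding P by (rule sum.union_disjoint) auto
  also have "\<dots> = (\<Sum>S \<in> Pow {1..n}. ?t n S) * ((if Suc n \<in> T then 0 else la) + (if Suc n \<in> T then lb
      else - lb))"
    by (simp only: sum.reindex[OF inj] o_def sum.cong[OF refl a] b sum_distrib_right distrib_left
        sum.distrib)
  also have "\<dots> = chain_word n T * (if Suc n \<in> T then lb else lx)"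
    by (simp add: Suc.IH lx_def)
  also have "\<dots> = chain_word (Suc n) T"
    by (simp add: chain_word_def)
  finally show ?case by simp
qed

lemma flag_sign_eq:
  assumes "T \<subseteq> {1..n}" "S \<subseteq> {1..n}"
  shows "flag_sign n T S = (if T \<subseteq> S then (- 1) ^ card (S - T) else 0)"
proof (cases "T \<subseteq> S")
  case True
  have "flag_sign n T S = (\<Prod>i = 1..n. if i \<in> S - T then - 1 else 1)"
    unfolding flag_sign_def using True by (intro prod.cong) auto
  also have "\<dots> = (\<Prod>i \<in> {1..n} \<inter> (S - T). - 1)"
    by (rule prod.inter_restrict[symmetric]) simp
  also have "{1..n} \<inter> (S - T) = S - T" using assms by auto
  finally show ?thesis using True by simp
next
  case False
  then obtain i where "i \<in> T" "i \<notin> S" by blast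
  then show ?thesis
    using False assms unfolding flag_sign_def by (auto intro!: prod_zero)
qed

context ranked_poset
begin

lemma graded_set_Field: "graded_set r \<rho> (Field r - {z}) N"
  unfolding graded_set_def
  using partial_order finite_carrier rank_le rank_less rank_eq_bot by (auto simp: Suc_le_eq)

text \<open>Grouping chains by their rank set \<open>T\<close> gives \<open>flag_alpha r T\<close>
  copies of \<open>chain_word N T\<close>. Expanding X = a - b in these words produces exactly the
  inclusion-exclusion signs of \<open>flag_beta\<close>.\<close>

lemma ab_index_eq: "ab_index r = (Psi r \<rho> (Field r - {z}) N :: 'k::comm_ring_1 R_Psi)"
proof -
  let ?Ch = "{C. C \<in> Chains r \<and> C \<subseteq> Field r - {z}}"
  have Ch: "{C \<in> Chains r. zero_hat r \<notin> C \<and> rho r ` C = T} = {C \<in> ?Ch. \<rho> ` C = T}" for T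
  proof -
    have "rho r ` C = \<rho> ` C" if "C \<in> Chains r" for C
      using Chains_subset_Field[OF that] rho_eq by (intro image_cong) auto
    then show ?thesis
      unfolding zero_hat_eq using Chains_subset_Field by blast
  qed
  have fCh: "finite ?Ch"
    by (rule finite_subset[OF _ finite_Chains[OF finite_carrier]]) auto
  have img: "(\<lambda>C. \<rho> ` C) ` ?Ch \<subseteq> Pow {1..N}"
    using rank_le rank_eq_bot by (fastforce simp: Suc_le_eq)
  have "Psi r \<rho> (Field r - {z}) N = (\<Sum>T \<in> Pow {1..N}. \<Sum>C | C \<in> ?Ch \<and> \<rho> ` C = T. chain_word N (\<rho> ` C)
      :: 'k R_Psi)"
    unfolding Psi_def by (rule sum.group[OF fCh _ img, symmetric]) simp
  also have "\<dots> = (\<Sum>T \<in> Pow {1..N}. scale (of_nat (flag_alpha r T)) (chain_word N T))"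
  proof (rule sum.cong[OF refl])
    fix T
    have "(\<Sum>C | C \<in> ?Ch \<and> \<rho> ` C = T. chain_word N (\<rho> ` C) :: 'k R_Psi) =
        of_nat (flag_alpha r T) * chain_word N T"
      unfolding flag_alpha_def Ch by simp
    also have "\<dots> = scale (of_nat (flag_alpha r T)) (chain_word N T)"
      by (simp add: scale_eq_mult)
    finally show "(\<Sum>C | C \<in> ?Ch \<and> \<rho> ` C = T. chain_word N (\<rho> ` C) :: 'k R_Psi) =
      scale (of_nat (flag_alpha r T)) (chain_word N T)" .
  qed
  also have "\<dots> = (\<Sum>T \<in> Pow {1..N}. \<Sum>S \<in> Pow {1..N}.
      scale (of_nat (flag_alpha r T) * flag_sign N T S) (mon (ab_word N S)))"
    by (simp add: chain_word_expand scale_sum scale_scale)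
  also have "\<dots> = (\<Sum>S \<in> Pow {1..N}. \<Sum>T \<in> Pow {1..N}.
      scale (of_nat (flag_alpha r T) * flag_sign N T S) (mon (ab_word N S)))"
    by (rule sum.swap)
  also have "\<dots> = (\<Sum>S \<in> Pow {1..N}. Poly_Mapping.single (ab_word N S) (of_int (flag_beta r S)))"
  proof (rule sum.cong[OF refl])
    fix S assume S: "S \<in> Pow {1..N}"
    have "(\<Sum>T \<in> Pow {1..N}. of_nat (flag_alpha r T) * flag_sign N T S) =
        (\<Sum>T \<in> Pow S. of_nat (flag_alpha r T) * flag_sign N T S :: 'k)"
      using S by (intro sum.mono_neutral_right) (auto simp: flag_sign_eq)
    also have "\<dots> = of_int (flag_beta r S)"
      unfolding flag_beta_def of_int_sum using S
      by (intro sum.cong refl) (auto simp: flag_sign_eq subset_trans)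
    finally have 1: "(\<Sum>T \<in> Pow {1..N}. of_nat (flag_alpha r T) * flag_sign N T S) = (of_int
        (flag_beta r S) :: 'k)" .
    have "(\<Sum>T \<in> Pow {1..N}. scale (c T) (mon w)) = Poly_Mapping.single w (\<Sum>T \<in> Pow {1..N}. c T)" for
        c :: "_ \<Rightarrow> 'k" and w :: "ab list"
      by (rule poly_mapping_eqI) (simp add: lookup_sum lookup_single when_def)
    then show "(\<Sum>T \<in> Pow {1..N}. scale (of_nat (flag_alpha r T) * flag_sign N T S) (mon (ab_word N S))) =
        Poly_Mapping.single (ab_word N S) (of_int (flag_beta r S) :: 'k)"
      using 1 by simp
  qed
  finally show ?thesis
    by (simp add: ab_index_def poset_rank_eq ab_word_def)
qed

end

section \<open>Symmetry of F and G on the boundaries of Eulerian posets\<close>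

definition tu_deg :: "nat \<times> nat \<Rightarrow> int" where "tu_deg m = int (fst m + snd m)"

lemma homogeneous_iff: "homogeneous n p \<longleftrightarrow> homog tu_deg (int n) p"
  by (auto simp: homogeneous_def homog_def tu_deg_def split_beta)

lemma tu_deg_add: "tu_deg (m + m') = tu_deg m + tu_deg m'"
  by (simp add: tu_deg_def)

lemma homog_tu_mult: "homog tu_deg i p \<Longrightarrow> homog tu_deg j q \<Longrightarrow> n = i + j \<Longrightarrow> homog tu_deg n (p * q)"
  by (rule homog_mult[OF tu_deg_add])

lemma homog_tu_one: "homog tu_deg 0 1"
  using homog_mon[of tu_deg 0 0] by (simp add: tu_deg_def)

lemma homog_tu_power: "homog tu_deg i p \<Longrightarrow> homog tu_deg (int n * i) (p ^ n)"
proof (induction n)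
  case (Suc n)
  then show ?case by (auto intro!: homog_tu_mult[of i _ "int n * i"] simp: algebra_simps)
qed (simp add: homog_tu_one)

lemma homog_var: "homog tu_deg 1 var_t" "homog tu_deg 1 var_u"
  by (auto simp: var_t_def var_u_def tu_deg_def intro!: homog_mon)

lemma homog_tmu_power: "homog tu_deg (int n) (tmu ^ n)"
  using homog_tu_power[OF homog_minus[OF homog_var], of n] by simp

lemma homog_bar: "homog tu_deg n p \<Longrightarrow> homog tu_deg n (bar p)"
  unfolding bar_def by (rule homog_lin) (auto simp: tu_deg_def intro!: homog_mon)

lemma homog_t_lower_half: "homog tu_deg n p \<Longrightarrow> homog tu_deg n (t_lower_half k p)"
  unfolding t_lower_half_def by (rule homog_lin) (auto simp: tu_deg_def intro!: homog_mon)

lemma homog_F_word: "homog tu_deg (len w) (F_word w :: 'k::comm_ring_1 poly_tu)"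
  and homog_G_word: "homog tu_deg (len w + 1) (G_word w :: 'k poly_tu)"
proof (induction w and w rule: F_word_G_word.induct)
  case (1 w)
  have k: "homog tu_deg (len v) (kappa_mon (W v) :: 'k poly_tu)" for v
    using homog_tmu_power by auto
  show ?case
    unfolding F_word.simps[of w]
    by (intro homog_bar homog_add homog_sum k homog_tu_mult[OF 1 k]) auto
next
  case (2 w)
  show ?case
    unfolding G_word.simps[of w]
    by (intro homog_t_lower_half homog_tu_mult[OF homog_minus[OF homog_var(2,1)] 2]) simp
qed

lemma homog_ab_F: "homog len n p \<Longrightarrow> homog tu_deg n (ab_F p)"
  unfolding ab_F_def using homog_F_word by (intro homog_lin) auto

lemma lookup_lin_bij:
  assumes "bij f"
  shows "Poly_Mapping.lookup (lin (\<lambda>m. mon (f m)) p) (f n) = Poly_Mapping.lookup p n"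
proof -
  have "Poly_Mapping.lookup (lin (\<lambda>m. mon (f m)) p) (f n) =
      (\<Sum>m \<in> insert n (Poly_Mapping.keys p). Poly_Mapping.lookup p m * (if m = n then 1 else 0))"
    using bij_is_inj[OF assms] by (subst lookup_lin_superset[of "insert n (Poly_Mapping.keys p)"])
      (auto simp: lookup_single when_def inj_eq intro!: sum.cong)
  also have "\<dots> = Poly_Mapping.lookup p n" by (simp add: sum.delta' if_distrib cong: if_cong)
  finally show ?thesis .
qed

lemma lookup_bar: "Poly_Mapping.lookup (bar p) (i, j) = Poly_Mapping.lookup p (j, i)"
proof -
  have "bij (prod.swap :: nat \<times> nat \<Rightarrow> _)" by simp
  from lookup_lin_bij[OF this, of p "(j, i)"] show ?thesis
    unfolding bar_def prod.swap_def split_beta by simp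
qed

lemma lookup_t_lower_half:
  "Poly_Mapping.lookup (t_lower_half n p) (i, j) = (if 2 * i < n then Poly_Mapping.lookup p (i, j)
      else 0)"
proof -
  let ?A = "insert (i, j) (Poly_Mapping.keys p)"
  have "Poly_Mapping.lookup (t_lower_half n p) (i, j) =
      (\<Sum>m \<in> ?A. Poly_Mapping.lookup p m * (if m = (i, j) then (if 2 * i < n then 1 else 0) else 0))"
  proof -
    have "Poly_Mapping.lookup (case m of (i, j) \<Rightarrow> if 2 * i < n then mon (i, j) else 0) (i, j) =
        (if m = (i, j) then (if 2 * i < n then 1 else 0) else 0 :: 'a)" for m
      by (cases m) (auto simp: lookup_single when_def)
    then show ?thesis
      unfolding t_lower_half_def by (subst lookup_lin_superset[of ?A]) auto
  qed
  also have "\<dots> = (if 2 * i < n then Poly_Mapping.lookup p (i, j) else 0)"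
    by (simp add: sum.delta' if_distrib cong: if_cong)
  finally show ?thesis .
qed

text \<open>The coefficients of \<open>p\<close> sit at t-degrees below n/2 and those of
  \<open>bar p\<close> above, so \<open>p\<close> has to cancel the low half of \<open>S\<close>;
  the high half of the equation then holds by antisymmetry. This is the existence and uniqueness on
  which the definition of \<open>g_poly\<close> relies.\<close>

lemma antisym_solve:
  fixes S p :: "'k::{idom,ring_char_0} poly_tu"
  assumes S: "bar S = - S" and hS: "homog tu_deg (int n) S"
  shows "homog tu_deg (int n) p \<and> t_degree_less_half n p \<and> bar p = p + S \<longleftrightarrow> p = - t_lower_half n S"
proof -
  have Sl: "Poly_Mapping.lookup S (j, i) = - Poly_Mapping.lookup S (i, j)" for i j
    using arg_cong[OF S, of "\<lambda>p. Poly_Mapping.lookup p (i, j)"] by (simp add: lookup_bar)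
  \<comment> \<open>The middle coefficient lies in neither half. It equals its own negative and
    vanishes because 2 is not a zero divisor.\<close>
  have Sd: "Poly_Mapping.lookup S (i, i) = 0" for i
    using Sl[of i i] by (simp add: eq_neg_iff_add_eq_0 flip: mult_2)
  have Sn: "Poly_Mapping.lookup S (i, j) = 0" if "i + j \<noteq> n" for i j
    using hS that by (force simp: homog_def tu_deg_def in_keys_iff)
  show ?thesis
  proof
    assume p: "p = - t_lower_half n S"
    have "homog tu_deg (int n) p"
      using homog_minus[OF homog_zero homog_t_lower_half[OF hS, of n]] by (simp add: p)
    moreover have "t_degree_less_half n p"
      by (auto simp: t_degree_less_half_def p in_keys_iff lookup_t_lower_half split: if_splits)
    moreover have "bar p = p + S"
    proof (rule poly_mapping_eqI)
      fix m :: "nat \<times> nat"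
      obtain i j where m: "m = (i, j)" by (cases m)
      show "Poly_Mapping.lookup (bar p) m = Poly_Mapping.lookup (p + S) m"
        using Sl[of i j] Sd[of i] Sn[of i j]
        by (cases "i + j = n"; cases "i = j") (auto simp: m p lookup_bar lookup_t_lower_half
            lookup_add lookup_minus)
    qed
    ultimately show "homog tu_deg (int n) p \<and> t_degree_less_half n p \<and> bar p = p + S" by blast
  next
    assume *: "homog tu_deg (int n) p \<and> t_degree_less_half n p \<and> bar p = p + S"
    have p0: "Poly_Mapping.lookup p (i, j) = 0" if "\<not> (2 * i < n \<and> i + j = n)" for i j
      using * that by (force simp: homog_def tu_deg_def t_degree_less_half_def in_keys_iff)
    show "p = - t_lower_half n S"
    proof (rule poly_mapping_eqI)
      fix m :: "nat \<times> nat"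
      obtain i j where m: "m = (i, j)" by (cases m)
      have e: "Poly_Mapping.lookup p (j, i) = Poly_Mapping.lookup p (i, j) + Poly_Mapping.lookup S
          (i, j)"
        using * lookup_bar[of p i j] by (simp add: lookup_add)
      show "Poly_Mapping.lookup p m = Poly_Mapping.lookup (- t_lower_half n S) m"
        using e p0[of i j] p0[of j i] Sn[of i j]
        by (auto simp: m lookup_t_lower_half eq_neg_iff_add_eq_0)
    qed
  qed
qed

text \<open>The proper part of the boundary of an Eulerian poset of rank \<open>n + 1\<close>.\<close>

definition sphere :: "'a rel \<Rightarrow> ('a \<Rightarrow> nat) \<Rightarrow> 'a set \<Rightarrow> nat \<Rightarrow> bool" where
  "sphere r \<rho> A n \<longleftrightarrow> graded_set r \<rho> A n \<and> eulerian_set r \<rho> A n \<and>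
     (\<forall>x \<in> A. eulerian_set r \<rho> (below r A x) (\<rho> x - 1))"

lemma sphere_below:
  assumes "sphere r \<rho> A n" "x \<in> A"
  shows "sphere r \<rho> (below r A x) (\<rho> x - 1)"
proof -
  have g: "graded_set r \<rho> A n" using assms(1) by (simp add: sphere_def)
  show ?thesis
    using assms graded_set_below[OF g assms(2)] below_below[OF g assms(2)]
    by (auto simp: sphere_def below_def)
qed

text \<open>\<open>S\<close> is the sum in the definition of g without its top summand, and its
  antisymmetry is a form of the Dehn-Sommerville equations. After applying \<open>bar\<close>, the
  induction hypothesis rewrites \<open>bar\<close> of each G and the Eulerian condition evaluates
  the signs. The other conclusions follow by \<open>antisym_solve\<close>; the second one is what
  the induction feeds on.\<close>

lemma bar_F_sphere_antisym:
  fixes r :: "'a rel"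
  defines "S \<equiv> \<lambda>\<rho> A n. tmu * bar (ab_F (Psi r \<rho> A n)) :: 'k::{idom,ring_char_0} poly_tu"
  assumes "sphere r \<rho> A n"
  shows "bar (S \<rho> A n) = - S \<rho> A n \<and> bar (ab_G (Psi r \<rho> A n)) = ab_G (Psi r \<rho> A n) + S \<rho> A n
     \<and> ab_G (Psi r \<rho> A n) = - t_lower_half (n + 1) (S \<rho> A n)"
  using assms(2)
proof (induction n arbitrary: A rule: less_induct)
  case (less n)
  have g: "graded_set r \<rho> A n" and e: "eulerian_set r \<rho> A n"
    using less.prems by (auto simp: sphere_def)
  have fA: "finite A" and AF: "A \<subseteq> Field r"
    and rk: "\<And>x. x \<in> A \<Longrightarrow> 1 \<le> \<rho> x \<and> \<rho> x \<le> n"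
    and lt: "\<And>x y. x \<in> A \<Longrightarrow> y \<in> A \<Longrightarrow> (x, y) \<in> r \<Longrightarrow> x \<noteq> y \<Longrightarrow> \<rho> x < \<rho> y"
    and partial_order: "Partial_order r"
    using g unfolding graded_set_def by blast+
  have rel_refl: "(x, x) \<in> r" if "x \<in> A" for x
    using partial_order AF that by (auto simp: partial_order_on_def preorder_on_def refl_on_def)
  let ?G = "\<lambda>x. ab_G (Psi_below r \<rho> A x) :: 'k poly_tu"
  have Sn: "S \<rho> A n = tmu ^ Suc n + (\<Sum>x \<in> A. ?G x * tmu ^ (Suc n - \<rho> x))"
    unfolding S_def bar_F_Psi[OF g] using rk
    by (simp add: distrib_left sum_distrib_left Suc_diff_le mult.left_commute)
  \<comment> \<open>The induction hypothesis at \<open>x\<close>, with the polynomial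
    \<open>S\<close> of the set below \<open>x\<close> written out.\<close>
  have Gb: "bar (?G x) = ?G x + tmu ^ \<rho> x + (\<Sum>y \<in> below r A x. ?G y * tmu ^ (\<rho> x - \<rho> y))"
    if x: "x \<in> A" for x
  proof -
    have "\<rho> x - 1 < n" using rk[OF x] by linarith
    then have "bar (?G x) = ?G x + S \<rho> (below r A x) (\<rho> x - 1)"
      using less.IH sphere_below[OF less.prems x] by blast
    also have "S \<rho> (below r A x) (\<rho> x - 1) = tmu ^ \<rho> x + (\<Sum>y \<in> below r A x. ?G y * tmu ^ (\<rho> x - \<rho> y))"
    proof -
      have *: "tmu * tmu ^ (\<rho> x - 1) = (tmu ^ \<rho> x :: 'k poly_tu)"
        using rk[OF x] by (simp flip: power_Suc)
      have **: "tmu * (p * tmu ^ (\<rho> x - 1 - \<rho> y)) = (p * tmu ^ (\<rho> x - \<rho> y) :: 'k poly_tu)"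
        if "y \<in> below r A x" for p y
      proof -
        have "\<rho> x - \<rho> y = Suc (\<rho> x - 1 - \<rho> y)" using that lt[of y x] x by (auto simp: below_def)
        then show ?thesis by (simp add: mult.left_commute)
      qed
      show ?thesis
        unfolding S_def bar_F_Psi[OF graded_set_below[OF g x]] distrib_left * sum_distrib_left
        by (intro arg_cong2[of _ _ _ _ "(+)"] sum.cong refl) (simp only: below_below[OF g x] **)
    qed
    finally show ?thesis by (simp add: add.assoc)
  qed
  let ?s = "\<lambda>k. (- 1) ^ k :: 'k poly_tu"
  have bp: "bar (tmu ^ k) = ?s k * tmu ^ k" for k :: nat
    unfolding bar_power bar_tmu by (rule power_minus)
  have sgn: "?s (Suc n - \<rho> x) = - (?s n * ?s (\<rho> x))" if "x \<in> A" for x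
  proof -
    have "?s (Suc n - \<rho> x) * (?s (\<rho> x) * ?s (\<rho> x)) = ?s (Suc n) * ?s (\<rho> x)"
      unfolding mult.assoc[symmetric] power_add[symmetric] using rk[OF that] by simp
    then show ?thesis by (simp flip: power_mult_distrib)
  qed
  have sq: "?s n * ?s n = 1" by (simp flip: power_mult_distrib)
  have e1: "1 + (\<Sum>x \<in> A. ?s (\<rho> x)) = ?s n"
  proof -
    have "of_int (1 + (\<Sum>x \<in> A. (- 1) ^ \<rho> x)) = (of_int ((- 1) ^ n) :: 'k poly_tu)"
      using e unfolding eulerian_set_def by metis
    then show ?thesis by simp
  qed
  have e2: "?s (\<rho> y) + (\<Sum>x \<in> above r A y. ?s (\<rho> x)) = ?s n" if y: "y \<in> A" for y
  proof -
    have "{x. x \<in> A \<and> (y, x) \<in> r} = insert y (above r A y)"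
      using rel_refl[OF y] y by (auto simp: above_def)
    moreover have "y \<notin> above r A y" "finite (above r A y)" using fA by (auto simp: above_def)
    moreover have "of_int (\<Sum>x | x \<in> A \<and> (y, x) \<in> r. (- 1) ^ \<rho> x) = (of_int ((- 1) ^ n) :: 'k poly_tu)"
      using e y unfolding eulerian_set_def by metis
    ultimately show ?thesis by simp
  qed
  have summand: "bar (?G x * tmu ^ (Suc n - \<rho> x)) = - (?s n * (?s (\<rho> x) * (?G x * tmu ^ (Suc n - \<rho> x))))
      - ?s n * (?s (\<rho> x) * tmu ^ Suc n) - (\<Sum>y \<in> below r A x. ?s n * (?s (\<rho> x) * (?G y * tmu ^ (Suc n
          - \<rho> y))))"
    if x: "x \<in> A" for x
  proof -
    have 1: "tmu ^ \<rho> x * tmu ^ (Suc n - \<rho> x) = (tmu ^ Suc n :: 'k poly_tu)"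
      unfolding power_add[symmetric] using rk[OF x] by simp
    have 2: "?G y * tmu ^ (\<rho> x - \<rho> y) * tmu ^ (Suc n - \<rho> x) = ?G y * tmu ^ (Suc n - \<rho> y)"
      if "y \<in> below r A x" for y
    proof -
      have "\<rho> x - \<rho> y + (Suc n - \<rho> x) = Suc n - \<rho> y"
        using that lt[of y x] x rk[OF x] by (auto simp: below_def)
      then show ?thesis unfolding mult.assoc power_add[symmetric] by simp
    qed
    have "bar (?G x * tmu ^ (Suc n - \<rho> x)) = - (?s n * ?s (\<rho> x)) * (bar (?G x) * tmu ^ (Suc n - \<rho> x))"
      unfolding bar_mult bp sgn[OF x] by (simp add: mult.left_commute)
    also have "bar (?G x) * tmu ^ (Suc n - \<rho> x) = ?G x * tmu ^ (Suc n - \<rho> x) + tmu ^ Suc n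
        + (\<Sum>y \<in> below r A x. ?G y * tmu ^ (Suc n - \<rho> y))"
      unfolding Gb[OF x] distrib_right 1 sum_distrib_right
      by (intro arg_cong2[of _ _ _ _ "(+)"] sum.cong refl 2)
    finally show ?thesis
      by (simp add: distrib_left sum_distrib_left mult.assoc sum_negf)
  qed
  \<comment> \<open>After the exchange, the coefficient of each \<open>?G y\<close> is an
    alternating sum over the elements above \<open>y\<close>, which \<open>e2\<close>
    evaluates.\<close>
  have swap: "(\<Sum>x \<in> A. \<Sum>y \<in> below r A x. ?s n * (?s (\<rho> x) * (?G y * tmu ^ (Suc n - \<rho> y))))
      = (\<Sum>y \<in> A. ?s n * ((\<Sum>x \<in> above r A y. ?s (\<rho> x)) * (?G y * tmu ^ (Suc n - \<rho> y))))"
    unfolding sum_distrib_right sum_distrib_left below_def[of r A] above_def[of r A] using fA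
    by (subst sum.swap_restrict) (auto simp: eq_commute)
  have bS: "bar (S \<rho> A n) = - S \<rho> A n"
  proof -
    have "(\<Sum>x \<in> A. bar (?G x * tmu ^ (Suc n - \<rho> x))) =
        (\<Sum>x \<in> A. - (?s n * (?s (\<rho> x) * (?G x * tmu ^ (Suc n - \<rho> x))))
      - ?s n * (?s (\<rho> x) * tmu ^ Suc n) - (\<Sum>y \<in> below r A x. ?s n * (?s (\<rho> x) * (?G y * tmu ^ (Suc n
          - \<rho> y)))))"
      by (intro sum.cong refl summand)
    also have "\<dots> = - (\<Sum>x \<in> A. ?s n * (?s (\<rho> x) * (?G x * tmu ^ (Suc n - \<rho> x))))
        - ?s n * ((\<Sum>x \<in> A. ?s (\<rho> x)) * tmu ^ Suc n)
        - (\<Sum>y \<in> A. ?s n * ((\<Sum>x \<in> above r A y. ?s (\<rho> x)) * (?G y * tmu ^ (Suc n - \<rho> y))))"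
      unfolding sum_subtractf sum_negf swap by (simp only: sum_distrib_left sum_distrib_right)
    finally have "bar (S \<rho> A n) = ?s (Suc n) * tmu ^ Suc n
        - (\<Sum>x \<in> A. ?s n * (?s (\<rho> x) * (?G x * tmu ^ (Suc n - \<rho> x))))
        - ?s n * ((\<Sum>x \<in> A. ?s (\<rho> x)) * tmu ^ Suc n)
        - (\<Sum>y \<in> A. ?s n * ((\<Sum>x \<in> above r A y. ?s (\<rho> x)) * (?G y * tmu ^ (Suc n - \<rho> y))))"
      unfolding Sn bar_add bar_sum bp by simp
    also have "\<dots> = - (?s n * (1 + (\<Sum>x \<in> A. ?s (\<rho> x))) * tmu ^ Suc n)
        - (\<Sum>y \<in> A. ?s n * (?s (\<rho> y) + (\<Sum>x \<in> above r A y. ?s (\<rho> x))) * (?G y * tmu ^ (Suc n - \<rho> y)))"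
      by (simp add: algebra_simps sum.distrib)
    also have "\<dots> = - S \<rho> A n"
      unfolding Sn e1 sq by (simp add: e2 sq)
    finally show ?thesis .
  qed
  have hS: "homog tu_deg (int (n + 1)) (S \<rho> A n)"
    unfolding S_def
    by (intro homog_tu_mult[OF homog_minus[OF homog_var] homog_bar[OF homog_ab_F[OF homog_Psi]]]) simp
  \<comment> \<open>G truncates (u - t) F, which is \<open>bar S\<close> and therefore
    \<open>- S\<close>. This turns the definition of G into the solution given by
    \<open>antisym_solve\<close>.\<close>
  have "ab_G (Psi r \<rho> A n) = t_lower_half (n + 1) (- (tmu * ab_F (Psi r \<rho> A n)))"
    by (simp add: ab_G_homog[OF homog_Psi] algebra_simps)
  also have "- (tmu * ab_F (Psi r \<rho> A n)) = bar (S \<rho> A n)"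
    unfolding S_def by (simp add: bar_mult bar_tmu bar_minus algebra_simps)
  also have "t_lower_half (n + 1) (bar (S \<rho> A n)) = - t_lower_half (n + 1) (S \<rho> A n)"
    unfolding bS using linear_map_minus[OF linear_t_lower_half[OF linear_ident], of "n + 1" 0 "S \<rho> A n"]
      linear_map_zero[OF linear_t_lower_half[OF linear_ident], of "n + 1"] by simp
  finally show ?case
    using bS antisym_solve[OF bS hS] by blast
qed

text \<open>By \<open>bar_F_a\<close>, the left side becomes (t - u) times \<open>bar\<close> of F,
  plus G, once \<open>bar\<close> is applied; the symmetry just proved says that this is
  \<open>bar\<close> of G.\<close>

lemma F_Psi_a:
  assumes "sphere r \<rho> A n"
  shows "ab_F (Psi r \<rho> A n * la) = (ab_G (Psi r \<rho> A n) :: 'k::{idom,ring_char_0} poly_tu)"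
proof -
  have "bar (ab_F (Psi r \<rho> A n * la)) = bar (ab_G (Psi r \<rho> A n) :: 'k poly_tu)"
    unfolding bar_F_a using bar_F_sphere_antisym[OF assms, where ?'k = 'k] by (metis add.commute)
  then show ?thesis by (metis bar_bar)
qed

section \<open>Eulerian posets\<close>

lemma sum_minus_one_power:
  assumes "finite F"
  shows "(\<Sum>w \<in> F. (- 1) ^ f w) = int (card {w \<in> F. even (f w)}) - int (card {w \<in> F. odd (f w)})"
proof -
  have "(\<Sum>w \<in> F. (- 1) ^ f w) = (\<Sum>w \<in> F. (if even (f w) then 1 else 0) - (if odd (f w) then 1 else 0
      :: int))"
    by (intro sum.cong) auto
  also have "\<dots> = (\<Sum>w \<in> {w \<in> F. even (f w)}. 1) - (\<Sum>w \<in> {w \<in> F. odd (f w)}. 1)"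
    unfolding sum_subtractf using assms by (simp only: sum.inter_filter)
  finally show ?thesis by simp
qed

locale lower_eulerian_poset = ranked_poset +
  assumes alternating: "\<And>x y. (x, y) \<in> r \<Longrightarrow> x \<noteq> y \<Longrightarrow>
    (\<Sum>w | (x, w) \<in> r \<and> (w, y) \<in> r. (- 1) ^ \<rho> w) = (0 :: int)"

locale eulerian_poset = lower_eulerian_poset +
  fixes t
  assumes top_in: "t \<in> Field r" and top_greatest: "\<And>x. x \<in> Field r \<Longrightarrow> (x, t) \<in> r"

context ranked_poset
begin

lemma sum_shift:
  "(\<Sum>w | (x, w) \<in> r \<and> P w. (- 1) ^ (\<rho> w - \<rho> x)) =
   (- 1) ^ \<rho> x * (\<Sum>w | (x, w) \<in> r \<and> P w. (- 1) ^ \<rho> w :: int)"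
proof -
  have "(- 1 :: int) ^ (\<rho> w - \<rho> x) = (- 1) ^ \<rho> x * (- 1) ^ \<rho> w" if "(x, w) \<in> r" for w
  proof -
    have "(- 1 :: int) ^ (\<rho> w - \<rho> x) * ((- 1) ^ \<rho> x * (- 1) ^ \<rho> x) = (- 1) ^ \<rho> w * (- 1) ^ \<rho> x"
      unfolding mult.assoc[symmetric] power_add[symmetric] using rank_mono[OF that] by simp
    then show ?thesis by (simp add: mult.commute flip: power_mult_distrib)
  qed
  then show ?thesis
    unfolding sum_distrib_left by (intro sum.cong) auto
qed

lemma interval_interval:
  assumes "(x, u) \<in> r" "(v, y) \<in> r"
  shows "interval (interval r x y) u v = interval r u v"
proof -
  have "(x, w) \<in> r \<and> (w, y) \<in> r \<and> (u, y) \<in> r \<and> (x, v) \<in> r"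
    if "(u, w) \<in> r" "(w, v) \<in> r" for w
    using rel_trans[OF assms(1) that(1)] rel_trans[OF that(2) assms(2)] rel_trans[OF that(1)]
        rel_trans[OF _ that(2)] by blast
  then show ?thesis using assms unfolding interval_def by auto
qed

lemma eulerian_condition:
  assumes "(x, y) \<in> r"
  shows "(poset_rank (interval r x y) > 0 \<longrightarrow>
        card {w \<in> Field (interval r x y). even (rho r w)} =
        card {w \<in> Field (interval r x y). odd (rho r w)}) \<longleftrightarrow>
     (x \<noteq> y \<longrightarrow> (\<Sum>w | (x, w) \<in> r \<and> (w, y) \<in> r. (- 1) ^ \<rho> w) = (0 :: int))"
proof -
  have "poset_rank (interval r x y) > 0 \<longleftrightarrow> x \<noteq> y"
    using poset_rank_interval[OF assms] rank_less[OF assms] by auto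
  moreover have *: "{w. (x, w) \<in> r \<and> (w, y) \<in> r \<and> P (rho r w)} = {w. (x, w) \<in> r \<and> (w, y) \<in> r \<and> P (\<rho>
      w)}" for P
    using rho_eq in_Field by auto
  ultimately show ?thesis
    using *[of even] *[of "\<lambda>n. odd n"] by (simp add: Field_interval sum_minus_one_power fin_le)
qed

end

context lower_eulerian_poset
begin

lemma interval_eulerian:
  assumes "(x, y) \<in> r"
  shows "eulerian_poset (interval r x y) x (\<lambda>w. \<rho> w - \<rho> x) (\<rho> y - \<rho> x) y"
proof -
  interpret I: ranked_poset "interval r x y" x "\<lambda>w. \<rho> w - \<rho> x" "\<rho> y - \<rho> x"
    by (rule interval_ranked[OF assms])
  show ?thesis
  proof
    show "y \<in> Field (interval r x y)"
      using assms rel_refl in_Field by (auto simp: Field_interval)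
    show "(w, y) \<in> interval r x y" if "w \<in> Field (interval r x y)" for w
      using that assms rel_refl in_Field unfolding Field_interval by (auto simp: interval_def)
    fix u v assume "(u, v) \<in> interval r x y" and uv: "u \<noteq> v"
    then have v: "(u, v) \<in> r" "(x, u) \<in> r" "(v, y) \<in> r" by (auto simp: interval_def)
    have eq: "{w. (u, w) \<in> interval r x y \<and> (w, v) \<in> interval r x y} = {w. (u, w) \<in> r \<and> (w, v) \<in> r}"
    proof -
      have "(x, w) \<in> r \<and> (w, y) \<in> r" if "(u, w) \<in> r" "(w, v) \<in> r" for w
        using rel_trans[OF v(2) that(1)] rel_trans[OF that(2) v(3)] by simp
      moreover have "(u, y) \<in> r" "(x, v) \<in> r" using rel_trans v by blast+
      ultimately show ?thesis using v unfolding interval_def by auto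
    qed
    have "(- 1) ^ (\<rho> w - \<rho> x) = (- 1 :: int) ^ (\<rho> u - \<rho> x) * (- 1) ^ (\<rho> w - \<rho> u)" if "(u, w) \<in> r" for w
      using rank_mono[OF v(2)] rank_mono[OF that] by (simp flip: power_add)
    then have "(\<Sum>w | (u, w) \<in> r \<and> (w, v) \<in> r. (- 1) ^ (\<rho> w - \<rho> x)) =
        (- 1 :: int) ^ (\<rho> u - \<rho> x) * (\<Sum>w | (u, w) \<in> r \<and> (w, v) \<in> r. (- 1) ^ (\<rho> w - \<rho> u))"
      unfolding sum_distrib_left by (intro sum.cong) auto
    also have "\<dots> = 0"
      unfolding sum_shift alternating[OF v(1) uv] by simp
    finally show "(\<Sum>w | (u, w) \<in> interval r x y \<and> (w, v) \<in> interval r x y. (- 1) ^ (\<rho> w - \<rho> x)) = (0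
        :: int)"
      unfolding eq .
  qed
qed

abbreviation "proper \<equiv> Field r - {z}"

lemma below_proper: "x \<in> Field r \<Longrightarrow> below r proper x = {w. (w, x) \<in> r \<and> w \<noteq> x \<and> w \<noteq> z}"
  by (auto simp: below_def Field_def)

text \<open>In the vanishing sum over the interval from \<open>y\<close> to \<open>x\<close>, moving
  the summand of \<open>x\<close> to the other side gives \<open>(- 1) ^ (\<rho> x - 1)\<close>. For
  \<open>y = z\<close> the summand of the bottom is the 1 in \<open>eulerian_set\<close>.\<close>

lemma eulerian_set_below:
  assumes x: "x \<in> Field r" "x \<noteq> z"
  shows "eulerian_set r \<rho> (below r proper x) (\<rho> x - 1)"
proof -
  have rx: "\<rho> x = Suc (\<rho> x - 1)" using rank_eq_bot[OF x(1)] x(2) by simp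
  have *: "(\<Sum>w | (y, w) \<in> r \<and> (w, x) \<in> r \<and> w \<noteq> x. (- 1) ^ \<rho> w) = ((- 1) ^ (\<rho> x - 1) :: int)"
    if y: "(y, x) \<in> r" "y \<noteq> x" for y
  proof -
    have "{w. (y, w) \<in> r \<and> (w, x) \<in> r} = insert x {w. (y, w) \<in> r \<and> (w, x) \<in> r \<and> w \<noteq> x}"
      using y rel_refl x by auto
    moreover have "finite {w. (y, w) \<in> r \<and> (w, x) \<in> r \<and> w \<noteq> x}" by (rule fin_le)
    ultimately have "(- 1) ^ \<rho> x + (\<Sum>w | (y, w) \<in> r \<and> (w, x) \<in> r \<and> w \<noteq> x. (- 1) ^ \<rho> w) = (0 :: int)"
      using alternating[OF y] by simp
    then show ?thesis by (subst (asm) rx) simp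
  qed
  have zx: "(z, x) \<in> r" using bot_least x by blast
  have "{w. (z, w) \<in> r \<and> (w, x) \<in> r \<and> w \<noteq> x} = insert z (below r proper x)"
    unfolding below_proper[OF x(1)] using bot_least bot_in in_Field x zx by auto
  moreover have "finite (below r proper x)" "z \<notin> below r proper x"
    using finite_carrier by (auto simp: below_def)
  ultimately have 1: "1 + (\<Sum>w \<in> below r proper x. (- 1) ^ \<rho> w) = ((- 1) ^ (\<rho> x - 1) :: int)"
    using *[OF zx x(2)[symmetric]] rank_bot by simp
  have 2: "(\<Sum>w | w \<in> below r proper x \<and> (y, w) \<in> r. (- 1) ^ \<rho> w) = ((- 1) ^ (\<rho> x - 1) :: int)"
    if y: "y \<in> below r proper x" for y
  proof -
    have "{w. w \<in> below r proper x \<and> (y, w) \<in> r} = {w. (y, w) \<in> r \<and> (w, x) \<in> r \<and> w \<noteq> x}"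
      using y rel_antisym bot_least unfolding below_def by (auto simp: Field_def)
    then show ?thesis using * y by (auto simp: below_def)
  qed
  show ?thesis unfolding eulerian_set_def using 1 2 by blast
qed

lemma sphere_proper_below:
  assumes x: "x \<in> Field r" "x \<noteq> z"
  shows "sphere r \<rho> (below r proper x) (\<rho> x - 1)"
  unfolding sphere_def
proof (intro conjI ballI)
  show "graded_set r \<rho> (below r proper x) (\<rho> x - 1)"
    using graded_set_below[OF graded_set_Field] x by blast
  show "eulerian_set r \<rho> (below r proper x) (\<rho> x - 1)"
    by (rule eulerian_set_below[OF x])
  fix y assume y: "y \<in> below r proper x"
  then show "eulerian_set r \<rho> (below r (below r proper x) y) (\<rho> y - 1)"
    using below_below[OF graded_set_Field _ y] eulerian_set_below[of y] x by (auto simp: below_def)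
qed

end

lemma (in eulerian_poset) rank_top_eq: "\<rho> t = N"
  using rank_top[OF top_in] top_greatest rel_antisym in_Field by metis

lemma (in eulerian_poset) is_maximal_iff: "is_maximal r x \<longleftrightarrow> x = t"
  unfolding is_maximal_def using top_in top_greatest rel_antisym in_Field by blast

lemma (in eulerian_poset) one_hat_eq: "one_hat r = t"
  by (simp add: one_hat_def is_maximal_iff)

lemma (in eulerian_poset) eulerian: "eulerian r"
  unfolding eulerian_def
  using graded eulerian_condition alternating by (auto simp: is_maximal_iff)

lemma (in eulerian_poset) dual_eulerian:
  "eulerian_poset (r\<inverse>) t (\<lambda>w. N - \<rho> w) N z"
proof -
  interpret I: ranked_poset "r\<inverse>" t "\<lambda>w. N - \<rho> w" N
    by (rule dual_ranked[OF top_in top_greatest])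
  show ?thesis
  proof
    show "z \<in> Field (r\<inverse>)" using bot_in by simp
    show "(x, z) \<in> r\<inverse>" if "x \<in> Field (r\<inverse>)" for x using that bot_least by simp
    fix x y assume xy: "(x, y) \<in> r\<inverse>" "x \<noteq> y"
    have "(- 1) ^ (N - \<rho> w) = (- 1 :: int) ^ N * (- 1) ^ \<rho> w" if "(w, x) \<in> r" for w
    proof -
      have "\<rho> w \<le> N" using rank_le in_Field that by blast
      then have "(- 1 :: int) ^ (N - \<rho> w) * ((- 1) ^ \<rho> w * (- 1) ^ \<rho> w) = (- 1) ^ N * (- 1) ^ \<rho> w"
        unfolding mult.assoc[symmetric] power_add[symmetric] by simp
      then show ?thesis by (simp flip: power_mult_distrib)
    qed
    then have "(\<Sum>w | (x, w) \<in> r\<inverse> \<and> (w, y) \<in> r\<inverse>. (- 1) ^ (N - \<rho> w)) =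
        (- 1 :: int) ^ N * (\<Sum>w | (y, w) \<in> r \<and> (w, x) \<in> r. (- 1) ^ \<rho> w)"
      unfolding sum_distrib_left by (intro sum.cong) auto
    then show "(\<Sum>w | (x, w) \<in> r\<inverse> \<and> (w, y) \<in> r\<inverse>. (- 1) ^ (N - \<rho> w)) = (0 :: int)"
      using alternating[of y x] xy by simp
  qed
qed

lemma eulerian_eulerian_poset:
  assumes "eulerian r"
  shows "eulerian_poset r (zero_hat r) (rho r) (poset_rank r) (one_hat r)"
proof -
  have "graded_poset r" and exm: "\<exists>!x. is_maximal r x" using assms by (auto simp: eulerian_def)
  interpret R: ranked_poset r "zero_hat r" "rho r" "poset_rank r"
    by (rule graded_poset_ranked) fact
  have mx: "is_maximal r (one_hat r)" unfolding one_hat_def using exm by (rule theI')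
  show ?thesis
  proof
    show "one_hat r \<in> Field r" using mx by (simp add: is_maximal_def)
    fix x assume "x \<in> Field r"
    then obtain y where y: "(x, y) \<in> r" "rho r y = poset_rank r" using R.rank_top by blast
    have "is_maximal r y"
      unfolding is_maximal_def using y R.in_Field R.rank_le R.rank_eqD by metis
    then have "y = one_hat r" using mx exm by blast
    then show "(x, one_hat r) \<in> r" using y by simp
  next
    fix x y assume "(x, y) \<in> r" "x \<noteq> y"
    then show "(\<Sum>w | (x, w) \<in> r \<and> (w, y) \<in> r. (- 1) ^ rho r w) = (0 :: int)"
      using assms R.eulerian_condition unfolding eulerian_def by blast
  qed
qed

text \<open>Each interval is used only as an interval of itself. Its own ranks differ from the
  ambient ones by \<open>rho r x\<close>, which changes the alternating sum by a sign at
  most.\<close>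

lemma lower_eulerian_lower_eulerian_poset:
  assumes "lower_eulerian r"
  shows "lower_eulerian_poset r (zero_hat r) (rho r) (poset_rank r)"
proof -
  interpret R: ranked_poset r "zero_hat r" "rho r" "poset_rank r"
    using assms by (intro graded_poset_ranked) (auto simp: lower_eulerian_def)
  show ?thesis
  proof
    fix x y assume xy: "(x, y) \<in> r" "x \<noteq> y"
    let ?I = "interval r x y"
    interpret I: ranked_poset ?I x "\<lambda>w. rho r w - rho r x" "rho r y - rho r x"
      by (rule R.interval_ranked[OF xy(1)])
    have "eulerian ?I" using assms xy by (simp add: lower_eulerian_def)
    moreover have xyI: "(x, y) \<in> ?I" using xy R.rel_refl R.in_Field by (auto simp: interval_def)
    ultimately have "(\<Sum>w | (x, w) \<in> ?I \<and> (w, y) \<in> ?I. (- 1) ^ (rho r w - rho r x)) = (0 :: int)"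
      using I.eulerian_condition[OF xyI] xy(2) unfolding eulerian_def by blast
    moreover have "{w. (x, w) \<in> ?I \<and> (w, y) \<in> ?I} = {w. (x, w) \<in> r \<and> (w, y) \<in> r}"
      using xy R.rel_refl R.in_Field unfolding interval_def by auto
    ultimately show "(\<Sum>w | (x, w) \<in> r \<and> (w, y) \<in> r. (- 1) ^ rho r w) = (0 :: int)"
      by (simp add: R.sum_shift)
  qed
qed

section \<open>The polynomials g and h in terms of F and G\<close>

context lower_eulerian_poset
begin

lemma interval_refl: "x \<in> Field r \<Longrightarrow> interval r x x = {(x, x)}"
  unfolding interval_def using rel_refl rel_antisym by auto

lemma g_poly_singleton: "g_poly {(x, x)} = 1"
proof -
  have "eulerian_poset {(x, x)} x (\<lambda>_. 0) 0 x"
    by unfold_locales (auto simp: partial_order_on_def preorder_on_def refl_on_def trans_def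
        antisym_def Field_def)
  then interpret I: eulerian_poset "{(x, x)}" x "\<lambda>_. 0" 0 x .
  show ?thesis
    by (subst g_poly.simps) (simp add: I.eulerian I.poset_rank_eq)
qed

text \<open>The sum defining g has the unknown as its summand at the maximal element; the other
  summands add up, by induction, to the polynomial \<open>S\<close> of
  \<open>bar_F_sphere_antisym\<close>. Hence g and G are both the unique solution from
  \<open>antisym_solve\<close>.\<close>

lemma g_poly_interval:
  assumes "x \<in> Field r" "x \<noteq> z"
  shows "g_poly (interval r z x) = ab_G (Psi_below r \<rho> proper x)"
  using assms
proof (induction "\<rho> x" arbitrary: x rule: less_induct)
  case less
  let ?I = "interval r z x" and ?A = "below r proper x"
  have zx: "(z, x) \<in> r" using bot_least less.prems by blast
  interpret I: eulerian_poset ?I z "\<lambda>w. \<rho> w - \<rho> z" "\<rho> x - \<rho> z" x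
    by (rule interval_eulerian[OF zx])
  have rx: "\<rho> x = Suc (\<rho> x - 1)" using rank_eq_bot[OF less.prems(1)] less.prems(2) by simp
  have g: "graded_set r \<rho> ?A (\<rho> x - 1)" and sp: "sphere r \<rho> ?A (\<rho> x - 1)"
    using sphere_proper_below[OF less.prems] by (auto simp: sphere_def)
  define S where "S = (tmu * bar (ab_F (Psi r \<rho> ?A (\<rho> x - 1))) :: int poly_tu)"
  have S: "S = tmu ^ \<rho> x + (\<Sum>w \<in> ?A. g_poly (interval r z w) * tmu ^ (\<rho> x - \<rho> w))"
  proof -
    have 1: "tmu * tmu ^ (\<rho> x - 1) = (tmu ^ \<rho> x :: int poly_tu)"
      by (subst (2) rx) simp
    have 2: "tmu * (ab_G (Psi_below r \<rho> ?A w) * tmu ^ (\<rho> x - 1 - \<rho> w)) =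
        g_poly (interval r z w) * tmu ^ (\<rho> x - \<rho> w)" if w: "w \<in> ?A" for w
    proof -
      have wx: "\<rho> w < \<rho> x" "w \<in> Field r" "w \<noteq> z" using w rank_less by (auto simp: below_def)
      then have "\<rho> x - \<rho> w = Suc (\<rho> x - 1 - \<rho> w)" by simp
      moreover have "Psi_below r \<rho> ?A w = (Psi_below r \<rho> proper w :: int R_Psi)"
        using below_below[OF graded_set_Field _ w] less.prems by simp
      ultimately show ?thesis using less.hyps[OF wx] by (simp add: mult.left_commute)
    qed
    show ?thesis
      unfolding S_def bar_F_Psi[OF g] distrib_left 1 sum_distrib_left
      by (intro arg_cong2[of _ _ _ _ "(+)"] sum.cong refl 2)
  qed
  have FI: "Field ?I = insert x (insert z ?A)"
    unfolding Field_interval using rel_refl[OF less.prems(1)] zx bot_in bot_least in_Field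
    by (auto simp: below_def)
  have sum: "(\<Sum>w \<in> Field ?I. (if w = one_hat ?I then p else g_poly (interval ?I (zero_hat ?I) w)) *
      tmu ^ (poset_rank ?I - rho ?I w)) = p + S" for p
  proof -
    have 1: "(if w = one_hat ?I then p else g_poly (interval ?I (zero_hat ?I) w)) * tmu ^
        (poset_rank ?I - rho ?I w)
        = (if w = x then p else g_poly (interval r z w)) * tmu ^ (\<rho> x - \<rho> w)" if w: "w \<in> Field ?I" for w
    proof -
      have "interval ?I z w = interval r z w"
        using w bot_in rel_refl unfolding Field_interval by (intro interval_interval) auto
      then show ?thesis
        by (simp add: I.one_hat_eq I.zero_hat_eq I.poset_rank_eq I.rho_eq[OF w] rank_bot)
    qed
    have fA: "finite ?A" "x \<notin> ?A" "z \<notin> ?A" using finite_carrier by (auto simp: below_def)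
    have "(\<Sum>w \<in> Field ?I. (if w = x then p else g_poly (interval r z w)) * tmu ^ (\<rho> x - \<rho> w)) =
      p + (tmu ^ \<rho> x + (\<Sum>w \<in> ?A. (if w = x then p else g_poly (interval r z w)) * tmu ^ (\<rho> x - \<rho> w)))"
      unfolding FI using fA less.prems by (simp add: interval_refl bot_in g_poly_singleton rank_bot)
    also have "(\<Sum>w \<in> ?A. (if w = x then p else g_poly (interval r z w)) * tmu ^ (\<rho> x - \<rho> w))
        = (\<Sum>w \<in> ?A. g_poly (interval r z w) * tmu ^ (\<rho> x - \<rho> w))"
      using fA by (intro sum.cong) auto
    finally show ?thesis unfolding S using 1 by simp
  qed
  have S_antisym: "bar S = - S" "ab_G (Psi r \<rho> ?A (\<rho> x - 1)) = - t_lower_half (\<rho> x) S"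
    using bar_F_sphere_antisym[OF sp, where ?'k = int] rx unfolding S_def by auto
  have hS: "homog tu_deg (int (\<rho> x)) S"
    unfolding S_def by (rule homog_tu_mult[OF homog_minus[OF homog_var] homog_bar[OF homog_ab_F[OF
        homog_Psi]]])
      (use rx in simp)
  have rI: "poset_rank ?I = \<rho> x" by (simp add: I.poset_rank_eq rank_bot)
  have "g_poly ?I = (THE p. homogeneous (\<rho> x) p \<and> t_degree_less_half (\<rho> x) p \<and> bar p = p + S)"
    using I.eulerian rx by (subst g_poly.simps) (simp add: rI sum[unfolded rI])
  also have "\<dots> = (THE p. p = - t_lower_half (\<rho> x) S)"
    unfolding homogeneous_iff antisym_solve[OF S_antisym(1) hS] ..
  finally show ?case using S_antisym(2) by simp
qed

lemma h_poly_eq: "h_poly r = ab_F (Psi r \<rho> proper N)"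
proof -
  have *: "(\<Sum>x \<in> proper. g_poly (interval r (zero_hat r) x) * tmu ^ (poset_rank r - rho r x)) =
      (\<Sum>x \<in> proper. g_poly (interval r z x) * tmu ^ (N - \<rho> x))"
    by (intro sum.cong refl) (simp add: zero_hat_eq poset_rank_eq rho_eq)
  have "(\<Sum>x \<in> Field r. g_poly (interval r (zero_hat r) x) * tmu ^ (poset_rank r - rho r x)) =
      tmu ^ N + (\<Sum>x \<in> proper. g_poly (interval r z x) * tmu ^ (N - \<rho> x))"
    unfolding sum.remove[OF finite_carrier bot_in] *
    by (simp add: zero_hat_eq poset_rank_eq rho_eq bot_in interval_refl g_poly_singleton rank_bot)
  also have "\<dots> = bar (ab_F (Psi r \<rho> proper N))"
    unfolding bar_F_Psi[OF graded_set_Field] by (simp add: g_poly_interval)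
  finally show ?thesis by (simp add: h_poly_def)
qed

end

context eulerian_poset
begin

lemma interval_whole: "interval r z t = r"
  unfolding interval_def using bot_least top_greatest in_Field by auto

lemma g_poly_eq:
  assumes "z \<noteq> t"
  shows "g_poly r = ab_G (Psi r \<rho> (Field r - {z, t}) (N - 1))"
proof -
  have "below r proper t = Field r - {z, t}"
    using top_greatest by (auto simp: below_def)
  then show ?thesis
    using g_poly_interval[OF top_in] assms by (simp add: interval_whole rank_top_eq)
qed

lemma sphere_proper: "z \<noteq> t \<Longrightarrow> sphere r \<rho> (Field r - {z, t}) (N - 1)"
proof -
  assume "z \<noteq> t"
  moreover have "below r proper t = Field r - {z, t}"
    using top_greatest by (auto simp: below_def)
  ultimately show ?thesis
    using sphere_proper_below[OF top_in] by (simp add: rank_top_eq)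
qed

lemma N_pos: "z \<noteq> t \<Longrightarrow> N > 0"
  using rank_eq_bot[OF top_in] rank_top_eq by auto

text \<open>An element of rank \<open>N - 1\<close> is covered by \<open>t\<close> alone, as
  anything strictly above it has the maximal rank, and every element other than \<open>t\<close>
  lies below such an element.\<close>

lemma boundary_eq:
  assumes zt: "z \<noteq> t"
  shows "boundary r = Restr r (Field r - {t})"
proof -
  have "{x. \<exists>y \<in> Field r. rho r y + 1 = poset_rank r \<and> (\<exists>!w. covers r w y) \<and> (x, y) \<in> r} = Field r - {t}"
  proof (intro equalityI subsetI)
    fix x assume "x \<in> {x. \<exists>y \<in> Field r. rho r y + 1 = poset_rank r \<and> (\<exists>!w. covers r w y) \<and> (x, y) \<in> r}"
    then obtain y where y: "y \<in> Field r" "\<rho> y + 1 = N" "(x, y) \<in> r"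
      by (auto simp: rho_eq poset_rank_eq)
    then have "x \<noteq> t" using rank_mono[OF y(3)] rank_top_eq by auto
    then show "x \<in> Field r - {t}" using y in_Field by blast
  next
    fix x assume x: "x \<in> Field r - {t}"
    then have xt: "(x, t) \<in> r" "x \<noteq> t" using top_greatest by auto
    then obtain y where y: "(x, y) \<in> r" "(y, t) \<in> r" "\<rho> y = N - 1"
      using rank_between[of x t "N - 1"] rank_less[of x t] rank_top_eq by fastforce
    have yt: "y \<noteq> t" using y N_pos[OF zt] rank_top_eq by auto
    have cov: "covers r w y \<longleftrightarrow> w = t" for w
    proof
      assume w: "covers r w y"
      then have "(y, w) \<in> r" "y \<noteq> w" by (auto simp: covers_def)
      then have "\<rho> t \<le> \<rho> w" using rank_less[of y w] y(3) rank_top_eq by simp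
      moreover have "(w, t) \<in> r" using \<open>(y, w) \<in> r\<close> in_Field top_greatest by blast
      ultimately show "w = t" using rank_eqD by blast
    next
      assume w: "w = t"
      have "v = y \<or> v = t" if "(y, v) \<in> r" "(v, t) \<in> r" for v
        using rank_less[OF that(1)] rank_less[OF that(2)] y(3) rank_top_eq by fastforce
      then show "covers r w y" using w y yt by (auto simp: covers_def)
    qed
    have "rho r y + 1 = poset_rank r"
      using y in_Field N_pos[OF zt] by (simp add: rho_eq[OF in_Field(2)[OF y(1)]] poset_rank_eq)
    then show "x \<in> {x. \<exists>y \<in> Field r. rho r y + 1 = poset_rank r \<and> (\<exists>!w. covers r w y) \<and> (x, y) \<in> r}"
      using y in_Field cov by auto
  qed
  then show ?thesis by (simp add: boundary_def)
qed

end

context ranked_poset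
begin

text \<open>A lower ideal contains everything between two of its elements, so saturation is
  inherited. Elements of rank \<open>n\<close> above each element do not come for free and have to
  be supplied.\<close>

lemma lower_ideal_ranked:
  assumes "z \<in> A" "A \<subseteq> Field r" "\<And>x y. y \<in> A \<Longrightarrow> (x, y) \<in> r \<Longrightarrow> x \<in> A"
    and "\<And>x. x \<in> A \<Longrightarrow> \<exists>y \<in> A. (x, y) \<in> r \<and> \<rho> y = n" "\<And>x. x \<in> A \<Longrightarrow> \<rho> x \<le> n"
  shows "ranked_poset (Restr r A) z \<rho> n"
proof
  have F: "Field (Restr r A) = A"
    using Field_Restr[OF rel_Refl] assms(2) by auto
  show "Partial_order (Restr r A)" using partial_order by (rule Partial_order_Restr)
  show "finite (Field (Restr r A))" unfolding F using assms(2) finite_carrier finite_subset by blast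
  show "z \<in> Field (Restr r A)" using F assms(1) by simp
  show "\<rho> z = 0" by (rule rank_bot)
  fix x assume "x \<in> Field (Restr r A)"
  then have x: "x \<in> A" using F by simp
  show "(z, x) \<in> Restr r A" using x assms(1,2) bot_least by auto
  show "\<exists>y. (x, y) \<in> Restr r A \<and> \<rho> y = n" using assms(4)[OF x] x by auto
  show "\<rho> x \<le> n" by (rule assms(5)[OF x])
next
  fix x y assume "(x, y) \<in> Restr r A"
  then have xy: "(x, y) \<in> r" "x \<in> A" "y \<in> A" by auto
  show "x \<noteq> y \<Longrightarrow> \<rho> x < \<rho> y" using rank_less xy by blast
  fix k assume "\<rho> x \<le> k" "k \<le> \<rho> y"
  then show "\<exists>w. (x, w) \<in> Restr r A \<and> (w, y) \<in> Restr r A \<and> \<rho> w = k"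
    using rank_between[OF xy(1)] xy assms(3) by blast
qed

end

lemma Psi_Restr: "A \<subseteq> A' \<Longrightarrow> Psi (Restr r A') \<rho> A n = Psi r \<rho> A n"
  by (rule Psi_cong) auto

text \<open>Membership in the range gives existence and \<open>ab_to_cd\<close> gives uniqueness, so
  the description denotes the intended polynomial.\<close>

lemma cd_to_ab_cd_index_boundary:
  assumes "ab_index r \<in> range (cd_to_ab :: 'k::comm_ring_1 R_Phi \<Rightarrow> _)"
  shows "cd_to_ab (cd_index_boundary r :: 'k R_Phi) = ab_index r"
proof -
  obtain p :: "'k R_Phi" where p: "cd_to_ab p = ab_index r" using assms by (metis imageE)
  have "cd_index_boundary r = p"
    unfolding cd_index_boundary_def
    by (rule the_equality[where P = "\<lambda>p. cd_to_ab p = ab_index r", OF p])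
      (metis p ab_to_cd_cd_to_ab)
  then show ?thesis using p by simp
qed

lemma sphere_in_range_cd:
  "sphere r \<rho> A n \<Longrightarrow> (Psi r \<rho> A n :: 'k::field_char_0 R_Psi) \<in> range cd_to_ab"
  unfolding sphere_def by (intro Psi_in_range_cd) auto

context eulerian_poset
begin

lemma cd_index_pos:
  assumes zt: "z \<noteq> t"
  shows "\<exists>p. cd_index r = (words_to_e p :: 'k::field_char_0 Re_Phi) \<and>
    cd_to_ab p = Psi r \<rho> (Field r - {z, t}) (N - 1) \<and> homog cd_deg (int (N - 1)) p"
proof -
  have rb: "ranked_poset (Restr r (Field r - {t})) z \<rho> (N - 1)"
  proof (rule lower_ideal_ranked)
    fix x assume x: "x \<in> Field r - {t}"
    then have xt: "(x, t) \<in> r" "x \<noteq> t" using top_greatest by auto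
    then have xN: "\<rho> x < N" using rank_less[of x t] rank_top_eq by simp
    then show "\<rho> x \<le> N - 1" by simp
    then obtain y where "(x, y) \<in> r" "\<rho> y = N - 1"
      using rank_between[OF xt(1), of "N - 1"] rank_top_eq by auto
    then show "\<exists>y \<in> Field r - {t}. (x, y) \<in> r \<and> \<rho> y = N - 1"
      using N_pos[OF zt] rank_top_eq in_Field by (intro bexI[of _ y]) auto
  qed (use bot_in zt top_greatest rel_antisym in_Field in \<open>auto\<close>)
  have Fb: "Field (Restr r (Field r - {t})) - {z} = Field r - {z, t}"
    unfolding Field_Restr[OF rel_Refl] by auto
  have ab: "ab_index (boundary r) = (Psi r \<rho> (Field r - {z, t}) (N - 1) :: 'k R_Psi)"
    unfolding boundary_eq[OF zt] ranked_poset.ab_index_eq[OF rb] Fb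
    by (rule Psi_Restr) auto
  have 1: "cd_to_ab (cd_index_boundary (boundary r) :: 'k R_Phi) = Psi r \<rho> (Field r - {z, t}) (N - 1)"
    using cd_to_ab_cd_index_boundary[of "boundary r", where ?'k = 'k]
      sphere_in_range_cd[OF sphere_proper[OF zt], where ?'k = 'k] by (simp add: ab)
  have 2: "cd_index r = (words_to_e (cd_index_boundary (boundary r)) :: 'k Re_Phi)"
    using N_pos[OF zt] by (simp add: cd_index_def poset_rank_eq)
  have "homog len (int (N - 1)) (Psi r \<rho> (Field r - {z, t}) (N - 1) :: 'k R_Psi)"
    by (rule homog_Psi)
  from homog_ab_to_cd[OF this] have "homog cd_deg (int (N - 1)) (cd_index_boundary (boundary r) ::
      'k R_Phi)"
    unfolding 1[symmetric] ab_to_cd_cd_to_ab .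
  then show ?thesis using 1 2 by blast
qed

end

section \<open>Dual posets\<close>

definition rev_words :: "('x list \<Rightarrow>\<^sub>0 'k) \<Rightarrow> 'x list \<Rightarrow>\<^sub>0 'k::comm_ring_1" where
  "rev_words = lin (\<lambda>w. mon (rev w))"

lemma linear_rev_words [linear_intros]: "linear_map F \<Longrightarrow> linear_map (\<lambda>p. rev_words (F p))"
  unfolding rev_words_def by (intro linear_intros)

lemma rev_words_mult: "rev_words (p * q) = rev_words q * rev_words p"
  by (rule linear_map_ext2[where F = "\<lambda>p q. rev_words (p * q)" and G = "\<lambda>p q. rev_words q *
      rev_words p"])
    (intro linear_intros | simp add: rev_words_def mult_single plus_list_def)+

lemma rev_words_prod_list: "rev_words (prod_list ps) = prod_list (rev (map rev_words ps))"
  by (induction ps) (simp_all add: rev_words_mult, simp add: rev_words_def one_word)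

lemma rev_words_letter [simp]: "rev_words (mon [x]) = mon [x]"
  by (simp add: rev_words_def)

lemma rev_words_lx [simp]: "rev_words lx = lx"
  by (simp add: lx_def linear_map_minus[OF linear_rev_words[OF linear_ident]])

lemma rev_chain_word:
  assumes "T \<subseteq> {1..n}"
  shows "rev_words (chain_word n T) = chain_word n ((\<lambda>i. Suc n - i) ` T)"
proof -
  have mem: "i \<in> (\<lambda>i. Suc n - i) ` T \<longleftrightarrow> Suc n - i \<in> T" if "1 \<le> i" "i \<le> n" for i
  proof
    assume "i \<in> (\<lambda>i. Suc n - i) ` T"
    then obtain j where "j \<in> T" "i = Suc n - j" by blast
    then show "Suc n - i \<in> T" using assms by auto
  next
    assume "Suc n - i \<in> T"
    moreover have "i = Suc n - (Suc n - i)" using that by simp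
    ultimately show "i \<in> (\<lambda>i. Suc n - i) ` T" by blast
  qed
  have "rev (map rev_words (map (\<lambda>i. if i \<in> T then lb else lx) [1..<Suc n])) =
      (map (\<lambda>i. if i \<in> (\<lambda>i. Suc n - i) ` T then lb else lx) [1..<Suc n] :: 'a R_Psi list)"
  proof (rule nth_equalityI)
    fix i assume "i < length (rev (map rev_words (map (\<lambda>i. if i \<in> T then lb else lx :: 'a R_Psi)
        [1..<Suc n])))"
    then have i: "i < n" by (simp del: upt_Suc)
    then show "rev (map rev_words (map (\<lambda>i. if i \<in> T then lb else lx :: 'a R_Psi) [1..<Suc n])) ! i =
      map (\<lambda>i. if i \<in> (\<lambda>i. Suc n - i) ` T then lb else lx) [1..<Suc n] ! i"
      using mem[of "Suc i"] by (simp add: rev_nth nth_map del: upt_Suc) (simp add: Suc_diff_Suc)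
  qed simp
  then show ?thesis
    unfolding chain_word_def rev_words_prod_list by simp
qed

text \<open>A poset and its dual have the same chains; rank \<open>i\<close> becomes
  \<open>Suc n - i\<close>, which reads every chain word backwards.\<close>

lemma Psi_dual:
  assumes "\<And>x. x \<in> A \<Longrightarrow> 1 \<le> \<rho> x \<and> \<rho> x \<le> n"
  shows "Psi (r\<inverse>) (\<lambda>x. Suc n - \<rho> x) A n = rev_words (Psi r \<rho> A n :: 'k::comm_ring_1 R_Psi)"
proof -
  have Ch: "Chains (r\<inverse>) = Chains r" by (auto simp: Chains_def)
  have "rev_words (chain_word n (\<rho> ` C)) = (chain_word n ((\<lambda>x. Suc n - \<rho> x) ` C) :: 'k R_Psi)" if "C
      \<subseteq> A" for C
  proof -
    have "\<rho> ` C \<subseteq> {1..n}" using assms that by auto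
    from rev_chain_word[OF this] show ?thesis by (simp add: image_image)
  qed
  then show ?thesis
    unfolding Psi_def Ch linear_map_sum[OF linear_rev_words[OF linear_ident]]
    by (intro sum.cong) auto
qed

text \<open>On an element of pure degree the sign in \<open>Gstar_mon\<close> is the same for all
  words and can be taken out.\<close>

lemma map_Gstar_words:
  assumes "homog len (int n) p"
  shows "map_Gstar (words_to_e p) = (- 1) ^ (n + 1) * ab_G (rev_words p)"
proof -
  have 1: "map_Gstar (words_to_e p) = lin (\<lambda>w. Gstar_mon (W w)) p"
    by (simp add: map_Gstar_def words_to_e_def lin_lin)
  have 2: "(- 1) ^ (n + 1) * ab_G (rev_words p) = lin (\<lambda>w. (- 1) ^ (n + 1) * G_word (rev w)) p"
    by (rule linear_map_ext[where F = "\<lambda>p. (- 1) ^ (n + 1) * ab_G (rev_words p)"])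
      (intro linear_intros linear_lin[OF linear_ident] | simp add: ab_G_def rev_words_def)+
  show ?thesis
    unfolding 1 2 lin_eq_sum_scale using assms by (intro sum.cong) (auto simp: homog_def)
qed

lemma (in eulerian_poset) g_poly_dual:
  assumes "z \<noteq> t"
  shows "g_poly (r\<inverse>) = ab_G (rev_words (Psi r \<rho> (Field r - {z, t}) (N - 1)))"
proof -
  interpret D: eulerian_poset "r\<inverse>" t "\<lambda>w. N - \<rho> w" N z by (rule dual_eulerian)
  have "1 \<le> \<rho> x \<and> \<rho> x \<le> N - 1" if "x \<in> Field r - {z, t}" for x
    using that rank_eq_bot[of x] rank_less[of x t] top_greatest rank_top_eq
    by (auto simp: Suc_le_eq)
  from Psi_dual[where A = "Field r - {z, t}" and r = r and ?'k = int, OF this] show ?thesis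
    using D.g_poly_eq assms N_pos[OF assms] by (simp add: insert_commute)
qed

section \<open>Change of coefficients\<close>

lemma lookup_of_int_coeffs [simp]: "Poly_Mapping.lookup (of_int_coeffs p) m = of_int
    (Poly_Mapping.lookup p m)"
  by (simp add: of_int_coeffs_def Poly_Mapping.map.rep_eq when_def)

lemma of_int_coeffs_add: "of_int_coeffs (p + q) = of_int_coeffs p + of_int_coeffs q"
  by (rule poly_mapping_eqI) (simp add: lookup_add)

lemma of_int_coeffs_minus: "of_int_coeffs (p - q) = of_int_coeffs p - of_int_coeffs q"
  by (rule poly_mapping_eqI) (simp add: lookup_minus)

lemma of_int_coeffs_zero [simp]: "of_int_coeffs 0 = 0"
  by (rule poly_mapping_eqI) simp

lemma of_int_coeffs_sum: "of_int_coeffs (sum f I) = (\<Sum>i \<in> I. of_int_coeffs (f i))"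
  by (induction I rule: infinite_finite_induct) (simp_all add: of_int_coeffs_add)

lemma of_int_coeffs_mon [simp]: "of_int_coeffs (mon m) = mon m"
  by (rule poly_mapping_eqI) (simp add: lookup_single when_def)

lemma of_int_coeffs_lin:
  "of_int_coeffs (lin f p) = lin (\<lambda>m. of_int_coeffs (f m)) (of_int_coeffs p :: _ \<Rightarrow>\<^sub>0 'k::comm_ring_1)"
proof (rule poly_mapping_eqI)
  fix n
  \<comment> \<open>A nonzero integer may become 0 in \<open>'k\<close>, so the support can shrink;
    both sums are taken over the keys of \<open>p\<close>.\<close>
  have "Poly_Mapping.keys (of_int_coeffs p :: _ \<Rightarrow>\<^sub>0 'k) \<subseteq> Poly_Mapping.keys p"
    by (auto simp: in_keys_iff)
  then show "Poly_Mapping.lookup (of_int_coeffs (lin f p)) n =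
      Poly_Mapping.lookup (lin (\<lambda>m. of_int_coeffs (f m)) (of_int_coeffs p :: _ \<Rightarrow>\<^sub>0 'k)) n"
    by (subst lookup_lin_superset[of "Poly_Mapping.keys p"]) (simp_all add: lookup_lin)
qed

lemma mult_eq_lin:
  fixes p q :: "'m::monoid_add \<Rightarrow>\<^sub>0 'k::comm_ring_1"
  shows "p * q = lin (\<lambda>m. lin (\<lambda>n. mon (m + n)) q) p"
  by (rule linear_map_ext2[where F = "\<lambda>p q. p * q" and G = "\<lambda>p q. lin (\<lambda>m. lin (\<lambda>n. mon (m + n)) q) p"])
    (intro linear_intros | simp add: mult_single)+

lemma of_int_coeffs_mult:
  fixes p q :: "'m::monoid_add \<Rightarrow>\<^sub>0 int"
  shows "of_int_coeffs (p * q) = (of_int_coeffs p * of_int_coeffs q :: 'm \<Rightarrow>\<^sub>0 'k::comm_ring_1)"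
  unfolding mult_eq_lin of_int_coeffs_lin of_int_coeffs_mon ..

lemma of_int_coeffs_one [simp]:
  "of_int_coeffs (1 :: 'm::monoid_add \<Rightarrow>\<^sub>0 int) = (1 :: 'm \<Rightarrow>\<^sub>0 'k::comm_ring_1)"
  using of_int_coeffs_mon[of "0 :: 'm"] by (simp only: single_one)

lemma of_int_coeffs_power:
  fixes p :: "'m::monoid_add \<Rightarrow>\<^sub>0 int"
  shows "of_int_coeffs (p ^ n) = (of_int_coeffs p ^ n :: 'm \<Rightarrow>\<^sub>0 'k::comm_ring_1)"
  by (induction n) (simp_all add: of_int_coeffs_mult)

lemma of_int_coeffs_sign:
  "of_int_coeffs ((- 1) ^ n :: 'm::monoid_add \<Rightarrow>\<^sub>0 int) = ((- 1) ^ n :: 'm \<Rightarrow>\<^sub>0 'k::comm_ring_1)"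
proof -
  have "of_int_coeffs (- 1 :: 'm \<Rightarrow>\<^sub>0 int) = (- 1 :: 'm \<Rightarrow>\<^sub>0 'k)"
    unfolding diff_0[symmetric] by (simp only: of_int_coeffs_minus of_int_coeffs_zero of_int_coeffs_one)
  then show ?thesis by (simp add: of_int_coeffs_power)
qed

lemma of_int_coeffs_bar: "of_int_coeffs (bar p) = bar (of_int_coeffs p)"
proof -
  have "(\<lambda>m. of_int_coeffs (case m of (i, j) \<Rightarrow> mon (j, i))) = (\<lambda>(i, j). mon (j :: nat, i :: nat) ::
      _ \<Rightarrow>\<^sub>0 'a)"
    by (auto simp: fun_eq_iff)
  then show ?thesis by (simp add: bar_def of_int_coeffs_lin)
qed

lemma of_int_coeffs_t_lower_half: "of_int_coeffs (t_lower_half n p) = t_lower_half n (of_int_coeffs p)"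
proof -
  have "(\<lambda>m. of_int_coeffs (case m of (i, j) \<Rightarrow> if 2 * i < n then mon (i, j) else 0)) =
      (\<lambda>(i, j). if 2 * i < n then mon (i :: nat, j :: nat) else 0 :: _ \<Rightarrow>\<^sub>0 'a)"
    by (auto simp: fun_eq_iff)
  then show ?thesis by (simp add: t_lower_half_def of_int_coeffs_lin)
qed

lemma of_int_coeffs_var [simp]: "of_int_coeffs var_t = var_t" "of_int_coeffs var_u = var_u"
  by (simp_all add: var_t_def var_u_def)

lemma of_int_coeffs_kappa_mon: "of_int_coeffs (kappa_mon m) = kappa_mon m"
  by (cases m) (simp_all add: of_int_coeffs_power of_int_coeffs_minus)

text \<open>The recursion consists of ring operations, the exchange of t and u, and truncation, all
  of which commute with the map from the integers.\<close>

lemma of_int_coeffs_F_word: "of_int_coeffs (F_word w) = (F_word w :: 'k::comm_ring_1 poly_tu)"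
  and of_int_coeffs_G_word: "of_int_coeffs (G_word w) = (G_word w :: 'k poly_tu)"
proof (induction w and w rule: F_word_G_word.induct)
  case (1 w)
  show ?case
    unfolding F_word.simps[of w] of_int_coeffs_bar of_int_coeffs_add of_int_coeffs_sum
      of_int_coeffs_mult of_int_coeffs_kappa_mon
    using 1 by (intro arg_cong[of _ _ bar] arg_cong2[of _ _ _ _ "(+)"] sum.cong) auto
next
  case (2 w)
  show ?case
    unfolding G_word.simps[of w] of_int_coeffs_t_lower_half of_int_coeffs_mult of_int_coeffs_minus
      of_int_coeffs_var 2 ..
qed

lemma of_int_coeffs_ab_F: "of_int_coeffs (ab_F p) = ab_F (of_int_coeffs p)"
  and of_int_coeffs_ab_G: "of_int_coeffs (ab_G p) = ab_G (of_int_coeffs p)"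
  and of_int_coeffs_rev_words: "of_int_coeffs (rev_words p) = rev_words (of_int_coeffs p)"
  by (simp_all add: ab_F_def ab_G_def rev_words_def of_int_coeffs_lin of_int_coeffs_F_word
      of_int_coeffs_G_word)

lemma of_int_coeffs_Psi: "of_int_coeffs (Psi r \<rho> A n) = (Psi r \<rho> A n :: 'k::comm_ring_1 R_Psi)"
proof -
  have lx: "of_int_coeffs lx = (lx :: 'k R_Psi)"
    by (simp add: lx_def of_int_coeffs_minus)
  have "of_int_coeffs (prod_list ps) = prod_list (map of_int_coeffs ps :: 'k R_Psi list)" for ps
    by (induction ps) (simp_all add: of_int_coeffs_mult)
  then have "of_int_coeffs (chain_word n T) = (chain_word n T :: 'k R_Psi)" for T
    unfolding chain_word_def by (simp add: o_def if_distrib lx cong: if_cong del: upt_Suc)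
  then show ?thesis by (simp add: Psi_def of_int_coeffs_sum)
qed

section \<open>Strong formal subdivisions\<close>

context lower_eulerian_poset
begin

lemma lower_ideal_lower_eulerian:
  assumes "ranked_poset (Restr r A) z \<rho> n" "\<And>x y. y \<in> A \<Longrightarrow> (x, y) \<in> r \<Longrightarrow> x \<in> A"
  shows "lower_eulerian_poset (Restr r A) z \<rho> n"
proof -
  interpret I: ranked_poset "Restr r A" z \<rho> n by fact
  show ?thesis
  proof
    fix x y assume xy: "(x, y) \<in> Restr r A" "x \<noteq> y"
    have "{w. (x, w) \<in> Restr r A \<and> (w, y) \<in> Restr r A} = {w. (x, w) \<in> r \<and> (w, y) \<in> r}"
      using xy assms(2) by auto
    then show "(\<Sum>w | (x, w) \<in> Restr r A \<and> (w, y) \<in> Restr r A. (- 1) ^ \<rho> w) = (0 :: int)"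
      using alternating[of x y] xy by simp
  qed
qed

lemma below_subset:
  assumes "A \<subseteq> proper" "\<And>x y. y \<in> A \<Longrightarrow> x \<in> proper \<Longrightarrow> (x, y) \<in> r \<Longrightarrow> x \<in> A" "x \<in> A"
  shows "below r A x = below r proper x"
  using assms unfolding below_def by auto

end

lemma graded_set_subset: "graded_set r \<rho> A n \<Longrightarrow> A' \<subseteq> A \<Longrightarrow> (\<And>x. x \<in> A' \<Longrightarrow> \<rho> x \<le> n') \<Longrightarrow> graded_set r \<rho> A' n'"
  unfolding graded_set_def by (auto intro: finite_subset simp: subset_iff)

lemma ex1_iff_card: "(\<exists>!w. w \<in> C) \<longleftrightarrow> card C = 1"
proof -
  have "(\<exists>!w. w \<in> C) \<longleftrightarrow> (\<exists>w. C = {w})" by blast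
  then show ?thesis by (simp add: card_1_singleton_iff)
qed

lemma Psi_image:
  assumes inj: "inj_on f A" and r: "\<And>x y. x \<in> A \<Longrightarrow> y \<in> A \<Longrightarrow> (f x, f y) \<in> r' \<longleftrightarrow> (x, y) \<in> r"
    and \<rho>: "\<And>x. x \<in> A \<Longrightarrow> \<rho>' (f x) = \<rho> x"
  shows "Psi r' \<rho>' (f ` A) n = (Psi r \<rho> A n :: 'k::comm_ring_1 R_Psi)"
proof -
  have eq: "{C. C \<in> Chains r' \<and> C \<subseteq> f ` A} = (`) f ` {C. C \<in> Chains r \<and> C \<subseteq> A}"
  proof (intro equalityI subsetI)
    fix C assume C: "C \<in> {C. C \<in> Chains r' \<and> C \<subseteq> f ` A}"
    then obtain D where D: "D \<subseteq> A" "C = f ` D" by (auto simp: subset_image_iff)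
    have "D \<in> Chains r"
      unfolding Chains_def
    proof (intro CollectI ballI)
      fix x y assume xy: "x \<in> D" "y \<in> D"
      then have "(f x, f y) \<in> r' \<or> (f y, f x) \<in> r'" using C D(2) by (auto simp: Chains_def)
      then show "(x, y) \<in> r \<or> (y, x) \<in> r" using r xy D(1) by blast
    qed
    then show "C \<in> (`) f ` {C. C \<in> Chains r \<and> C \<subseteq> A}" using D by blast
  next
    fix C assume "C \<in> (`) f ` {C. C \<in> Chains r \<and> C \<subseteq> A}"
    then obtain D where D: "D \<in> Chains r" "D \<subseteq> A" "C = f ` D" by blast
    have "C \<in> Chains r'"
      unfolding Chains_def D(3)
    proof (intro CollectI ballI)
      fix a b assume "a \<in> f ` D" "b \<in> f ` D"
      then obtain x y where xy: "x \<in> D" "y \<in> D" "a = f x" "b = f y" by blast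
      then have "(x, y) \<in> r \<or> (y, x) \<in> r" using D(1) by (auto simp: Chains_def)
      then show "(a, b) \<in> r' \<or> (b, a) \<in> r'" using r xy D(2) by blast
    qed
    then show "C \<in> {C. C \<in> Chains r' \<and> C \<subseteq> f ` A}" using D by blast
  qed
  have inj': "inj_on ((`) f) {C. C \<in> Chains r \<and> C \<subseteq> A}"
    using inj by (intro inj_onI) (auto simp: inj_on_image_eq_iff)
  have "\<rho>' ` f ` C = \<rho> ` C" if "C \<subseteq> A" for C
    using that \<rho> by (auto simp: image_image intro!: image_cong)
  then show ?thesis
    unfolding Psi_def eq sum.reindex[OF inj'] by (intro sum.cong) auto
qed

text \<open>As \<open>m\<close> lies below no element of \<open>A\<close>, the recursions for the
  two sets differ only in the summand of \<open>m\<close>, whose power of X is trivial because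
  \<open>m\<close> has the top rank \<open>n\<close>.\<close>

lemma Psi_insert_top:
  assumes g: "graded_set r \<rho> (insert m A) n" and m: "m \<notin> A" "\<rho> m = n" "\<And>x. x \<in> A \<Longrightarrow> (m, x) \<notin> r"
  shows "(Psi r \<rho> (insert m A) n :: 'k::comm_ring_1 R_Psi) =
    Psi r \<rho> A n + Psi r \<rho> (below r A m) (n - 1) * lb"
proof -
  have g': "graded_set r \<rho> A n"
    using graded_set_subset[OF g, of A n] g by (auto simp: graded_set_def)
  have fA: "finite A" using g' by (simp add: graded_set_def)
  have b: "below r (insert m A) x = below r A x" if "x \<in> A" for x
    using m(3)[OF that] by (auto simp: below_def)
  have bm: "below r (insert m A) m = below r A m"
    by (auto simp: below_def)
  show ?thesis
    unfolding Psi_rec[OF g] Psi_rec[OF g'] using m fA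
    by (simp add: bm b add.commute add.left_commute cong: sum.cong)
qed

section \<open>Preimages of lower intervals and their boundaries\<close>

locale formal_subdivision = G: lower_eulerian_poset \<Gamma> g0 \<rho>G NG + B: eulerian_poset B b0 \<rho>B NB b1
  for \<Gamma> :: "'a rel" and g0 \<rho>G NG and B :: "'b rel" and b0 \<rho>B NB b1 +
  fixes \<phi> :: "'a \<Rightarrow> 'b"
  assumes surj: "\<phi> ` Field \<Gamma> = Field B"
    and mono: "\<And>y y'. (y, y') \<in> \<Gamma> \<Longrightarrow> (\<phi> y, \<phi> y') \<in> B"
    and rank_inc: "\<And>y. y \<in> Field \<Gamma> \<Longrightarrow> \<rho>G y \<le> \<rho>B (\<phi> y)"
    and lift: "\<And>y x. y \<in> Field \<Gamma> \<Longrightarrow> (\<phi> y, x) \<in> B \<Longrightarrow>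
      \<exists>y'. (y, y') \<in> \<Gamma> \<and> \<phi> y' = x \<and> \<rho>G y' = \<rho>B x"
    and fibre: "\<And>y x. y \<in> Field \<Gamma> \<Longrightarrow> (\<phi> y, x) \<in> B \<Longrightarrow>
      (\<Sum>y' | (y, y') \<in> \<Gamma> \<and> \<phi> y' = x. (- 1) ^ \<rho>G y') = ((- 1) ^ \<rho>B x :: int)"
begin

lemma phi_in: "y \<in> Field \<Gamma> \<Longrightarrow> \<phi> y \<in> Field B"
  using surj by blast

lemma phi_bot: "\<phi> g0 = b0"
proof -
  obtain y where y: "y \<in> Field \<Gamma>" "\<phi> y = b0" using surj B.bot_in by (metis imageE)
  have "(\<phi> g0, b0) \<in> B" using mono[OF G.bot_least[OF y(1)]] y(2) by simp
  then show ?thesis using B.bot_least[OF phi_in[OF G.bot_in]] B.rel_antisym by blast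
qed

lemma phi_eq_bot: "y \<in> Field \<Gamma> \<Longrightarrow> \<phi> y = b0 \<longleftrightarrow> y = g0"
  using rank_inc[of y] B.rank_bot G.rank_eq_bot[of y] phi_bot by auto

text \<open>\<open>U x\<close> is the carrier of the subdivision of the interval up to
  \<open>x\<close>. \<open>V x\<close> is a candidate for its boundary in terms of the map alone,
  confirmed in \<open>boundary_sub\<close>.\<close>

definition U :: "'b \<Rightarrow> 'a set" where "U x = {y \<in> Field \<Gamma>. (\<phi> y, x) \<in> B}"
definition V :: "'b \<Rightarrow> 'a set" where "V x = {y \<in> Field \<Gamma>. (\<phi> y, x) \<in> B \<and> \<phi> y \<noteq> x}"

lemma V_subset: "V x \<subseteq> U x" "U x \<subseteq> Field \<Gamma>"
  by (auto simp: U_def V_def)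

lemma finite_U: "finite (U x)"
  by (rule finite_subset[OF V_subset(2) G.finite_carrier])

lemma finite_V: "finite (V x)"
  by (rule finite_subset[OF V_subset(1) finite_U])

lemma U_lower: "y \<in> U x \<Longrightarrow> (w, y) \<in> \<Gamma> \<Longrightarrow> w \<in> U x"
  unfolding U_def using mono B.rel_trans G.in_Field by blast

lemma V_lower: "y \<in> V x \<Longrightarrow> (w, y) \<in> \<Gamma> \<Longrightarrow> w \<in> V x"
  unfolding V_def using mono B.rel_trans B.rel_antisym G.in_Field by blast

lemma subdiv_below_eq: "subdiv_below \<Gamma> B \<phi> x = Restr \<Gamma> (U x)"
  by (simp add: subdiv_below_def U_def)

lemma g0_U: "x \<in> Field B \<Longrightarrow> g0 \<in> U x"
  using G.bot_in phi_bot B.bot_least by (auto simp: U_def)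

lemma g0_V: "x \<in> Field B \<Longrightarrow> x \<noteq> b0 \<Longrightarrow> g0 \<in> V x"
  using G.bot_in phi_bot B.bot_least by (auto simp: V_def)

lemma rank_U: "y \<in> U x \<Longrightarrow> \<rho>G y \<le> \<rho>B x"
  unfolding U_def using rank_inc B.rank_mono le_trans by blast

lemma rank_V: "y \<in> V x \<Longrightarrow> \<rho>G y < \<rho>B x"
  unfolding V_def using rank_inc B.rank_less le_less_trans by blast

lemma U_top: "y \<in> U x \<Longrightarrow> \<exists>y' \<in> U x. (y, y') \<in> \<Gamma> \<and> \<phi> y' = x \<and> \<rho>G y' = \<rho>B x"
  using lift[of y x] B.rel_refl B.in_Field G.in_Field unfolding U_def by blast

text \<open>An element of rank \<open>\<rho>B x - 1\<close> is chosen in \<open>B\<close> between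
  \<open>\<phi> y\<close> and \<open>x\<close> and then lifted; it differs from \<open>x\<close>, so
  its lift stays in \<open>V x\<close>.\<close>

lemma V_top: "y \<in> V x \<Longrightarrow> \<exists>y' \<in> V x. (y, y') \<in> \<Gamma> \<and> \<rho>G y' = \<rho>B x - 1"
proof -
  assume y: "y \<in> V x"
  then have yF: "y \<in> Field \<Gamma>" and yx: "(\<phi> y, x) \<in> B" "\<phi> y \<noteq> x" by (auto simp: V_def)
  have lt: "\<rho>B (\<phi> y) < \<rho>B x" using B.rank_less yx by blast
  then have "\<rho>B (\<phi> y) \<le> \<rho>B x - 1" "\<rho>B x - 1 \<le> \<rho>B x" by auto
  then obtain b where b: "(\<phi> y, b) \<in> B" "(b, x) \<in> B" "\<rho>B b = \<rho>B x - 1"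
    using B.rank_between[OF yx(1)] by blast
  obtain y' where "(y, y') \<in> \<Gamma>" "\<phi> y' = b" "\<rho>G y' = \<rho>B b" using lift[OF yF b(1)] by blast
  then show ?thesis using b lt G.in_Field by (intro bexI[of _ y']) (auto simp: V_def)
qed

lemma bot_U: "y \<in> U x \<Longrightarrow> (g0, y) \<in> \<Gamma>"
  using G.bot_least V_subset by blast

lemma re_U: "y \<in> U x \<Longrightarrow> (y, y) \<in> \<Gamma>"
  using G.rel_refl V_subset by blast

lemma sub_ranked: "x \<in> Field B \<Longrightarrow> ranked_poset (Restr \<Gamma> (U x)) g0 \<rho>G (\<rho>B x)"
  by (rule G.lower_ideal_ranked) (use g0_U V_subset U_lower U_top rank_U in blast)+

lemma sub_lower_eulerian: "x \<in> Field B \<Longrightarrow> lower_eulerian_poset (Restr \<Gamma> (U x)) g0 \<rho>G (\<rho>B x)"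
  by (rule G.lower_ideal_lower_eulerian[OF sub_ranked]) (auto intro: U_lower)

lemma V_ranked: "x \<in> Field B \<Longrightarrow> x \<noteq> b0 \<Longrightarrow> ranked_poset (Restr \<Gamma> (V x)) g0 \<rho>G (\<rho>B x - 1)"
  by (rule G.lower_ideal_ranked) (use g0_V V_subset V_lower V_top rank_V in \<open>fastforce\<close>)+

lemma sum_fibres:
  assumes y: "y \<in> Field \<Gamma>" and X: "X \<subseteq> {x. (\<phi> y, x) \<in> B}"
  shows "(\<Sum>y' | (y, y') \<in> \<Gamma> \<and> \<phi> y' \<in> X. (- 1) ^ \<rho>G y') = (\<Sum>x \<in> X. (- 1) ^ \<rho>B x :: int)"
proof -
  have fX: "finite X" by (rule finite_subset[OF X]) (use B.fin_le[of _ "\<lambda>_. True"] in simp)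
  let ?S = "{y'. (y, y') \<in> \<Gamma> \<and> \<phi> y' \<in> X}"
  have "(\<Sum>y' \<in> ?S. (- 1) ^ \<rho>G y' :: int) = (\<Sum>x \<in> X. \<Sum>y' | y' \<in> ?S \<and> \<phi> y' = x. (- 1) ^ \<rho>G y')"
    by (rule sum.group[symmetric]) (use G.fin_le fX in auto)
  also have "\<dots> = (\<Sum>x \<in> X. (- 1) ^ \<rho>B x)"
  proof (rule sum.cong[OF refl])
    fix x assume x: "x \<in> X"
    then have "{y'. y' \<in> ?S \<and> \<phi> y' = x} = {y'. (y, y') \<in> \<Gamma> \<and> \<phi> y' = x}" by auto
    then show "(\<Sum>y' | y' \<in> ?S \<and> \<phi> y' = x. (- 1) ^ \<rho>G y' :: int) = (- 1) ^ \<rho>B x"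
      using fibre[OF y, of x] x X by auto
  qed
  finally show ?thesis .
qed

text \<open>Adding the fibre identities over all \<open>b\<close> with \<open>\<phi> y\<close> \<le>
  \<open>b\<close> < \<open>x\<close> replaces the sum over \<open>\<Gamma>\<close> by one over
  \<open>B\<close>, where the interval up to \<open>x\<close> is Eulerian.\<close>

lemma sum_V:
  assumes y: "y \<in> V x"
  shows "(\<Sum>y' | (y, y') \<in> \<Gamma> \<and> y' \<in> V x. (- 1) ^ \<rho>G y') = ((- 1) ^ (\<rho>B x - 1) :: int)"
proof -
  have yF: "y \<in> Field \<Gamma>" and yx: "(\<phi> y, x) \<in> B" "\<phi> y \<noteq> x" using y by (auto simp: V_def)
  let ?X = "{b. (\<phi> y, b) \<in> B \<and> (b, x) \<in> B \<and> b \<noteq> x}"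
  have a: "{y'. (y, y') \<in> \<Gamma> \<and> y' \<in> V x} = {y'. (y, y') \<in> \<Gamma> \<and> \<phi> y' \<in> ?X}"
    unfolding V_def using mono G.in_Field by blast
  have b: "(\<Sum>y' | (y, y') \<in> \<Gamma> \<and> \<phi> y' \<in> ?X. (- 1) ^ \<rho>G y') = (\<Sum>b \<in> ?X. (- 1) ^ \<rho>B b :: int)"
    by (rule sum_fibres[OF yF]) auto
  have c: "(- 1) ^ \<rho>B x + (\<Sum>b \<in> ?X. (- 1) ^ \<rho>B b) = (0 :: int)"
  proof -
    have "{b. (\<phi> y, b) \<in> B \<and> (b, x) \<in> B} = insert x ?X"
      using yx B.rel_refl B.in_Field by auto
    moreover have "finite ?X" by (rule B.fin_le)
    ultimately show ?thesis using B.alternating[OF yx] by simp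
  qed
  have "\<rho>B x = Suc (\<rho>B x - 1)" using rank_V[OF y] by simp
  then have d: "(- 1 :: int) ^ \<rho>B x = - ((- 1) ^ (\<rho>B x - 1))"
    by (metis mult_minus1 power_Suc)
  show ?thesis unfolding a b using c d by linarith
qed

text \<open>Here the fibres over the whole interval from \<open>\<phi> y\<close> to \<open>x\<close>
  are added. It has vanishing alternating sum if \<open>\<phi> y \<noteq> x\<close>, and otherwise
  there is a single fibre.\<close>

lemma sum_U:
  assumes y: "y \<in> U x"
  shows "(\<Sum>y' | (y, y') \<in> \<Gamma> \<and> y' \<in> U x. (- 1) ^ \<rho>G y') = (if y \<in> V x then 0 else (- 1) ^ \<rho>B x :: int)"
proof -
  have yF: "y \<in> Field \<Gamma>" and yx: "(\<phi> y, x) \<in> B" using y by (auto simp: U_def)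
  let ?X = "{b. (\<phi> y, b) \<in> B \<and> (b, x) \<in> B}"
  have "{y'. (y, y') \<in> \<Gamma> \<and> y' \<in> U x} = {y'. (y, y') \<in> \<Gamma> \<and> \<phi> y' \<in> ?X}"
    unfolding U_def using mono G.in_Field by blast
  moreover have "(\<Sum>y' | (y, y') \<in> \<Gamma> \<and> \<phi> y' \<in> ?X. (- 1) ^ \<rho>G y') = (\<Sum>b \<in> ?X. (- 1) ^ \<rho>B b :: int)"
    by (rule sum_fibres[OF yF]) auto
  moreover have "y \<in> V x \<longleftrightarrow> \<phi> y \<noteq> x" using y by (auto simp: U_def V_def)
  moreover have "?X = {x}" if "\<phi> y = x" using that yx B.rel_antisym by blast
  ultimately show ?thesis using B.alternating[OF yx] by auto
qed

lemma V_lower_set: "below \<Gamma> (V x - {g0}) y = below \<Gamma> G.proper y" if "y \<in> V x - {g0}"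
  by (rule G.below_subset[OF _ _ that]) (use V_subset V_lower in blast)+

lemma U_lower_set: "below \<Gamma> (U x - {g0}) y = below \<Gamma> G.proper y" if "y \<in> U x - {g0}"
  by (rule G.below_subset[OF _ _ that]) (use V_subset U_lower in blast)+

lemma graded_set_U: "graded_set \<Gamma> \<rho>G (U x - {g0}) (\<rho>B x)"
  by (rule graded_set_subset[OF G.graded_set_Field]) (use V_subset rank_U in auto)

lemma graded_set_V: "graded_set \<Gamma> \<rho>G (V x - {g0}) (\<rho>B x - 1)"
proof (rule graded_set_subset[OF G.graded_set_Field])
  show "V x - {g0} \<subseteq> Field \<Gamma> - {g0}" using V_subset by blast
  show "\<rho>G y \<le> \<rho>B x - 1" if "y \<in> V x - {g0}" for y using rank_V[of y x] that by simp
qed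

lemma sphere_V:
  assumes x: "x \<in> Field B" "x \<noteq> b0"
  shows "sphere \<Gamma> \<rho>G (V x - {g0}) (\<rho>B x - 1)"
  unfolding sphere_def
proof (intro conjI ballI graded_set_V)
  have z: "{y'. (g0, y') \<in> \<Gamma> \<and> y' \<in> V x} = insert g0 (V x - {g0})"
    using g0_V[OF x] G.bot_least V_subset by blast
  have "finite (V x)" by (rule finite_V)
  then have 1: "1 + (\<Sum>y \<in> V x - {g0}. (- 1) ^ \<rho>G y) = ((- 1) ^ (\<rho>B x - 1) :: int)"
    using sum_V[OF g0_V[OF x]] unfolding z by (subst (asm) sum.insert) (auto simp: G.rank_bot)
  have 2: "(\<Sum>y' | y' \<in> V x - {g0} \<and> (y, y') \<in> \<Gamma>. (- 1) ^ \<rho>G y') = ((- 1) ^ (\<rho>B x - 1) :: int)"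
    if y: "y \<in> V x - {g0}" for y
  proof -
    have "{y'. y' \<in> V x - {g0} \<and> (y, y') \<in> \<Gamma>} = {y'. (y, y') \<in> \<Gamma> \<and> y' \<in> V x}"
      using y G.rel_antisym[of y g0] G.bot_least V_subset by blast
    then show ?thesis using sum_V y by simp
  qed
  show "eulerian_set \<Gamma> \<rho>G (V x - {g0}) (\<rho>B x - 1)"
    unfolding eulerian_set_def using 1 2 by blast
  fix y assume y: "y \<in> V x - {g0}"
  then show "eulerian_set \<Gamma> \<rho>G (below \<Gamma> (V x - {g0}) y) (\<rho>G y - 1)"
    unfolding V_lower_set[OF y] using V_subset by (intro G.eulerian_set_below) auto
qed

text \<open>For \<open>y\<close> of rank \<open>\<rho>B x - 1\<close>, the covers are the other
  elements above \<open>y\<close> in the fibre over \<open>x\<close>, all of rank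
  \<open>\<rho>B x\<close>. The fibre identity counts them: one if
  \<open>\<phi> y \<noteq> x\<close>, but two if \<open>\<phi> y = x\<close>, because
  \<open>y\<close> then contributes the opposite sign.\<close>

lemma boundary_sub:
  assumes x: "x \<in> Field B" "x \<noteq> b0"
  shows "boundary (Restr \<Gamma> (U x)) = Restr \<Gamma> (V x)"
proof -
  let ?R = "Restr \<Gamma> (U x)" and ?n = "\<rho>B x"
  interpret R: ranked_poset ?R g0 \<rho>G ?n by (rule sub_ranked[OF x(1)])
  have F: "Field ?R = U x" using Field_Restr[OF G.rel_Refl] V_subset by blast
  have n: "?n > 0" using B.rank_eq_bot x by auto
  have cov: "(\<exists>!w. covers ?R w y) \<longleftrightarrow> \<phi> y \<noteq> x" if y: "y \<in> U x" "\<rho>G y + 1 = ?n" for y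
  proof -
    have yF: "y \<in> Field \<Gamma>" and yx: "(\<phi> y, x) \<in> B" using y by (auto simp: U_def)
    let ?C = "{w. (y, w) \<in> \<Gamma> \<and> \<phi> w = x \<and> w \<noteq> y}"
    have rC: "\<rho>G w = ?n" if "w \<in> ?C" for w
    proof -
      have "w \<in> U x" using that x B.rel_refl G.in_Field by (auto simp: U_def)
      then show ?thesis using rank_U[of w x] G.rank_less[of y w] that y(2) by auto
    qed
    have CU: "covers ?R w y \<longleftrightarrow> w \<in> ?C" for w
    proof
      assume "covers ?R w y"
      then have w: "(y, w) \<in> \<Gamma>" "w \<in> U x" "y \<noteq> w" by (auto simp: covers_def)
      then have "?n \<le> \<rho>B (\<phi> w)" using G.rank_less[of y w] rank_inc[of w] y(2) V_subset by fastforce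
      moreover have "(\<phi> w, x) \<in> B" using w by (auto simp: U_def)
      ultimately show "w \<in> ?C" using w B.rank_eqD by blast
    next
      assume w: "w \<in> ?C"
      then have wU: "w \<in> U x" using x B.rel_refl G.in_Field by (auto simp: U_def)
      have "v = y \<or> v = w" if "(y, v) \<in> \<Gamma>" "(v, w) \<in> \<Gamma>" for v
        using G.rank_less[OF that(1)] G.rank_less[OF that(2)] rC[OF w] y(2) by fastforce
      then show "covers ?R w y" using w wU y by (auto simp: covers_def)
    qed
    have fC: "finite ?C" by (rule G.fin_le)
    have "{y'. (y, y') \<in> \<Gamma> \<and> \<phi> y' = x} = (if \<phi> y = x then insert y ?C else ?C)"
      using G.rel_refl[OF yF] by auto
    moreover have "y \<notin> ?C" by simp
    moreover have sC: "(\<Sum>w \<in> ?C. (- 1) ^ \<rho>G w) = (int (card ?C) * (- 1) ^ ?n)"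
      using rC by simp
    moreover have "?n = Suc (\<rho>G y)" using y by simp
    ultimately have "(if \<phi> y = x then int (card ?C) - 1 else int (card ?C)) * (- 1) ^ ?n = (- 1) ^ ?n"
      using fibre[OF yF yx] fC by (auto split: if_splits simp: algebra_simps)
    then have "card ?C = (if \<phi> y = x then 2 else 1)"
      by (auto split: if_splits)
    moreover have "(\<exists>!w. w \<in> ?C) \<longleftrightarrow> card ?C = 1"
      by (rule ex1_iff_card)
    ultimately show ?thesis
      unfolding CU by (simp split: if_splits)
  qed
  have "{w. \<exists>y \<in> Field ?R. rho ?R y + 1 = poset_rank ?R \<and> (\<exists>!v. covers ?R v y) \<and> (w, y) \<in> ?R} = V x"
  proof (intro equalityI subsetI)
    fix w assume "w \<in> {w. \<exists>y \<in> Field ?R. rho ?R y + 1 = poset_rank ?R \<and> (\<exists>!v. covers ?R v y) \<and> (w,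
        y) \<in> ?R}"
    then obtain y where y: "y \<in> U x" "rho ?R y + 1 = poset_rank ?R" "\<exists>!v. covers ?R v y" "(w, y) \<in> ?R"
      unfolding F by blast
    have "\<rho>G y + 1 = ?n" using y(1,2) R.rho_eq F R.poset_rank_eq by simp
    then have "\<phi> y \<noteq> x" using cov y by blast
    then have "y \<in> V x" using y(1) by (auto simp: U_def V_def)
    then show "w \<in> V x" using V_lower y(4) by blast
  next
    fix w assume w: "w \<in> V x"
    then obtain y where y: "y \<in> V x" "(w, y) \<in> \<Gamma>" "\<rho>G y = ?n - 1" using V_top by blast
    have yU: "y \<in> U x" "w \<in> U x" using y w V_subset by auto
    have "\<exists>!v. covers ?R v y" using cov[OF yU(1)] y n by (simp add: V_def)
    moreover have "rho ?R y + 1 = poset_rank ?R" using R.rho_eq F R.poset_rank_eq yU y n by simp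
    ultimately show "w \<in> {w. \<exists>y \<in> Field ?R. rho ?R y + 1 = poset_rank ?R \<and> (\<exists>!v. covers ?R v y) \<and>
        (w, y) \<in> ?R}"
      using yU y F by blast
  qed
  then show ?thesis
    unfolding boundary_def using V_subset by auto
qed

text \<open>\<open>T x\<close> is the ab-index of the subdivision up to \<open>x\<close> and, for
  \<open>x\<close> above the bottom, \<open>D x\<close> is that of its boundary.\<close>

definition T :: "'b \<Rightarrow> 'k::comm_ring_1 R_Psi" where "T x = Psi \<Gamma> \<rho>G (U x - {g0}) (\<rho>B x)"
definition D :: "'b \<Rightarrow> 'k::comm_ring_1 R_Psi" where "D x = Psi \<Gamma> \<rho>G (V x - {g0}) (\<rho>B x - 1)"
text \<open>The image of the local cd-index: the semisuspension contributes \<open>T x + D x * b\<close>, and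
  \<open>D x * (a + b)\<close> is subtracted.\<close>

definition Lam :: "'b \<Rightarrow> 'k::comm_ring_1 R_Psi" where
  "Lam x = (if x = b0 then 1 else T x - D x * la)"

lemma cd_to_ab_boundary:
  assumes x: "x \<in> Field B" "x \<noteq> b0"
  shows "cd_to_ab (cd_index_boundary (boundary (Restr \<Gamma> (U x))) :: 'k::field_char_0 R_Phi) = D x"
proof -
  have "Field (Restr \<Gamma> (V x)) - {g0} = V x - {g0}"
    using Field_Restr[OF G.rel_Refl] V_subset by blast
  then have "ab_index (Restr \<Gamma> (V x)) = (D x :: 'k R_Psi)"
    unfolding ranked_poset.ab_index_eq[OF V_ranked[OF x]] D_def by (simp add: Psi_Restr Diff_subset)
  moreover have "(D x :: 'k R_Psi) \<in> range cd_to_ab"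
    unfolding D_def by (rule sphere_in_range_cd[OF sphere_V[OF x]])
  ultimately show ?thesis
    unfolding boundary_sub[OF x] using cd_to_ab_cd_index_boundary by metis
qed

section \<open>The semisuspension and the local cd-index\<close>

abbreviation "Sus x \<equiv> semisuspension (Restr \<Gamma> (U x))"
abbreviation "sus_rank x w \<equiv> (case w of None \<Rightarrow> \<rho>B x | Some y \<Rightarrow> \<rho>G y)"

lemma Sus_iff:
  assumes x: "x \<in> Field B" "x \<noteq> b0"
  shows "(Some y, Some y') \<in> Sus x \<longleftrightarrow> (y, y') \<in> \<Gamma> \<and> y \<in> U x \<and> y' \<in> U x"
    and "(Some y, None) \<in> Sus x \<longleftrightarrow> y \<in> V x"
    and "(None, w) \<in> Sus x \<longleftrightarrow> w = None"
proof -
  have "Field (Restr \<Gamma> (V x)) = V x" using Field_Restr[OF G.rel_Refl] V_subset by blast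
  then show "(Some y, Some y') \<in> Sus x \<longleftrightarrow> (y, y') \<in> \<Gamma> \<and> y \<in> U x \<and> y' \<in> U x"
    and "(Some y, None) \<in> Sus x \<longleftrightarrow> y \<in> V x"
    and "(None, w) \<in> Sus x \<longleftrightarrow> w = None"
    by (auto simp: semisuspension_def boundary_sub[OF x])
qed

lemma Sus_Field:
  assumes x: "x \<in> Field B" "x \<noteq> b0"
  shows "Field (Sus x) = insert None (Some ` U x)"
proof (intro equalityI subsetI)
  fix w assume "w \<in> Field (Sus x)"
  then show "w \<in> insert None (Some ` U x)"
    using V_subset
    by (cases w) (auto simp: Field_def Domain_iff Range_iff semisuspension_def boundary_sub[OF x])
next
  fix w assume "w \<in> insert None (Some ` U x)"
  then have "(w, w) \<in> Sus x"
    using re_U by (auto simp: Sus_iff[OF x])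
  then show "w \<in> Field (Sus x)" by (auto simp: Field_def)
qed

lemma Sus_ranked:
  assumes x: "x \<in> Field B" "x \<noteq> b0"
  shows "ranked_poset (Sus x) (Some g0) (sus_rank x) (\<rho>B x)"
proof
  note S = Sus_iff[OF x] and F = Sus_Field[OF x]
  show "Partial_order (Sus x)"
    unfolding partial_order_on_def preorder_on_def
  proof (intro conjI)
    show "Sus x \<subseteq> Field (Sus x) \<times> Field (Sus x)"
      by (rule subsetI) (auto intro: FieldI1 FieldI2)
    show "Refl (Sus x)"
    proof (rule refl_onI)
      show "(w, w) \<in> Sus x" if "w \<in> Field (Sus x)" for w
        using that re_U by (auto simp: F S)
    qed
    show "trans (Sus x)"
    proof (rule transI)
      fix a b c assume "(a, b) \<in> Sus x" "(b, c) \<in> Sus x"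
      then show "(a, c) \<in> Sus x"
        by ((cases a; cases b; cases c); simp add: S; blast intro: G.rel_trans V_lower)
    qed
    show "antisym (Sus x)"
    proof (rule antisymI)
      fix a b assume "(a, b) \<in> Sus x" "(b, a) \<in> Sus x"
      then show "a = b" using G.rel_antisym by (cases a; cases b) (auto simp: S)
    qed
  qed
  have "finite (U x)" by (rule finite_U)
  then show "finite (Field (Sus x))" by (simp add: F)
  show "Some g0 \<in> Field (Sus x)" using g0_U x by (simp add: F)
  show "sus_rank x (Some g0) = 0" by (simp add: G.rank_bot)
  fix w assume w: "w \<in> Field (Sus x)"
  show "(Some g0, w) \<in> Sus x"
    using w g0_U[OF x(1)] g0_V[OF x] bot_U by (auto simp: F S)
  show "\<exists>v. (w, v) \<in> Sus x \<and> sus_rank x v = \<rho>B x"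
  proof (cases w)
    case None
    then show ?thesis by (intro exI[of _ None]) (simp add: S)
  next
    case (Some y)
    then have y: "y \<in> U x" using w by (auto simp: F)
    then obtain y' where "y' \<in> U x" "(y, y') \<in> \<Gamma>" "\<rho>G y' = \<rho>B x" using U_top by blast
    then show ?thesis using Some y by (intro exI[of _ "Some y'"]) (simp add: S)
  qed
  show "sus_rank x w \<le> \<rho>B x"
    using w rank_U by (cases w) (auto simp: F)
next
  note S = Sus_iff[OF x] and F = Sus_Field[OF x]
  fix a b assume ab: "(a, b) \<in> Sus x"
  show "sus_rank x a < sus_rank x b" if "a \<noteq> b"
    using ab that G.rank_less rank_V by (cases a; cases b) (auto simp: S)
  fix k assume k: "sus_rank x a \<le> k" "k \<le> sus_rank x b"
  show "\<exists>w. (a, w) \<in> Sus x \<and> (w, b) \<in> Sus x \<and> sus_rank x w = k"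
  proof (cases a)
    case None
    then have "b = None" using ab by (simp add: S)
    then show ?thesis using None k by (intro exI[of _ None]) (simp add: S)
  next
    case a: (Some y)
    show ?thesis
    proof (cases b)
      case b: (Some y')
      have yy: "(y, y') \<in> \<Gamma>" "y \<in> U x" "y' \<in> U x" using ab a b by (auto simp: S)
      then obtain w where "(y, w) \<in> \<Gamma>" "(w, y') \<in> \<Gamma>" "\<rho>G w = k"
        using G.rank_between[OF yy(1), of k] k a b by auto
      then show ?thesis using a b yy U_lower by (intro exI[of _ "Some w"]) (auto simp: S)
    next
      case b: None
      have y: "y \<in> V x" using ab a b by (simp add: S)
      show ?thesis
      proof (cases "k = \<rho>B x")
        case True
        then show ?thesis using a b y by (intro exI[of _ None]) (simp add: S)
      next
        case False
        \<comment> \<open>Ranks below that of the new element are realised inside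
          \<open>V x\<close>, on the way from \<open>y\<close> to an element of rank
          \<open>\<rho>B x - 1\<close>.\<close>
        obtain y' where y': "y' \<in> V x" "(y, y') \<in> \<Gamma>" "\<rho>G y' = \<rho>B x - 1" using V_top[OF y] by blast
        have "\<rho>G y \<le> k" "k \<le> \<rho>G y'" using k a b False y'(3) by auto
        then obtain w where w: "(y, w) \<in> \<Gamma>" "(w, y') \<in> \<Gamma>" "\<rho>G w = k"
          using G.rank_between[OF y'(2)] by blast
        then have "w \<in> V x" using V_lower y'(1) by blast
        then show ?thesis using a b w y V_subset by (intro exI[of _ "Some w"]) (auto simp: S)
      qed
    qed
  qed
qed

text \<open>The formula is \<open>Psi_insert_top\<close> for the new element. That a cd-index exists
  at all is due to the Eulerian condition: the new element lies above exactly the elements of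
  \<open>V x\<close> and adds the sign that \<open>sum_U\<close> lacks for them.\<close>

lemma cd_to_ab_semisuspension:
  assumes x: "x \<in> Field B" "x \<noteq> b0"
  shows "cd_to_ab (cd_index_boundary (Sus x) :: 'k::field_char_0 R_Phi) = T x + D x * lb"
proof -
  note S = Sus_iff[OF x] and F = Sus_Field[OF x]
  interpret S: ranked_poset "Sus x" "Some g0" "sus_rank x" "\<rho>B x" by (rule Sus_ranked[OF x])
  let ?U = "U x - {g0}" and ?V = "V x - {g0}" and ?n = "\<rho>B x"
  let ?A = "insert None (Some ` ?U)"
  have n: "?n > 0" using B.rank_eq_bot x by auto
  have A: "Field (Sus x) - {Some g0} = ?A" unfolding F by auto
  have g: "graded_set (Sus x) (sus_rank x) ?A ?n"
    using S.graded_set_Field unfolding A .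
  have im: "Psi (Sus x) (sus_rank x) (Some ` X) m = (Psi \<Gamma> \<rho>G X m :: 'k R_Psi)" if "X \<subseteq> U x" for X m
    by (rule Psi_image) (use that in \<open>auto simp: S\<close>)
  have UU: "?U \<subseteq> U x" and VU: "?V \<subseteq> U x" using V_subset(1)[of x] by auto
  have bN: "below (Sus x) (Some ` ?U) None = Some ` ?V"
    using V_subset by (auto simp: below_def S)
  have "ab_index (Sus x) = (Psi (Sus x) (sus_rank x) ?A ?n :: 'k R_Psi)"
    using S.ab_index_eq unfolding A .
  also have "\<dots> = T x + D x * lb"
  proof -
    have "Psi (Sus x) (sus_rank x) ?A ?n = (Psi (Sus x) (sus_rank x) (Some ` ?U) ?n
        + Psi (Sus x) (sus_rank x) (below (Sus x) (Some ` ?U) None) (?n - 1) * lb :: 'k R_Psi)"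
      by (rule Psi_insert_top[OF g]) (auto simp: S)
    then show ?thesis
      unfolding bN T_def D_def im[OF UU] im[OF VU] .
  qed
  finally have ab: "ab_index (Sus x) = (T x + D x * lb :: 'k R_Psi)" .
  have fU: "finite (U x)" by (rule finite_U)
  have si: "(\<Sum>w \<in> Some ` X. (- 1) ^ sus_rank x w) = (\<Sum>y \<in> X. (- 1) ^ \<rho>G y :: int)" for X
    by (simp add: sum.reindex)
  have "sphere (Sus x) (sus_rank x) ?A ?n"
    unfolding sphere_def
  proof (intro conjI ballI g)
    have z: "{y'. (g0, y') \<in> \<Gamma> \<and> y' \<in> U x} = U x"
      using bot_U by blast
    have 1: "1 + (\<Sum>w \<in> ?A. (- 1) ^ sus_rank x w) = ((- 1) ^ ?n :: int)"
      using sum_U[OF g0_U[OF x(1)]] g0_V[OF x] fU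
      unfolding z sum.remove[OF fU g0_U[OF x(1)]] by (simp add: si G.rank_bot)
    have 2: "(\<Sum>w | w \<in> ?A \<and> (v, w) \<in> Sus x. (- 1) ^ sus_rank x w) = ((- 1) ^ ?n :: int)"
      if v: "v \<in> ?A" for v
    proof (cases v)
      case None
      then have "{w. w \<in> ?A \<and> (v, w) \<in> Sus x} = {None}" by (auto simp: S)
      then show ?thesis by simp
    next
      case (Some y)
      then have y: "y \<in> U x" "y \<noteq> g0" using v by auto
      let ?Y = "{y'. (y, y') \<in> \<Gamma> \<and> y' \<in> U x}"
      have Y: "g0 \<notin> ?Y" using y G.rel_antisym[of y g0] G.bot_least V_subset by blast
      have "{w. w \<in> ?A \<and> (v, w) \<in> Sus x} = (if y \<in> V x then insert None (Some ` ?Y) else Some ` ?Y)"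
        using y Y Some by (auto simp: S image_iff)
      moreover have "finite ?Y" by (rule G.fin_le)
      ultimately show ?thesis using sum_U[OF y(1)] by (auto simp: si)
    qed
    show "eulerian_set (Sus x) (sus_rank x) ?A ?n"
      unfolding eulerian_set_def using 1 2 by blast
    have eulerian_image: "eulerian_set (Sus x) (sus_rank x) (Some ` X) m" if e: "eulerian_set \<Gamma> \<rho>G X m"
        and X: "X \<subseteq> U x" for X m
    proof -
      have "{w. w \<in> Some ` X \<and> (Some y, w) \<in> Sus x} = Some ` {y'. y' \<in> X \<and> (y, y') \<in> \<Gamma>}" if "y \<in> X" for y
        using X that by (auto simp: S)
      then show ?thesis using e by (auto simp: eulerian_set_def si)
    qed
    fix v assume v: "v \<in> ?A"
    show "eulerian_set (Sus x) (sus_rank x) (below (Sus x) ?A v) (sus_rank x v - 1)"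
    proof (cases v)
      case None
      have "below (Sus x) ?A None = Some ` ?V" using bN by (auto simp: below_def)
      moreover have "eulerian_set \<Gamma> \<rho>G ?V (?n - 1)" using sphere_V[OF x] by (simp add: sphere_def)
      ultimately show ?thesis using None eulerian_image[of ?V "?n - 1"] V_subset by auto
    next
      case (Some y)
      then have y: "y \<in> ?U" using v by auto
      have "below (Sus x) ?A v = Some ` below \<Gamma> ?U y"
        using y Some by (auto simp: below_def S)
      moreover have "eulerian_set \<Gamma> \<rho>G (below \<Gamma> ?U y) (\<rho>G y - 1)"
        unfolding U_lower_set[OF y] using y V_subset by (intro G.eulerian_set_below) auto
      moreover have "below \<Gamma> ?U y \<subseteq> U x" by (auto simp: below_def)
      ultimately show ?thesis using eulerian_image Some by simp
    qed
  qed
  then have "(Psi (Sus x) (sus_rank x) ?A ?n :: 'k R_Psi) \<in> range cd_to_ab"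
    by (rule sphere_in_range_cd)
  then show ?thesis
    using cd_to_ab_cd_index_boundary[of "Sus x", where ?'k = 'k] S.ab_index_eq ab unfolding A by metis
qed

abbreviation ell :: "'b \<Rightarrow> 'k::field_char_0 R_Phi" where
  "ell x \<equiv> local_cd_index (subdiv_below \<Gamma> B \<phi> x)"

lemma cd_to_ab_ell:
  assumes x: "x \<in> Field B"
  shows "cd_to_ab (ell x :: 'k::field_char_0 R_Phi) = Lam x"
proof (cases "x = b0")
  case True
  have "U x = {g0}"
    using True phi_eq_bot B.rel_antisym B.bot_least phi_in g0_U[OF x] unfolding U_def by blast
  moreover have "Field (Restr \<Gamma> (U x)) = U x" using Field_Restr[OF G.rel_Refl] V_subset by blast
  ultimately have "Field (Restr \<Gamma> (U x)) = {g0}" by simp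
  then show ?thesis using True by (simp add: local_cd_index_def subdiv_below_eq Lam_def)
next
  case False
  have F: "Field (Restr \<Gamma> (U x)) = U x" using Field_Restr[OF G.rel_Refl] V_subset by blast
  \<comment> \<open>\<open>local_cd_index\<close> branches on the number of elements, so a singleton
    has to be excluded: besides \<open>g0\<close> there is a lift of \<open>x\<close>.\<close>
  have "card (U x) \<noteq> 1"
  proof
    assume "card (U x) = 1"
    then have U: "U x = {g0}" using g0_U[OF x] by (auto simp: card_1_singleton_iff)
    obtain y where "y \<in> U x" "\<phi> y = x" using U_top[OF g0_U[OF x]] by blast
    then show False using U False phi_bot by simp
  qed
  then have "ell x = (cd_index_boundary (Sus x) - cd_index_boundary (boundary (Restr \<Gamma> (U x))) * mon
      [Lc] :: 'k R_Phi)"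
    by (simp add: local_cd_index_def subdiv_below_eq F)
  then show ?thesis
    using False
    by (simp add: linear_map_minus[OF linear_cd_to_ab[OF linear_ident]] cd_to_ab_mult
        cd_to_ab_semisuspension[OF x] cd_to_ab_boundary[OF x] Lam_def distrib_left)
qed

lemma homog_Lam: "homog len (int (\<rho>B x)) (Lam x :: 'k::comm_ring_1 R_Psi)" if x: "x \<in> Field B"
proof (cases "x = b0")
  case True
  then show ?thesis by (simp add: Lam_def B.rank_bot one_word homog_mon)
next
  case False
  then have "\<rho>B x > 0" using B.rank_eq_bot[OF x] by simp
  then have "homog len (int (\<rho>B x)) (D x * la :: 'k R_Psi)"
    unfolding D_def by (intro homog_mult[OF len_add homog_Psi homog_mon[OF refl]]) auto
  then show ?thesis
    using False unfolding Lam_def T_def by (auto intro: homog_minus homog_Psi)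
qed

lemma homog_ell: "homog cd_deg (int (\<rho>B x)) (ell x :: 'k::field_char_0 R_Phi)" if x: "x \<in> Field B"
  using homog_ab_to_cd[OF homog_Lam[OF x, where ?'k = 'k]] unfolding cd_to_ab_ell[OF x, symmetric]
      by simp

section \<open>The decomposition of the cd-index of a subdivided boundary\<close>

text \<open>For \<open>x\<close> strictly below \<open>y\<close>, the ab-index of the boundary of
  the interval from \<open>x\<close> to \<open>y\<close>, computed on the open interval inside
  \<open>B\<close>.\<close>

definition P :: "'b \<Rightarrow> 'b \<Rightarrow> 'k::comm_ring_1 R_Psi" where
  "P x y = Psi B (\<lambda>w. \<rho>B w - \<rho>B x) {w. (x, w) \<in> B \<and> w \<noteq> x \<and> (w, y) \<in> B \<and> w \<noteq> y} (\<rho>B y - \<rho>B x - 1)"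

lemma below_open: "w \<in> {w. (x, w) \<in> B \<and> w \<noteq> x \<and> (w, y) \<in> B \<and> w \<noteq> y} \<Longrightarrow>
    below B {w. (x, w) \<in> B \<and> w \<noteq> x \<and> (w, y) \<in> B \<and> w \<noteq> y} w =
    {v. (x, v) \<in> B \<and> v \<noteq> x \<and> (v, w) \<in> B \<and> v \<noteq> w}"
  unfolding below_def using B.rel_trans B.rel_antisym by blast

lemma above_open: "w \<in> {w. (x, w) \<in> B \<and> w \<noteq> x \<and> (w, y) \<in> B \<and> w \<noteq> y} \<Longrightarrow>
    above B {w. (x, w) \<in> B \<and> w \<noteq> x \<and> (w, y) \<in> B \<and> w \<noteq> y} w =
    {v. (w, v) \<in> B \<and> v \<noteq> w \<and> (v, y) \<in> B \<and> v \<noteq> y}"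
  unfolding above_def using B.rel_trans B.rel_antisym by blast

lemma graded_set_open:
  "graded_set B (\<lambda>w. \<rho>B w - \<rho>B x) {w. (x, w) \<in> B \<and> w \<noteq> x \<and> (w, y) \<in> B \<and> w \<noteq> y} (\<rho>B y - \<rho>B x - 1)"
  unfolding graded_set_def
proof (intro conjI ballI impI B.partial_order)
  let ?A = "{w. (x, w) \<in> B \<and> w \<noteq> x \<and> (w, y) \<in> B \<and> w \<noteq> y}"
  show "finite ?A" by (rule B.fin_le)
  show "?A \<subseteq> Field B" using B.in_Field by blast
  fix w assume w: "w \<in> ?A"
  then have "\<rho>B x < \<rho>B w" "\<rho>B w < \<rho>B y" using B.rank_less by auto
  then show "1 \<le> \<rho>B w - \<rho>B x" "\<rho>B w - \<rho>B x \<le> \<rho>B y - \<rho>B x - 1" by auto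
  fix v assume "v \<in> ?A" "(w, v) \<in> B" "w \<noteq> v"
  then show "\<rho>B w - \<rho>B x < \<rho>B v - \<rho>B x"
    using B.rank_less[of w v] \<open>\<rho>B x < \<rho>B w\<close> by auto
qed

lemma P_rec:
  "P x y = (lx ^ (\<rho>B y - \<rho>B x - 1) +
    (\<Sum>w | (x, w) \<in> B \<and> w \<noteq> x \<and> (w, y) \<in> B \<and> w \<noteq> y. P x w * lb * lx ^ (\<rho>B y - \<rho>B w - 1)) ::
        'k::comm_ring_1 R_Psi)"
proof -
  let ?A = "{w. (x, w) \<in> B \<and> w \<noteq> x \<and> (w, y) \<in> B \<and> w \<noteq> y}"
  have "\<rho>B y - \<rho>B x - 1 - (\<rho>B w - \<rho>B x) = \<rho>B y - \<rho>B w - 1" if "w \<in> ?A" for w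
  proof -
    have "\<rho>B x < \<rho>B w" using that B.rank_less by auto
    then show ?thesis by simp
  qed
  then show ?thesis
    unfolding P_def Psi_rec[OF graded_set_open[of x y]]
    by (intro arg_cong2[of _ _ _ _ "(+)"] sum.cong refl) (simp only: below_open)
qed

text \<open>Multiplying \<open>D x\<close> by X extends all its words to rank
  \<open>\<rho>B x\<close>. Its recursion then matches that of \<open>T x\<close> term by term on
  \<open>V x\<close>, and the fibre over \<open>x\<close> remains.\<close>

lemma T_minus_D:
  assumes x: "x \<in> Field B" "x \<noteq> b0"
  shows "T x - D x * lx = (\<Sum>y | y \<in> Field \<Gamma> \<and> \<phi> y = x. Psi_below \<Gamma> \<rho>G G.proper y * lb * lx ^ (\<rho>B x -
      \<rho>G y) :: 'k::comm_ring_1 R_Psi)"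
proof -
  let ?f = "\<lambda>y. Psi_below \<Gamma> \<rho>G G.proper y * lb * lx ^ (\<rho>B x - \<rho>G y) :: 'k R_Psi"
  have n: "\<rho>B x > 0" using B.rank_eq_bot x by auto
  have T: "T x = lx ^ \<rho>B x + (\<Sum>y \<in> U x - {g0}. ?f y)"
    unfolding T_def Psi_rec[OF graded_set_U]
    by (intro arg_cong2[of _ _ _ _ "(+)"] sum.cong refl) (simp only: U_lower_set)
  have Dx: "D x = lx ^ (\<rho>B x - 1) + (\<Sum>y \<in> V x - {g0}. Psi_below \<Gamma> \<rho>G G.proper y * lb * lx ^ (\<rho>B x -
      1 - \<rho>G y) :: 'k R_Psi)"
    unfolding D_def Psi_rec[OF graded_set_V]
    by (intro arg_cong2[of _ _ _ _ "(+)"] sum.cong refl) (simp only: V_lower_set)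
  have 1: "lx ^ (\<rho>B x - 1) * lx = (lx ^ \<rho>B x :: 'k R_Psi)"
    using n by (simp flip: power_Suc2)
  have 2: "p * lb * lx ^ (\<rho>B x - 1 - \<rho>G y) * lx = (p * lb * lx ^ (\<rho>B x - \<rho>G y) :: 'k R_Psi)"
    if "y \<in> V x - {g0}" for p y
  proof -
    have "\<rho>B x - \<rho>G y = Suc (\<rho>B x - 1 - \<rho>G y)" using rank_V[of y x] that by auto
    then show ?thesis by (simp only: power_Suc2 mult.assoc)
  qed
  have D: "D x * lx = lx ^ \<rho>B x + (\<Sum>y \<in> V x - {g0}. ?f y)"
    unfolding Dx distrib_right sum_distrib_right 1
    by (rule arg_cong[of _ _ "(+) _"], rule sum.cong[OF refl], rule 2)
  have fU: "finite (U x)" by (rule finite_U)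
  have "U x - {g0} = (V x - {g0}) \<union> {y. y \<in> Field \<Gamma> \<and> \<phi> y = x}"
    using x B.rel_refl phi_bot by (auto simp: U_def V_def)
  moreover have "(V x - {g0}) \<inter> {y. y \<in> Field \<Gamma> \<and> \<phi> y = x} = {}" by (auto simp: V_def)
  moreover have "finite (V x)" by (rule finite_V)
  moreover have "finite {y. y \<in> Field \<Gamma> \<and> \<phi> y = x}" using G.finite_carrier by simp
  ultimately have "(\<Sum>y \<in> U x - {g0}. ?f y) = (\<Sum>y \<in> V x - {g0}. ?f y) + (\<Sum>y | y \<in> Field \<Gamma> \<and> \<phi> y = x.
      ?f y)"
    by (simp add: sum.union_disjoint)
  then show ?thesis unfolding T D by simp
qed

text \<open>After expanding \<open>P x y\<close> by its recursion and exchanging sums, the inner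
  sums are \<open>D w\<close> by induction. Since a = X + b, \<open>Lam w + D w * lb\<close> equals
  \<open>T w - D w * lx\<close>, the contribution of the fibre over \<open>w\<close>; all fibres
  together form the recursion for \<open>D y\<close>.\<close>

theorem decomposition:
  assumes "y \<in> Field B" "y \<noteq> b0"
  shows "D y = (\<Sum>x | (x, y) \<in> B \<and> x \<noteq> y. Lam x * P x y :: 'k::comm_ring_1 R_Psi)"
  using assms
proof (induction "\<rho>B y" arbitrary: y rule: less_induct)
  case less
  note y = less.prems
  let ?I = "{x. (x, y) \<in> B \<and> x \<noteq> y}"
  let ?e = "\<lambda>w. \<rho>B y - \<rho>B w - 1"
  have fI: "finite ?I" by (rule B.fin_le)
  have b0I: "b0 \<in> ?I" using y B.bot_least by auto
  have IF: "w \<in> Field B" "\<rho>B w < \<rho>B y" if "w \<in> ?I" for w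
    using that B.in_Field B.rank_less by auto
  have "(\<Sum>x \<in> ?I. Lam x * P x y :: 'k R_Psi) = (\<Sum>x \<in> ?I. Lam x * lx ^ ?e x) +
      (\<Sum>x \<in> ?I. \<Sum>w | w \<in> ?I \<and> ((x, w) \<in> B \<and> w \<noteq> x). Lam x * P x w * lb * lx ^ ?e w)"
  proof -
    have "{w. (x, w) \<in> B \<and> w \<noteq> x \<and> (w, y) \<in> B \<and> w \<noteq> y} = {w. w \<in> ?I \<and> ((x, w) \<in> B \<and> w \<noteq> x)}" for x
        by auto
    then show ?thesis
      by (subst P_rec) (simp add: distrib_left sum.distrib sum_distrib_left mult.assoc)
  qed
  also have "(\<Sum>x \<in> ?I. \<Sum>w | w \<in> ?I \<and> ((x, w) \<in> B \<and> w \<noteq> x). Lam x * P x w * lb * lx ^ ?e w :: 'k R_Psi)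
      = (\<Sum>w \<in> ?I. \<Sum>x | x \<in> ?I \<and> ((x, w) \<in> B \<and> w \<noteq> x). Lam x * P x w * lb * lx ^ ?e w)"
    by (rule sum.swap_restrict[OF fI fI])
  also have "\<dots> = (\<Sum>w \<in> ?I. (\<Sum>x | (x, w) \<in> B \<and> x \<noteq> w. Lam x * P x w) * lb * lx ^ ?e w)"
  proof (rule sum.cong[OF refl])
    fix w assume w: "w \<in> ?I"
    then have "{x. x \<in> ?I \<and> ((x, w) \<in> B \<and> w \<noteq> x)} = {x. (x, w) \<in> B \<and> x \<noteq> w}"
      using B.rel_trans B.rel_antisym by blast
    then show "(\<Sum>x | x \<in> ?I \<and> ((x, w) \<in> B \<and> w \<noteq> x). Lam x * P x w * lb * lx ^ ?e w :: 'k R_Psi) =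
        (\<Sum>x | (x, w) \<in> B \<and> x \<noteq> w. Lam x * P x w) * lb * lx ^ ?e w"
      by (simp add: sum_distrib_right)
  qed
  also have "\<dots> = (\<Sum>w \<in> ?I - {b0}. D w * lb * lx ^ ?e w)"
  proof -
    \<comment> \<open>Nothing lies strictly below the bottom, so its inner sum vanishes and the
      induction hypothesis is applied to the other elements only.\<close>
    have "{x. (x, b0) \<in> B \<and> x \<noteq> b0} = {}" using B.rel_antisym B.bot_least B.in_Field by blast
    then have "(\<Sum>x | (x, b0) \<in> B \<and> x \<noteq> b0. Lam x * P x b0 :: 'k R_Psi) = 0"
      by (simp only: sum.empty)
    then have "(\<Sum>w \<in> ?I. (\<Sum>x | (x, w) \<in> B \<and> x \<noteq> w. Lam x * P x w) * lb * lx ^ ?e w) =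
        (\<Sum>w \<in> ?I - {b0}. (\<Sum>x | (x, w) \<in> B \<and> x \<noteq> w. Lam x * P x w) * lb * lx ^ ?e w :: 'k R_Psi)"
      unfolding sum.remove[OF fI b0I] by simp
    also have "\<dots> = (\<Sum>w \<in> ?I - {b0}. D w * lb * lx ^ ?e w)"
      using less.hyps IF by (intro sum.cong refl) auto
    finally show ?thesis .
  qed
  also have "(\<Sum>x \<in> ?I. Lam x * lx ^ ?e x) + (\<Sum>w \<in> ?I - {b0}. D w * lb * lx ^ ?e w) =
      lx ^ (\<rho>B y - 1) + (\<Sum>w \<in> ?I - {b0}. (T w - D w * lx) * lx ^ ?e w :: 'k R_Psi)"
  proof -
    have la: "la = lx + (lb :: 'k R_Psi)" by (simp add: lx_def)
    have "Lam w * lx ^ ?e w + D w * lb * lx ^ ?e w = (T w - D w * lx) * (lx ^ ?e w :: 'k R_Psi)"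
      if "w \<in> ?I - {b0}" for w
      using that unfolding Lam_def la by (simp add: algebra_simps)
    then have "(\<Sum>w \<in> ?I - {b0}. Lam w * lx ^ ?e w) + (\<Sum>w \<in> ?I - {b0}. D w * lb * lx ^ ?e w) =
        (\<Sum>w \<in> ?I - {b0}. (T w - D w * lx) * lx ^ ?e w :: 'k R_Psi)"
      unfolding sum.distrib[symmetric] by (intro sum.cong refl)
    then show ?thesis
      unfolding sum.remove[OF fI b0I] by (simp add: Lam_def B.rank_bot add.assoc)
  qed
  also have "(\<Sum>w \<in> ?I - {b0}. (T w - D w * lx) * lx ^ ?e w :: 'k R_Psi) =
      (\<Sum>w \<in> ?I - {b0}. \<Sum>v | v \<in> V y - {g0} \<and> \<phi> v = w. Psi_below \<Gamma> \<rho>G G.proper v * lb * lx ^ (\<rho>B y -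
          1 - \<rho>G v))"
  proof (rule sum.cong[OF refl])
    fix w assume w: "w \<in> ?I - {b0}"
    have eq: "{v. v \<in> V y - {g0} \<and> \<phi> v = w} = {v. v \<in> Field \<Gamma> \<and> \<phi> v = w}"
      using w phi_bot by (auto simp: V_def)
    have "p * lb * lx ^ (\<rho>B w - \<rho>G v) * lx ^ ?e w = (p * lb * lx ^ (\<rho>B y - 1 - \<rho>G v) :: 'k R_Psi)"
      if "v \<in> Field \<Gamma>" "\<phi> v = w" for p v
    proof -
      have "\<rho>B w - \<rho>G v + ?e w = \<rho>B y - 1 - \<rho>G v"
        using rank_inc[OF that(1)] that(2) IF(2)[of w] w by auto
      then show ?thesis by (simp only: mult.assoc flip: power_add)
    qed
    then show "(T w - D w * lx) * lx ^ ?e w =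
      (\<Sum>v | v \<in> V y - {g0} \<and> \<phi> v = w. Psi_below \<Gamma> \<rho>G G.proper v * lb * lx ^ (\<rho>B y - 1 - \<rho>G v) :: 'k
          R_Psi)"
      using IF(1) w unfolding eq by (subst T_minus_D) (auto simp: sum_distrib_right intro!: sum.cong)
  qed
  \<comment> \<open>The fibres over the elements strictly between the bottom and \<open>y\<close>
    partition \<open>V y - {g0}\<close>, because only \<open>g0\<close> is mapped to the
    bottom.\<close>
  also have "\<dots> = (\<Sum>v \<in> V y - {g0}. Psi_below \<Gamma> \<rho>G G.proper v * lb * lx ^ (\<rho>B y - 1 - \<rho>G v))"
  proof (rule sum.group)
    show "finite (V y - {g0})" using finite_V by simp
    show "\<phi> ` (V y - {g0}) \<subseteq> ?I - {b0}"
      using phi_eq_bot by (auto simp: V_def)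
  qed (use fI in simp)
  also have "lx ^ (\<rho>B y - 1) + \<dots> = D y"
    unfolding D_def Psi_rec[OF graded_set_V]
    by (intro arg_cong2[of _ _ _ _ "(+)"] sum.cong refl) (simp only: V_lower_set)
  finally show ?case ..
qed

end

section \<open>The mixed cd-index\<close>

lemma linear_H_Omega [linear_intros]: "linear_map F \<Longrightarrow> linear_map (\<lambda>p. H_Omega (F p))"
  unfolding H_Omega_def by (intro linear_intros)

lemma linear_L_Omega [linear_intros]: "linear_map F \<Longrightarrow> linear_map (\<lambda>p. L_Omega (F p))"
  unfolding L_Omega_def by (intro linear_intros)

lemma linear_L'_Omega [linear_intros]: "linear_map F \<Longrightarrow> linear_map (\<lambda>p. L'_Omega (F p))"
  unfolding L'_Omega_def by (intro linear_intros)

lemma linear_map_G [linear_intros]: "linear_map F \<Longrightarrow> linear_map (\<lambda>p. map_G (F p))"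
  unfolding map_G_def by (intro linear_intros)

lemma linear_map_Gstar [linear_intros]: "linear_map F \<Longrightarrow> linear_map (\<lambda>p. map_Gstar (F p))"
  unfolding map_Gstar_def by (intro linear_intros)

lemma linear_subst_prod [linear_intros]: "linear_map F \<Longrightarrow> linear_map (\<lambda>p. subst_prod (F p))"
  unfolding subst_prod_def subst_tu_def by (intro linear_intros)

lemma linear_subst_quot [linear_intros]: "linear_map F \<Longrightarrow> linear_map (\<lambda>p. subst_quot (F p))"
  unfolding subst_quot_def subst_tu_def by (intro linear_intros)

lemma linear_map_G' [linear_intros]: "linear_map F \<Longrightarrow> linear_map (\<lambda>p. map_G' (F p))"
  unfolding map_G'_def by (intro linear_intros)

lemma cd_to_ab_e_W: "cd_to_ab_e (mon (W w)) = words_to_e (cd_to_ab (mon w))"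
  by (simp flip: words_to_e_mon add: cd_to_ab_e_words)

lemma H_Omega_tensor_words:
  "H_Omega (tensor p (words_to_e q)) = ab_G (cd_to_ab p * cd_to_ab q)"
proof (rule linear_map_ext2[where F = "\<lambda>p q. H_Omega (tensor p (words_to_e q))"
      and G = "\<lambda>p q. ab_G (cd_to_ab p * cd_to_ab q)"])
  fix v w :: "cd list"
  show "H_Omega (tensor (mon v) (words_to_e (mon w))) =
      (ab_G (cd_to_ab (mon v) * cd_to_ab (mon w)) :: 'a poly_tu)"
    by (simp add: H_Omega_def cd_to_ab_e_W map_G_words mon_append cd_to_ab_mult del: mult_single)
qed (intro linear_intros)+

lemma H_Omega_tensor_E: "H_Omega (tensor p (mon E)) = ab_F (cd_to_ab p)"
  by (rule linear_map_ext[where F = "\<lambda>p. H_Omega (tensor p (mon E))" and G = "\<lambda>p. ab_F (cd_to_ab p)"])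
    (intro linear_intros | simp add: H_Omega_def cd_to_ab_e_W map_F_words)+

lemma homog_words_to_e: "homog cd_deg n p \<Longrightarrow> homog deg_emon n (words_to_e p)"
  unfolding words_to_e_def by (rule homog_lin) (auto intro: homog_mon)

lemma homog_tensor:
  assumes "homog cd_deg i p" "homog deg_emon j q"
  shows "homog deg_Omega (i + j) (tensor p q)"
  unfolding tensor_def
  by (rule homog_lin[OF assms(1)], rule homog_lin[OF assms(2)]) (auto intro: homog_mon)

lemma L'_Omega_homog:
  assumes "homog deg_Omega d p"
  shows "L'_Omega p = t'u' ^ nat (d + 1) * subst_quot (L_Omega p)"
proof -
  have "t'u' ^ nat (d + 1) * subst_quot (L_Omega p) =
      lin (\<lambda>m. t'u' ^ nat (d + 1) * subst_quot (L_Omega (mon m))) p"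
    by (rule linear_map_eq_lin) (intro linear_intros)
  also have "\<dots> = L'_Omega p"
    unfolding L'_Omega_def lin_eq_sum_scale using assms
    by (intro sum.cong) (auto simp: homog_def)
  finally show ?thesis ..
qed

lemma of_int_coeffs_subst_tu:
  fixes x y :: "int laurent"
  shows "of_int_coeffs (subst_tu x y p) = (subst_tu (of_int_coeffs x) (of_int_coeffs y)
      (of_int_coeffs p) :: 'k::comm_ring_1 laurent)"
proof -
  have "(\<lambda>m. of_int_coeffs (case m of (i, j) \<Rightarrow> x ^ i * y ^ j)) =
      (\<lambda>(i, j). of_int_coeffs x ^ i * of_int_coeffs y ^ j :: 'k laurent)"
    by (auto simp: fun_eq_iff of_int_coeffs_mult of_int_coeffs_power)
  then show ?thesis by (simp add: subst_tu_def of_int_coeffs_lin)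
qed

lemma of_int_coeffs_subst [simp]:
  "of_int_coeffs (subst_quot p) = subst_quot (of_int_coeffs p)"
  "of_int_coeffs (subst_prod p) = subst_prod (of_int_coeffs p)"
  "of_int_coeffs t'u' = t'u'"
  by (simp_all add: subst_quot_def subst_prod_def t'u'_def of_int_coeffs_subst_tu)

lemma subst_prod_one [simp]: "subst_prod 1 = 1"
proof -
  have "subst_prod (mon (0, 0)) = 1" by (simp add: subst_prod_def subst_tu_def)
  then show ?thesis unfolding zero_prod_def[symmetric] single_one .
qed

context formal_subdivision
begin

section \<open>The coproduct of the cd-index of an interval\<close>

lemma interval_Psi:
  assumes "(x, y) \<in> B"
  shows "Psi (interval B x y) (\<lambda>w. \<rho>B w - \<rho>B x) (Field (interval B x y) - {x, y}) (\<rho>B y - \<rho>B x - 1) =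
    (P x y :: 'k::comm_ring_1 R_Psi)"
proof -
  have "Field (interval B x y) - {x, y} = {w. (x, w) \<in> B \<and> w \<noteq> x \<and> (w, y) \<in> B \<and> w \<noteq> y}"
    unfolding B.Field_interval by auto
  moreover have "Psi (interval B x y) (\<lambda>w. \<rho>B w - \<rho>B x) {w. (x, w) \<in> B \<and> w \<noteq> x \<and> (w, y) \<in> B \<and> w \<noteq> y} m =
      (Psi B (\<lambda>w. \<rho>B w - \<rho>B x) {w. (x, w) \<in> B \<and> w \<noteq> x \<and> (w, y) \<in> B \<and> w \<noteq> y} m :: 'k R_Psi)" for m
    by (rule Psi_cong) (auto simp: interval_def)
  ultimately show ?thesis unfolding P_def by simp
qed

abbreviation Phi :: "'b \<Rightarrow> 'b \<Rightarrow> 'k::field_char_0 Re_Phi" where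
  "Phi x y \<equiv> cd_index (interval B x y)"

lemma Phi_refl: "x \<in> Field B \<Longrightarrow> Phi x x = mon E"
  using B.poset_rank_interval[of x x] B.rel_refl by (simp add: cd_index_def)

lemma Phi_words:
  assumes "(x, y) \<in> B" "x \<noteq> y"
  obtains p where "Phi x y = (words_to_e p :: 'k::field_char_0 Re_Phi)" "cd_to_ab p = P x y"
    "homog cd_deg (int (\<rho>B y - \<rho>B x - 1)) p"
proof -
  interpret I: eulerian_poset "interval B x y" x "\<lambda>w. \<rho>B w - \<rho>B x" "\<rho>B y - \<rho>B x" y
    by (rule B.interval_eulerian[OF assms(1)])
  show thesis
    using I.cd_index_pos[OF assms(2), where ?'k = 'k] that unfolding interval_Psi[OF assms(1)] by blast
qed

lemma homog_Phi:
  assumes "(x, y) \<in> B"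
  shows "homog deg_emon (int (\<rho>B y) - int (\<rho>B x) - 1) (Phi x y :: 'k::field_char_0 Re_Phi)"
proof (cases "x = y")
  case True
  then show ?thesis using assms B.in_Field by (simp add: Phi_refl homog_mon)
next
  case False
  obtain p :: "'k R_Phi" where p: "Phi x y = words_to_e p" "homog cd_deg (int (\<rho>B y - \<rho>B x - 1)) p"
    using Phi_words[OF assms False] by metis
  have "int (\<rho>B y - \<rho>B x - 1) = int (\<rho>B y) - int (\<rho>B x) - 1"
    using B.rank_less[OF assms False] by simp
  then show ?thesis using homog_words_to_e[OF p(2)] unfolding p(1) by simp
qed

definition PE :: "'b \<Rightarrow> 'b \<Rightarrow> 'k::comm_ring_1 Re_Psi" where
  "PE x y = (if x = y then mon E else words_to_e (P x y))"

lemma cd_to_ab_e_Phi: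
  assumes "(x, y) \<in> B"
  shows "cd_to_ab_e (Phi x y :: 'k::field_char_0 Re_Phi) = PE x y"
proof (cases "x = y")
  case True
  then show ?thesis using assms B.in_Field by (simp add: Phi_refl PE_def)
next
  case False
  obtain p :: "'k R_Phi" where "Phi x y = words_to_e p" "cd_to_ab p = P x y"
    using Phi_words[OF assms False] by metis
  then show ?thesis using False by (simp add: PE_def cd_to_ab_e_words)
qed

lemma deriv_P:
  "deriv (P x y) = (\<Sum>w | (x, w) \<in> B \<and> w \<noteq> x \<and> (w, y) \<in> B \<and> w \<noteq> y. tensor (P x w) (P w y ::
      'k::comm_ring_1 R_Psi))"
proof -
  let ?A = "{w. (x, w) \<in> B \<and> w \<noteq> x \<and> (w, y) \<in> B \<and> w \<noteq> y}"
  have "Psi_below B (\<lambda>w. \<rho>B w - \<rho>B x) ?A w = (P x w :: 'k R_Psi)" if "w \<in> ?A" for w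
    unfolding below_open[OF that] P_def ..
  moreover have "Psi B (\<lambda>v. \<rho>B v - \<rho>B x - (\<rho>B w - \<rho>B x)) (above B ?A w) (\<rho>B y - \<rho>B x - 1 - (\<rho>B w -
      \<rho>B x)) =
      (P w y :: 'k R_Psi)" if w: "w \<in> ?A" for w
  proof -
    have lt: "\<rho>B x < \<rho>B w" using w B.rank_less by auto
    then have "\<rho>B y - \<rho>B x - 1 - (\<rho>B w - \<rho>B x) = \<rho>B y - \<rho>B w - 1" by simp
    then show ?thesis
      unfolding above_open[OF w] P_def using lt by (auto intro!: Psi_cong)
  qed
  ultimately show ?thesis
    unfolding P_def[of x y] Psi_deriv[OF graded_set_open[of x y]] by (intro sum.cong) auto
qed

text \<open>The two endpoints of the interval provide the terms with \<open>E\<close>, and its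
  interior provides the derivation.\<close>

lemma Delta_PE:
  assumes "(x, y) \<in> B"
  shows "Delta (PE x y) = (\<Sum>w | (x, w) \<in> B \<and> (w, y) \<in> B. tensor (PE x w) (PE w y :: 'k::comm_ring_1
      Re_Psi))"
proof (cases "x = y")
  case True
  then have "{w. (x, w) \<in> B \<and> (w, y) \<in> B} = {x}" using assms B.rel_antisym by auto
  then show ?thesis using True by (simp add: PE_def Delta_def)
next
  case False
  let ?A = "{w. (x, w) \<in> B \<and> w \<noteq> x \<and> (w, y) \<in> B \<and> w \<noteq> y}"
  have "{w. (x, w) \<in> B \<and> (w, y) \<in> B} = insert x (insert y ?A)"
    using assms B.rel_refl B.in_Field by auto
  moreover have "finite ?A" by (rule B.fin_le)
  ultimately have "(\<Sum>w | (x, w) \<in> B \<and> (w, y) \<in> B. tensor (PE x w) (PE w y :: 'k Re_Psi)) =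
      tensor (mon E) (PE x y) + (tensor (PE x y) (mon E) + (\<Sum>w \<in> ?A. tensor (PE x w) (PE w y)))"
    using False by (simp add: PE_def)
  also have "(\<Sum>w \<in> ?A. tensor (PE x w) (PE w y :: 'k Re_Psi)) =
      (\<Sum>w \<in> ?A. tensor (words_to_e (P x w)) (words_to_e (P w y)))"
    by (intro sum.cong) (auto simp: PE_def)
  also have "\<dots> = tensor_map words_to_e words_to_e (deriv (P x y))"
    unfolding deriv_P linear_map_sum[OF linear_tensor_map[OF linear_ident]]
    by (simp add: tensor_map_tensor linear_intros)
  finally show ?thesis
    using False by (simp add: PE_def Delta_words_to_e)
qed

lemma Delta_Phi_Phi:
  assumes "(x, y) \<in> B"
  shows "Delta_Phi (Phi x y) = (\<Sum>w | (x, w) \<in> B \<and> (w, y) \<in> B. tensor (Phi x w) (Phi w y ::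
      'k::field_char_0 Re_Phi))"
proof (rule Delta_Phi_eqI)
  show "tensor_map cd_to_ab_e cd_to_ab_e (\<Sum>w | (x, w) \<in> B \<and> (w, y) \<in> B. tensor (Phi x w) (Phi w y)) =
      Delta (cd_to_ab_e (Phi x y :: 'k Re_Phi))"
    unfolding cd_to_ab_e_Phi[OF assms] Delta_PE[OF assms] linear_map_sum[OF linear_tensor_map[OF
        linear_ident]]
    by (intro sum.cong) (auto simp: tensor_map_tensor linear_intros cd_to_ab_e_Phi)
qed

text \<open>The mixed cd-index of the part over the interval up to \<open>y\<close>. All
  \<open>y\<close> have to be considered, because \<open>varrho\<close> splits \<open>Om y\<close>
  into the \<open>Om w\<close> with \<open>w\<close> below \<open>y\<close>.\<close>

definition Om :: "'b \<Rightarrow> 'k::field_char_0 R_Omega" where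
  "Om y = (\<Sum>x | (x, y) \<in> B. tensor (ell x) (Phi x y))"

lemma mixed_cd_index_eq: "mixed_cd_index \<Gamma> B \<phi> = (Om b1 :: 'k::field_char_0 R_Omega)"
proof -
  have "{x. (x, b1) \<in> B} = Field B" using B.top_greatest B.in_Field by blast
  then show ?thesis by (simp add: mixed_cd_index_def Om_def B.one_hat_eq)
qed

lemma varrho_Om:
  "varrho (Om y) = (\<Sum>w | (w, y) \<in> B. tensor (Om w) (Phi w y :: 'k::field_char_0 Re_Phi))"
proof -
  let ?I = "{x. (x, y) \<in> B}"
  let ?t = "\<lambda>x w. tensor (tensor (ell x) (Phi x w)) (Phi w y :: 'k Re_Phi)"
  have fI: "finite ?I" using B.fin_le(2)[of y "\<lambda>_. True"] by simp
  have "varrho (Om y :: 'k R_Omega) = (\<Sum>x \<in> ?I. varrho (tensor (ell x) (Phi x y)))"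
    unfolding Om_def by (rule linear_map_sum) (intro linear_intros)
  also have "\<dots> = (\<Sum>x \<in> ?I. \<Sum>w | w \<in> ?I \<and> (x, w) \<in> B. ?t x w)"
  proof (rule sum.cong[OF refl])
    fix x assume "x \<in> ?I"
    then have "varrho (tensor (ell x) (Phi x y :: 'k Re_Phi)) = (\<Sum>w | (x, w) \<in> B \<and> (w, y) \<in> B. ?t x w)"
      by (intro varrho_tensor Delta_Phi_Phi) simp
    moreover have "{w. (x, w) \<in> B \<and> (w, y) \<in> B} = {w. w \<in> ?I \<and> (x, w) \<in> B}" by auto
    ultimately show "varrho (tensor (ell x) (Phi x y :: 'k Re_Phi)) = (\<Sum>w | w \<in> ?I \<and> (x, w) \<in> B. ?t x w)"
      by simp
  qed
  also have "\<dots> = (\<Sum>w \<in> ?I. \<Sum>x | x \<in> ?I \<and> (x, w) \<in> B. ?t x w)"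
    by (rule sum.swap_restrict[OF fI fI])
  also have "\<dots> = (\<Sum>w \<in> ?I. tensor (Om w) (Phi w y))"
  proof (rule sum.cong[OF refl])
    fix w assume w: "w \<in> ?I"
    then have "{x. x \<in> ?I \<and> (x, w) \<in> B} = {x. (x, w) \<in> B}" using B.rel_trans by blast
    then show "(\<Sum>x | x \<in> ?I \<and> (x, w) \<in> B. ?t x w) = tensor (Om w) (Phi w y)"
      by (simp add: Om_def tensor_sum_left)
  qed
  finally show ?thesis .
qed

text \<open>The degrees of the two factors add up to \<open>\<rho>B y - 1\<close> for every
  \<open>x\<close>, including \<open>x = y\<close> since \<open>E\<close> has degree -1. Adding 1
  gives the exponent of \<open>t'u'\<close> in the mixed h-polynomial.\<close>

lemma homog_Om: "homog deg_Omega (int (\<rho>B y) - 1) (Om y :: 'k::field_char_0 R_Omega)"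
  unfolding Om_def
proof (rule homog_sum)
  fix x assume "x \<in> {x. (x, y) \<in> B}"
  then have x: "(x, y) \<in> B" by simp
  have "homog deg_Omega (int (\<rho>B x) + (int (\<rho>B y) - int (\<rho>B x) - 1)) (tensor (ell x) (Phi x y :: 'k
      Re_Phi))"
    by (rule homog_tensor[OF homog_ell[OF B.in_Field(1)[OF x]] homog_Phi[OF x]])
  then show "homog deg_Omega (int (\<rho>B y) - 1) (tensor (ell x) (Phi x y :: 'k Re_Phi))" by simp
qed

section \<open>Values of the linear maps on the mixed cd-index\<close>

lemma h_poly_sub:
  assumes x: "x \<in> Field B"
  shows "of_int_coeffs (h_poly (subdiv_below \<Gamma> B \<phi> x)) = (ab_F (T x) :: 'k::comm_ring_1 poly_tu)"
proof -
  interpret R: lower_eulerian_poset "Restr \<Gamma> (U x)" g0 \<rho>G "\<rho>B x"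
    by (rule sub_lower_eulerian[OF x])
  have "Field (Restr \<Gamma> (U x)) = U x" using Field_Restr[OF G.rel_Refl] V_subset by blast
  then show ?thesis
    unfolding subdiv_below_eq R.h_poly_eq T_def of_int_coeffs_ab_F of_int_coeffs_Psi
    by (simp add: Psi_Restr Diff_subset)
qed

lemma H_Omega_Om:
  assumes y: "y \<in> Field B"
  shows "H_Omega (Om y) = (of_int_coeffs (h_poly (subdiv_below \<Gamma> B \<phi> y)) :: 'k::field_char_0 poly_tu)"
proof -
  let ?I = "{x. (x, y) \<in> B \<and> x \<noteq> y}"
  have I: "{x. (x, y) \<in> B} = insert y ?I" using y B.rel_refl by auto
  have fI: "finite ?I" by (rule B.fin_le)
  have H: "H_Omega (tensor (ell x) (Phi x y)) = (ab_G (Lam x * P x y) :: 'k poly_tu)" if x: "x \<in> ?I"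
      for x
  proof -
    obtain p :: "'k R_Phi" where p: "Phi x y = words_to_e p" "cd_to_ab p = P x y"
      using Phi_words[of x y] x by blast
    have "cd_to_ab (ell x :: 'k R_Phi) = Lam x"
      using cd_to_ab_ell B.in_Field x by blast
    then show ?thesis
      unfolding p(1) H_Omega_tensor_words p(2) by simp
  qed
  have "H_Omega (Om y :: 'k R_Omega) = H_Omega (tensor (ell y) (Phi y y)) + (\<Sum>x \<in> ?I. H_Omega
      (tensor (ell x) (Phi x y)))"
    unfolding Om_def linear_map_sum[OF linear_H_Omega[OF linear_ident]] I using fI by simp
  also have "\<dots> = ab_F (Lam y) + ab_G (\<Sum>x \<in> ?I. Lam x * P x y)"
    using H by (simp add: Phi_refl[OF y] H_Omega_tensor_E cd_to_ab_ell[OF y] ab_G_sum)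
  also have "\<dots> = ab_F (T y)"
  proof (cases "y = b0")
    case True
    \<comment> \<open>Over the bottom there is no boundary to cancel; both \<open>T y\<close> and
      \<open>Lam y\<close> are 1.\<close>
    have 1: "U y - {g0} = {}" using True phi_eq_bot B.rel_antisym B.bot_least phi_in unfolding U_def
        by blast
    have 2: "{C. C \<in> Chains \<Gamma> \<and> C \<subseteq> {}} = {{}}" by (auto simp: Chains_def)
    have "T y = (1 :: 'k R_Psi)"
      unfolding T_def 1 Psi_def 2 using True by (simp add: B.rank_bot chain_word_def)
    moreover have I0: "?I = {}" using True B.rel_antisym B.bot_least B.in_Field by blast
    ultimately show ?thesis
      unfolding I0 using True by (simp add: Lam_def linear_map_zero[OF linear_ab_G[OF linear_ident]])
  next
    case False
    \<comment> \<open>This cancels the correction term of \<open>Lam y\<close> against G of the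
      decomposed boundary.\<close>
    have "ab_F (D y * la) = (ab_G (D y) :: 'k poly_tu)"
      unfolding D_def by (rule F_Psi_a[OF sphere_V[OF y False]])
    then show ?thesis
      unfolding decomposition[OF y False, symmetric] using False by (simp add: Lam_def ab_F_minus)
  qed
  finally show ?thesis by (simp add: h_poly_sub[OF y])
qed

text \<open>For a nontrivial interval the ab-words have length one less than its rank, so the
  exponent \<open>length w + 1\<close> in \<open>Gstar_mon\<close> is that rank. Reversal of words
  corresponds to the dual interval.\<close>

lemma map_Gstar_Phi:
  assumes xy: "(x, y) \<in> B"
  shows "map_Gstar (cd_to_ab_e (Phi x y)) =
    (of_int_coeffs ((- 1) ^ poset_rank (interval B x y) * g_poly ((interval B x y)\<inverse>)) ::
        'k::field_char_0 poly_tu)"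
proof (cases "x = y")
  case True
  have x: "x \<in> Field B" using xy B.in_Field by blast
  have "(interval B x x)\<inverse> = {(x, x)}" by (auto simp: B.interval_refl[OF x])
  then show ?thesis
    using True x B.poset_rank_interval[OF xy] by (simp add: Phi_refl map_Gstar_def B.g_poly_singleton)
next
  case False
  interpret I: eulerian_poset "interval B x y" x "\<lambda>w. \<rho>B w - \<rho>B x" "\<rho>B y - \<rho>B x" y
    by (rule B.interval_eulerian[OF xy])
  have n: "\<rho>B y - \<rho>B x - 1 + 1 = \<rho>B y - \<rho>B x" using B.rank_less[OF xy False] by simp
  have hP: "homog len (int (\<rho>B y - \<rho>B x - 1)) (P x y :: 'k R_Psi)" unfolding P_def by (rule homog_Psi)
  have "map_Gstar (cd_to_ab_e (Phi x y :: 'k Re_Phi)) = (- 1) ^ (\<rho>B y - \<rho>B x) * ab_G (rev_words (P x y))"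
    unfolding cd_to_ab_e_Phi[OF xy] using False map_Gstar_words[OF hP] unfolding n by (simp add: PE_def)
  moreover have "of_int_coeffs (g_poly ((interval B x y)\<inverse>)) = (ab_G (rev_words (P x y)) :: 'k poly_tu)"
    unfolding I.g_poly_dual[OF False] interval_Psi[OF xy] of_int_coeffs_ab_G of_int_coeffs_rev_words
    unfolding P_def of_int_coeffs_Psi ..
  ultimately show ?thesis
    by (simp add: of_int_coeffs_mult of_int_coeffs_sign B.poset_rank_interval[OF xy])
qed

lemma map_G'_Phi:
  assumes xy: "(x, y) \<in> B"
  shows "map_G' (Phi x y) = (subst_prod (of_int_coeffs (g_poly (interval B x y))) ::
      'k::field_char_0 laurent)"
proof (cases "x = y")
  case True
  have y: "y \<in> Field B" using xy B.in_Field by blast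
  show ?thesis
    unfolding True map_G'_def Phi_refl[OF y] unfolding B.interval_refl[OF y] B.g_poly_singleton
    by (simp add: map_G_def)
next
  case False
  interpret I: eulerian_poset "interval B x y" x "\<lambda>w. \<rho>B w - \<rho>B x" "\<rho>B y - \<rho>B x" y
    by (rule B.interval_eulerian[OF xy])
  have "of_int_coeffs (g_poly (interval B x y)) = (ab_G (P x y) :: 'k poly_tu)"
    unfolding I.g_poly_eq[OF False] interval_Psi[OF xy] of_int_coeffs_ab_G
    unfolding P_def of_int_coeffs_Psi ..
  then show ?thesis
    unfolding map_G'_def cd_to_ab_e_Phi[OF xy] using False by (simp add: PE_def map_G_words)
qed

definition local_h :: "'b \<Rightarrow> int poly_tu" where
  "local_h y = (\<Sum>x | (x, y) \<in> B. h_poly (subdiv_below \<Gamma> B \<phi> x) *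
     (- 1) ^ poset_rank (interval B x y) * g_poly ((interval B x y)\<inverse>))"

lemma local_h_poly_eq: "local_h_poly \<Gamma> B \<phi> = local_h b1"
proof -
  have "{x. (x, b1) \<in> B} = Field B" using B.top_greatest B.in_Field by blast
  then show ?thesis by (simp add: local_h_poly_def local_h_def B.one_hat_eq)
qed

text \<open>\<open>mixed_h_poly\<close> takes the local h-polynomial of a restricted subdivision.
  Restricting it further yields the same subposets and intervals as restricting the original one, so
  the locale need not be instantiated again.\<close>

lemma local_h_poly_sub:
  assumes y: "y \<in> Field B"
  shows "local_h_poly (subdiv_below \<Gamma> B \<phi> y) (interval B b0 y) \<phi> = local_h y"
proof -
  have b0y: "(b0, y) \<in> B" by (rule B.bot_least[OF y])
  interpret I: eulerian_poset "interval B b0 y" b0 "\<lambda>w. \<rho>B w - \<rho>B b0" "\<rho>B y - \<rho>B b0" y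
    by (rule B.interval_eulerian[OF b0y])
  have F: "Field (interval B b0 y) = {x. (x, y) \<in> B}"
    unfolding B.Field_interval using B.bot_least B.in_Field by auto
  have s: "subdiv_below (subdiv_below \<Gamma> B \<phi> y) (interval B b0 y) \<phi> x = subdiv_below \<Gamma> B \<phi> x" if x:
      "(x, y) \<in> B" for x
  proof -
    have Ux: "U x \<subseteq> U y" using B.rel_trans[OF _ x] by (auto simp: U_def)
    have "{v \<in> Field (Restr \<Gamma> (U y)). (\<phi> v, x) \<in> interval B b0 y} = U x"
    proof -
      have "Field (Restr \<Gamma> (U y)) = U y" using Field_Restr[OF G.rel_Refl] V_subset by blast
      moreover have "(\<phi> v, x) \<in> interval B b0 y \<longleftrightarrow> (\<phi> v, x) \<in> B" for v
        using x B.rel_trans[OF _ x] B.bot_least B.in_Field by (auto simp: interval_def)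
      ultimately show ?thesis using Ux by (auto simp: U_def)
    qed
    then show ?thesis
      unfolding subdiv_below_eq using Ux unfolding subdiv_below_def by auto
  qed
  have i: "interval (interval B b0 y) x y = interval B x y" if "(x, y) \<in> B" for x
    by (rule B.interval_interval) (use that B.bot_least B.in_Field B.rel_refl in auto)
  show ?thesis
    unfolding local_h_poly_def local_h_def F I.one_hat_eq by (intro sum.cong) (auto simp: s i)
qed

lemma L_Omega_Om:
  "L_Omega (Om y) = (of_int_coeffs (local_h y) :: 'k::field_char_0 poly_tu)"
proof -
  have "L_Omega (Om y :: 'k R_Omega) = (\<Sum>w | (w, y) \<in> B.
      nabla_tensor H_Omega (\<lambda>q. map_Gstar (cd_to_ab_e q)) (tensor (Om w) (Phi w y)))"
    unfolding L_Omega_def varrho_Om by (rule linear_map_sum) (intro linear_intros)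
  also have "\<dots> = (\<Sum>w | (w, y) \<in> B. H_Omega (Om w) * map_Gstar (cd_to_ab_e (Phi w y)))"
    by (intro sum.cong refl nabla_tensor_tensor linear_intros)
  also have "\<dots> = of_int_coeffs (local_h y)"
    unfolding local_h_def of_int_coeffs_sum using B.in_Field
    by (intro sum.cong) (auto simp: H_Omega_Om map_Gstar_Phi of_int_coeffs_mult mult.assoc)
  finally show ?thesis .
qed

lemma H'_Omega_Om_top:
  "H'_Omega (Om b1) = (of_int_coeffs (mixed_h_poly \<Gamma> B \<phi>) :: 'k::field_char_0 laurent)"
proof -
  have F: "{x. (x, b1) \<in> B} = Field B" using B.top_greatest B.in_Field by blast
  have "H'_Omega (Om b1 :: 'k R_Omega) = (\<Sum>w | (w, b1) \<in> B.
      nabla_tensor L'_Omega map_G' (tensor (Om w) (Phi w b1)))"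
    unfolding H'_Omega_def varrho_Om by (rule linear_map_sum) (intro linear_intros)
  also have "\<dots> = (\<Sum>w | (w, b1) \<in> B. L'_Omega (Om w) * map_G' (Phi w b1))"
    by (intro sum.cong refl nabla_tensor_tensor linear_intros)
  also have "\<dots> = of_int_coeffs (mixed_h_poly \<Gamma> B \<phi>)"
    unfolding mixed_h_poly_def of_int_coeffs_sum F B.one_hat_eq B.zero_hat_eq
  proof (rule sum.cong[OF refl])
    fix w assume w: "w \<in> Field B"
    have rk: "poset_rank (subdiv_below \<Gamma> B \<phi> w) = \<rho>B w"
      unfolding subdiv_below_eq by (rule ranked_poset.poset_rank_eq[OF sub_ranked[OF w]])
    show "L'_Omega (Om w) * map_G' (Phi w b1) = (of_int_coeffs (t'u' ^ poset_rank (subdiv_below \<Gamma> B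
        \<phi> w) *
        subst_quot (local_h_poly (subdiv_below \<Gamma> B \<phi> w) (interval B b0 w) \<phi>) *
        subst_prod (g_poly (interval B w b1))) :: 'k laurent)"
      unfolding L'_Omega_homog[OF homog_Om] L_Omega_Om map_G'_Phi[OF B.top_greatest[OF w]]
        rk local_h_poly_sub[OF w]
      by (simp add: of_int_coeffs_mult of_int_coeffs_power)
  qed
  finally show ?thesis .
qed

end

theorem theorem1p2:
  fixes \<Gamma> :: "'a rel" and B :: "'b rel" and \<phi> :: "'a \<Rightarrow> 'b"
  assumes "lower_eulerian \<Gamma>"
    and "eulerian B"
    and "strong_formal_subdivision \<Gamma> B \<phi>"
  shows "L_Omega (mixed_cd_index \<Gamma> B \<phi> :: 'k::field_char_0 R_Omega) =
           of_int_coeffs (local_h_poly \<Gamma> B \<phi>) \<and>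
         H'_Omega (mixed_cd_index \<Gamma> B \<phi> :: 'k R_Omega) =
           of_int_coeffs (mixed_h_poly \<Gamma> B \<phi>)"
proof -
  interpret G: lower_eulerian_poset \<Gamma> "zero_hat \<Gamma>" "rho \<Gamma>" "poset_rank \<Gamma>"
    by (rule lower_eulerian_lower_eulerian_poset[OF assms(1)])
  interpret B: eulerian_poset B "zero_hat B" "rho B" "poset_rank B" "one_hat B"
    by (rule eulerian_eulerian_poset[OF assms(2)])
  interpret formal_subdivision \<Gamma> "zero_hat \<Gamma>" "rho \<Gamma>" "poset_rank \<Gamma>" B "zero_hat B" "rho B" "poset_rank B" "one_hat B" \<phi>
  proof
    show "\<exists>y'. (y, y') \<in> \<Gamma> \<and> \<phi> y' = x \<and> rho \<Gamma> y' = rho B x"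
      and "(\<Sum>y' | (y, y') \<in> \<Gamma> \<and> \<phi> y' = x. (- 1) ^ rho \<Gamma> y') = ((- 1) ^ rho B x :: int)"
      if "y \<in> Field \<Gamma>" "(\<phi> y, x) \<in> B" for y x
      using assms(3) that B.in_Field unfolding strong_formal_subdivision_def by blast+
  qed (use assms(3) in \<open>auto simp: strong_formal_subdivision_def\<close>)
  show ?thesis
    unfolding mixed_cd_index_eq L_Omega_Om H'_Omega_Om_top local_h_poly_eq by simp
qed

end
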